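(* Let $h:\mathbb{R}^M\to\mathbb{R}$, let $Q\in\mathbb{R}^{M\times M}$, and let $\{x(k)\}_{k\ge1}\subset\mathbb{R}^M$ satisfy, for $k\ge1$, $$x(k+1)=x(k)-\alpha_k\big(v(k)+\gamma_kQx(k)+\xi(k+1)\big),\qquad v(k)\in\partial h(x(k)),$$ where $\{\xi(k)\}_{k\ge1}$ is a martingale difference sequence with respect to $(\mathcal{F}_k)$. Let $\mathcal{C}=\{x\in\mathbb{R}^M:x^{\top}Qx=0\}$ and let $x^*\in\mathcal{C}$ be a regular saddle point of $h|_{\mathcal{C}}$. Suppose: (1) $h$ is locally Lipschitz continuous; (2) for some $R>0$ and $C_1,C_2>0$, $\langle x,v\rangle\ge C_1\|x\|\|v\|$ and $\|v\|\le C_2\|x\|$ for all $v\in\partial h(x)$ and $\|x\|\ge R$; (3) $Q$ is positive semidefinite with at least one zero eigenvalue; (4) $\alpha_k=\Theta(k^{-\tau_\alpha})$ and $\gamma_k=\Theta(k^{\tau_\gamma})$ where $\frac12<\tau_\gamma<\tau_\alpha\le1$, and $\alpha_k,\gamma_k\neq0$; (5) for all $k\ge1$, $\mathbb{E}(P_{\mathcal{C}}\,\xi(k)\mid\mathcal{F}_{k-1})=0$ and $\mathbb{E}(\|\xi(k)\|^2\mid\mathcal{F}_{k-1})<B$ for some $B>0$; (6) for some constant $c_1>0$, $\mathbb{E}\big((\xi(k)^{\top}\theta)^+\mid\mathcal{F}_{k-1}\big)\ge c_1$ for every unit vector $\theta\in\mathcal{C}$ and all $k\ge1$; (7) for each $x$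 near $x^*$ there exists an orthonormal matrix $U(x)$ that diagonalizes $\nabla^2h(x)$, such that $x\mapsto U(x)$ is differentiable at $x^*$; (8) $h$ is $C^3$ in a neighborhood of $x^*$. Then for any initialization, $$\mathbb{P}\left(\lim_{k\to\infty}x(k)=x^*\right)=0.$$
   Context: For a locally Lipschitz function $h$, the generalized gradient is $\partial h(x)=\mathrm{co}\{\lim_{i\to\infty}\nabla h(x_i): x_i\to x,\ \nabla h(x_i)\text{ exists}\}$, where $\mathrm{co}$ denotes convex hull. Since $Q$ is positive semidefinite, $\mathcal{C}$ is the null space of $Q$; $P_{\mathcal{C}}$ is the orthogonal projection onto $\mathcal{C}$, and $h|_{\mathcal{C}}$ is the restriction of $h$ to the Euclidean space $\mathcal{C}$. A point $x^*\in\mathcal{C}$ is a regular saddle point of $h|_{\mathcal{C}}$ if $\nabla h|_{\mathcal{C}}(x^* )=0$, $x^*$ is neither a local maximum nor a local minimum of $h|_{\mathcal{C}}$, and the Hessian $\nabla^2h|_{\mathcal{C}}(x^* )$ is invertible. $\mathcal{F}_k=\sigma(\{x(j),\xi(j)\}_{j=1}^k)$ ($\mathcal{F}_0$ trivial). The initialization is a fixed deterministic point $x(1)\in\mathbb{R}^M$. $\|\cdot\|$ is the Euclidean norm, $(a)^+=\max\{0,a\}$. $g(k)=\Theta(h(k))$ means there are $a,b>0$ with $a\,h(k)\le g(k)\le b\,h(k)$ for all $k$ sufficiently large. *)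

theory Defs
  imports "HOL-Probability.Probability"
begin

section \<open>Differential notions\<close>

definition locally_lipschitz :: "('a::metric_space \<Rightarrow> 'b::metric_space) \<Rightarrow> bool" where
  "locally_lipschitz f \<longleftrightarrow> (\<forall>x. \<exists>u>0. \<exists>L. L-lipschitz_on (ball x u) f)"

definition generalized_gradient :: "('a::euclidean_space \<Rightarrow> real) \<Rightarrow> 'a \<Rightarrow> 'a set" where
  "generalized_gradient f x =
     convex hull {g. \<exists>X G. X \<longlonglongrightarrow> x \<and> (\<forall>i::nat. GDERIV f (X i) :> G i) \<and> G \<longlonglongrightarrow> g}"

(* For a linear subspace S, regarded as a Euclidean space of its own, this is the gradient of the
   restriction of f to S.  The condition g : S makes g unique, because the derivative
   "at x within S" is determined only on S. *)
definition has_gradient_on :: "('a::euclidean_space \<Rightarrow> real) \<Rightarrow> 'a \<Rightarrow> 'a \<Rightarrow> 'a set \<Rightarrow> bool" where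
  "has_gradient_on f g x S \<longleftrightarrow> g \<in> S \<and> (f has_derivative (\<lambda>d. g \<bullet> d)) (at x within S)"

(* The Hessian of the restriction of f to a subspace S, as the derivative of the gradient field;
   only the values of H on S matter, and H maps S to S. *)
definition has_hessian_on :: "('a::euclidean_space \<Rightarrow> real) \<Rightarrow> ('a \<Rightarrow> 'a) \<Rightarrow> 'a \<Rightarrow> 'a set \<Rightarrow> bool" where
  "has_hessian_on f H x S \<longleftrightarrow>
     (\<exists>G. (\<forall>\<^sub>F y in nhds x. y \<in> S \<longrightarrow> has_gradient_on f (G y) y S)
        \<and> (G has_derivative H) (at x within S))"

definition regular_saddle_point_on :: "('a::euclidean_space \<Rightarrow> real) \<Rightarrow> 'a set \<Rightarrow> 'a \<Rightarrow> bool" where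
  "regular_saddle_point_on f S x \<longleftrightarrow>
     x \<in> S \<and> has_gradient_on f 0 x S
     \<and> \<not> (\<forall>\<^sub>F y in at x within S. f y \<le> f x)
     \<and> \<not> (\<forall>\<^sub>F y in at x within S. f x \<le> f y)
     \<and> (\<exists>H. has_hessian_on f H x S \<and> bij_betw H S S)"

(* f is of class C^n on the open set S *)
primrec higher_differentiable_on ::
  "'a::real_normed_vector set \<Rightarrow> ('a \<Rightarrow> 'b::real_normed_vector) \<Rightarrow> nat \<Rightarrow> bool" where
  "higher_differentiable_on S f 0 \<longleftrightarrow> continuous_on S f"
| "higher_differentiable_on S f (Suc n) \<longleftrightarrow>
     (\<forall>x\<in>S. f differentiable (at x))
     \<and> (\<forall>v. higher_differentiable_on S (\<lambda>x. frechet_derivative f (at x) v) n)"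

section \<open>Linear algebra\<close>

(* Positive semidefinite matrices are taken to be symmetric. *)
definition positive_semidefinite :: "real^'n^'n \<Rightarrow> bool" where
  "positive_semidefinite A \<longleftrightarrow> transpose A = A \<and> (\<forall>x. 0 \<le> x \<bullet> (A *v x))"

definition eigenvalue :: "real^'n^'n \<Rightarrow> real \<Rightarrow> bool" where
  "eigenvalue A c \<longleftrightarrow> (\<exists>u. u \<noteq> 0 \<and> A *v u = c *\<^sub>R u)"

definition diagonal_matrix :: "real^'n^'n \<Rightarrow> bool" where
  "diagonal_matrix A \<longleftrightarrow> (\<forall>i j. i \<noteq> j \<longrightarrow> A $ i $ j = 0)"

definition orthogonal_projection :: "'a::euclidean_space set \<Rightarrow> 'a \<Rightarrow> 'a" where
  "orthogonal_projection S x = (THE y. y \<in> S \<and> (\<forall>z\<in>S. orthogonal (x - y) z))"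

lemma orthogonal_projection_ex1:
  fixes S :: "'a::euclidean_space set"
  assumes "subspace S"
  shows "\<exists>!y. y \<in> S \<and> (\<forall>z\<in>S. orthogonal (x - y) z)"
proof (rule ex_ex1I)
  have S: "span S = S"
    using assms by (simp add: span_eq_iff)
  obtain y z where "y \<in> span S" "\<And>w. w \<in> span S \<Longrightarrow> orthogonal z w" "x = y + z"
    using orthogonal_subspace_decomp_exists[of S x] by metis
  then show "\<exists>y. y \<in> S \<and> (\<forall>z\<in>S. orthogonal (x - y) z)"
    unfolding S by auto
next
  fix y y'
  assume y: "y \<in> S \<and> (\<forall>z\<in>S. orthogonal (x - y) z)"
    and y': "y' \<in> S \<and> (\<forall>z\<in>S. orthogonal (x - y') z)"
  then have "y - y' \<in> S"
    using assms by (simp add: subspace_diff)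
  then have "(x - y') \<bullet> (y - y') = 0" "(x - y) \<bullet> (y - y') = 0"
    using y y' by (auto simp: orthogonal_def)
  then have "(y - y') \<bullet> (y - y') = 0"
    by (simp add: inner_diff_left)
  then show "y = y'" by simp
qed

section \<open>Growth rates\<close>

(* Unlike bigtheta in HOL-Library.Landau_Symbols, this involves no absolute values, so g is
   eventually positive when h is. *)
definition theta_growth :: "(nat \<Rightarrow> real) \<Rightarrow> (nat \<Rightarrow> real) \<Rightarrow> bool" where
  "theta_growth g h \<longleftrightarrow>
     (\<exists>a>0. \<exists>b>0. \<forall>\<^sub>F k in sequentially. a * h k \<le> g k \<and> g k \<le> b * h k)"

section \<open>Stochastic processes\<close>

(* The sigma-algebra generated by X j, Y j for 1 <= j <= k; it is trivial for k = 0. *)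
definition history :: "'w measure \<Rightarrow> (nat \<Rightarrow> 'w \<Rightarrow> 'a::topological_space)
    \<Rightarrow> (nat \<Rightarrow> 'w \<Rightarrow> 'b::topological_space) \<Rightarrow> nat \<Rightarrow> 'w measure" where
  "history P X Y k = sigma (space P)
     (\<Union>j\<in>{1..k}. {X j -` A \<inter> space P | A. A \<in> sets borel}
                 \<union> {Y j -` A \<inter> space P | A. A \<in> sets borel})"

definition vec_cond_exp :: "'w measure \<Rightarrow> 'w measure \<Rightarrow> ('w \<Rightarrow> real^'n) \<Rightarrow> 'w \<Rightarrow> real^'n" where
  "vec_cond_exp P F f w = (\<chi> i. real_cond_exp P F (\<lambda>w. f w $ i) w)"

definition martingale_difference_sequence ::
  "'w measure \<Rightarrow> (nat \<Rightarrow> 'w measure) \<Rightarrow> (nat \<Rightarrow> 'w \<Rightarrow> real^'n) \<Rightarrow> bool" where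
  "martingale_difference_sequence P F Y \<longleftrightarrow>
     (\<forall>k\<ge>1. Y k \<in> borel_measurable (F k) \<and> integrable P (Y k)
        \<and> (AE w in P. vec_cond_exp P (F (k - 1)) (Y k) w = 0))"

end

theory Submission
  imports Defs
begin

text \<open>Suppose that the iterates converge to the saddle point with positive probability. Then at some
  late time \<open>n\<close> there is an event of the past, on which \<open>x n\<close> is nearly constant, that forces
  convergence with conditional probability close to 1. On this event run two independent copies of the
  process. Their difference obeys a linear recursion up to a small Lipschitz error, so its unstable
  component is repelled from 0; the penalty term, whose drift blows up, only adds a fast stable
  direction, and the constant part of its bias cancels. No stable manifold is needed because
  the second copy plays the role of a trajectory on it.

  The difference \<open>d\<close>, measured in units of \<open>\<sigma>\<close> with \<open>\<sigma>\<^sup>2\<close> a fixed multiple of the remaining sum of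
  the squared step sizes, is split into its unstable part \<open>u\<close> and the rest \<open>s\<close>. A function of \<open>(u, s)\<close>
  that equals 1 at the origin contracts in mean by a factor \<open>1 - g (\<alpha> k / \<sigma>)\<^sup>2\<close> at every step while
  both copies stay near the saddle point. The product of these factors is bounded away from 1
  independently of \<open>n\<close>, whereas convergence of both copies would force it to be nearly 1.\<close>

section \<open>Two scalar Lyapunov profiles\<close>

text \<open>Hence the profiles are explicit elementary functions whose increments under jumps of any
  size are controlled by the first two moments. The lower bound is used in a single unstable
  direction, while the noise in the stable directions may be much larger; the small weight
  \<open>kap\<close> of the stable part keeps it from cancelling the gain.

  The scale \<sigma> answers two demands. The total gain, a multiple of the sum of
  \<open>(\<alpha> k / \<sigma>)\<^sup>2\<close>, must not depend on the starting time. Away from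
  the origin the drift, of order \<open>\<alpha> k\<close>, must beat the noise, of order
  \<open>(\<alpha> k / \<sigma>)\<^sup>2\<close>, so \<open>\<alpha> k\<close> must be at most a
  small multiple of \<open>\<sigma>\<^sup>2\<close>. For steps of order
  \<open>k powr (- \<tau>)\<close> the tail of the squared steps has order
  \<open>n powr (1 - 2 * \<tau>)\<close>, and both demands are compatible because
  \<open>\<tau> \<le> 1\<close>.\<close>

lemma truncated_square_lower_bound:
  fixes y b M :: real
  assumes "0 \<le> y" "0 < M" "0 \<le> b"
  shows "b * (y - y\<^sup>2 / (4 * M)) - b\<^sup>2 / 2 \<le> y\<^sup>2 / (1 + y\<^sup>2 / M\<^sup>2)"
proof -
  \<comment> \<open>The truncation \<open>m\<close> is at least
    \<open>y - y\<^sup>2 / (4 * M)\<close>, and \<open>m\<^sup>2\<close> lies above its tangent at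
    \<open>b\<close>. The resulting bound is affine in \<open>y\<close> and
    \<open>y\<^sup>2\<close>, so a lower bound for the first moment and an upper bound for the
    second give a lower bound for a truncated second moment.\<close>
  define m where "m = min y M"
  have 1: "y - y\<^sup>2 / (4 * M) \<le> m"
  proof -
    have "0 \<le> (y - 2 * M)\<^sup>2 / (4 * M)" using assms by simp
    also have "(y - 2 * M)\<^sup>2 / (4 * M) = M - (y - y\<^sup>2 / (4 * M))"
      using assms by (simp add: field_simps power2_eq_square)
    finally show ?thesis using assms by (simp add: m_def)
  qed
  have "b * (y - y\<^sup>2 / (4 * M)) \<le> b * m" using 1 assms by (intro mult_left_mono)
  also have "b * m \<le> m\<^sup>2 / 2 + b\<^sup>2 / 2" using sum_squares_bound[of b m] by simp
  finally have 2: "b * (y - y\<^sup>2 / (4 * M)) - b\<^sup>2 / 2 \<le> m\<^sup>2 / 2" by simp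
  have 3: "m\<^sup>2 / 2 \<le> y\<^sup>2 / (1 + y\<^sup>2 / M\<^sup>2)"
  proof (cases "y \<le> M")
    case True
    have "y\<^sup>2 / M\<^sup>2 \<le> 1" using True assms by (simp add: power_mono)
    then have "y\<^sup>2 / 2 \<le> y\<^sup>2 / (1 + y\<^sup>2 / M\<^sup>2)"
      using assms by (intro divide_left_mono mult_pos_pos) (auto simp: add_pos_nonneg)
    then show ?thesis using True by (simp add: m_def)
  next
    case False
    have "M\<^sup>2 \<le> y\<^sup>2" using False assms by (simp add: power_mono)
    moreover have "y\<^sup>2 / (1 + y\<^sup>2 / M\<^sup>2) = y\<^sup>2 * M\<^sup>2 / (M\<^sup>2 + y\<^sup>2)"
      using assms by (simp add: field_simps)
    moreover have "M\<^sup>2 / 2 \<le> y\<^sup>2 * M\<^sup>2 / (M\<^sup>2 + y\<^sup>2)"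
    proof -
      have "0 < M\<^sup>2 + y\<^sup>2" using assms by (simp add: add_pos_nonneg)
      moreover have "M\<^sup>2 * (M\<^sup>2 + y\<^sup>2) \<le> y\<^sup>2 * M\<^sup>2 * 2"
        using mult_left_mono[OF \<open>M\<^sup>2 \<le> y\<^sup>2\<close>, of "M\<^sup>2"] by (simp add: algebra_simps)
      ultimately show ?thesis by (simp add: pos_le_divide_eq)
    qed
    ultimately show ?thesis using False by (simp add: m_def)
  qed
  show ?thesis using 2 3 by linarith
qed

section \<open>A bounded bump and its increments\<close>

definition bump :: "'a::real_inner \<Rightarrow> real" where
  "bump v = 1 / (1 + (norm v)\<^sup>2)"

lemma one_plus_sq_pos [simp]: "0 < 1 + (norm v)\<^sup>2" "1 + (norm v)\<^sup>2 \<noteq> 0"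
  using add_pos_nonneg[of 1 "(norm v)\<^sup>2"] by auto

lemma bump_pos: "0 < bump v" and bump_le_1: "bump v \<le> 1"
  by (auto simp: bump_def)

text \<open>With \<open>t\<close> the increment of the squared norm this is the identity 1/(A+t) =
  1/A - t/A^2 + t^2/(A^2 (A+t)), where \<open>t\<close> in the linear term is split into
  \<open>2 * (v \<bullet> e) + (norm e)\<^sup>2\<close>. It is exact for jumps of any size.\<close>

lemma bump_add:
  fixes v e :: "'a::real_inner"
  shows "bump (v + e) = bump v - 2 * (bump v)\<^sup>2 * (v \<bullet> e)
    + (bump v)\<^sup>2 * (((2 *\<^sub>R v + e) \<bullet> e)\<^sup>2 * bump (v + e) - (norm e)\<^sup>2)"
proof -
  have n: "(norm (v + e))\<^sup>2 = (norm v)\<^sup>2 + (2 *\<^sub>R v + e) \<bullet> e"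
    by (simp add: power2_norm_eq_inner inner_add inner_commute)
  have q: "(2 *\<^sub>R v + e) \<bullet> e = 2 * (v \<bullet> e) + (norm e)\<^sup>2"
    by (simp add: power2_norm_eq_inner inner_add)
  define t where "t = (2 *\<^sub>R v + e) \<bullet> e"
  define A where "A = 1 + (norm v)\<^sup>2"
  have "A > 0" "A + t > 0" using one_plus_sq_pos(1)[of "v+e"] unfolding A_def t_def n by (auto simp: add.assoc)
  then have *: "1 / (A + t) = 1 / A - (1/A)\<^sup>2 * t + (1/A)\<^sup>2 * (t\<^sup>2 * (1 / (A + t)))"
    by (simp add: divide_simps power2_eq_square) (simp add: algebra_simps)
  have b: "bump (v + e) = 1 / (A + t)" "bump v = 1 / A"
    by (simp_all add: bump_def n A_def t_def add.assoc)
  have ve: "v \<bullet> e = (t - (norm e)\<^sup>2) / 2" using q by (simp add: t_def)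
  show ?thesis unfolding t_def[symmetric] b ve by (subst *) (simp add: right_diff_distrib diff_divide_distrib)
qed

lemma inner_shift_bound:
  fixes v e :: "'a::real_inner"
  shows "((2 *\<^sub>R v + e) \<bullet> e)\<^sup>2 \<le> (norm e)\<^sup>2 * (norm v + norm (v + e))\<^sup>2"
proof -
  have "\<bar>(2 *\<^sub>R v + e) \<bullet> e\<bar> \<le> norm (2 *\<^sub>R v + e) * norm e" by (rule Cauchy_Schwarz_ineq2)
  also have "norm (2 *\<^sub>R v + e) \<le> norm v + norm (v + e)"
    using norm_triangle_ineq[of v "v + e"] by (simp add: scaleR_2 add.assoc)
  finally have "\<bar>(2 *\<^sub>R v + e) \<bullet> e\<bar> \<le> (norm v + norm (v + e)) * norm e"
    by (simp add: mult_right_mono)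
  then have "((2 *\<^sub>R v + e) \<bullet> e)\<^sup>2 \<le> ((norm v + norm (v + e)) * norm e)\<^sup>2"
    by (simp add: abs_le_square_iff[symmetric])
  then show ?thesis by (simp add: power_mult_distrib mult.commute)
qed

text \<open>Because \<open>bump v * (norm v)\<^sup>2 \<le> 1\<close>, and likewise at
  \<open>v + e\<close>, the two bumps in the remainder cancel the growth of the factor
  \<open>(norm v + norm (v + e))\<^sup>2\<close>; so the constant 4 does not depend on
  \<open>v\<close>.\<close>

lemma bump_noise_global:
  fixes v e :: "'a::real_inner"
  shows "bump (v + e) \<le> bump v - 2 * (bump v)\<^sup>2 * (v \<bullet> e) + 4 * (norm e)\<^sup>2"
proof -
  define w p q E where "w = norm (v + e)" and "p = bump v" and "q = bump (v + e)" and "E = (norm e)\<^sup>2"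
  have pq: "0 < p" "p \<le> 1" "0 < q" "q \<le> 1" by (auto simp: p_def q_def bump_pos bump_le_1)
  have "((2 *\<^sub>R v + e) \<bullet> e)\<^sup>2 \<le> E * (2 * (norm v)\<^sup>2 + 2 * w\<^sup>2)"
    using inner_shift_bound[of v e] sum_squares_bound[of "norm v" w] unfolding w_def E_def
    by (smt (verit, best) mult_left_mono power2_sum zero_le_power2)
  then have "p\<^sup>2 * (((2 *\<^sub>R v + e) \<bullet> e)\<^sup>2 * q) \<le> p\<^sup>2 * (E * (2 * (norm v)\<^sup>2 + 2 * w\<^sup>2) * q)"
    using pq by (intro mult_left_mono mult_right_mono) auto
  also have "\<dots> = E * (2 * (p * (norm v)\<^sup>2) * (p * q) + 2 * (q * w\<^sup>2) * (p * p))"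
    by (simp add: algebra_simps power2_eq_square)
  also have "\<dots> \<le> E * (2 * 1 * 1 + 2 * 1 * 1)"
  proof (intro mult_left_mono add_mono mult_mono)
    show "p * (norm v)\<^sup>2 \<le> 1" by (simp add: p_def bump_def)
    show "q * w\<^sup>2 \<le> 1" by (simp add: q_def w_def bump_def)
    show "p * q \<le> 1" "p * p \<le> 1" using pq by (auto intro: mult_le_one)
  qed (use pq in \<open>auto simp: E_def\<close>)
  finally have "p\<^sup>2 * (((2 *\<^sub>R v + e) \<bullet> e)\<^sup>2 * q) \<le> 4 * E" by simp
  moreover have "0 \<le> p\<^sup>2 * E" by (simp add: E_def)
  ultimately show ?thesis
    using bump_add[of v e] unfolding p_def[symmetric] q_def[symmetric] E_def[symmetric]
    by (simp add: right_diff_distrib)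
qed

text \<open>The bump is concave near its maximum, so noise lowers it on average; this is the only
  source of gain at the origin. Being bounded below, it can drop only by a truncated square. The
  error \<open>15 * r\<close> accounts for \<open>v\<close> not being exactly 0.\<close>

lemma bump_noise_local:
  fixes v e :: "'a::real_inner"
  assumes v: "norm v \<le> r" and r: "0 < r" "r \<le> 1/2"
  shows "bump (v + e) \<le> bump v - 2 * (bump v)\<^sup>2 * (v \<bullet> e)
    - (norm e)\<^sup>2 / (8 * (1 + (norm e)\<^sup>2)) + 15 * r * (norm e)\<^sup>2"
proof -
  define w p q E V where "w = norm (v + e)" and "p = bump v" and "q = bump (v + e)"
    and "E = (norm e)\<^sup>2" and "V = norm v"
  have pq: "0 < p" "p \<le> 1" "0 < q" "q \<le> 1" by (auto simp: p_def q_def bump_pos bump_le_1)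
  have V: "0 \<le> V" "V \<le> r" "0 \<le> w" "0 \<le> E" using v by (auto simp: V_def w_def E_def)
  have qw: "q * (1 + w\<^sup>2) = 1" by (simp add: q_def w_def bump_def)
  have s: "(V + w)\<^sup>2 \<le> (1 + r) * w\<^sup>2 + 2 * r"
  proof -
    have "2 * V * w \<le> 2 * r * w" using V by (intro mult_right_mono) auto
    also have "2 * r * w \<le> r * w\<^sup>2 + r"
      using mult_left_mono[OF sum_squares_bound[of 1 w], of r] r by (simp add: algebra_simps)
    finally have "2 * V * w \<le> r * w\<^sup>2 + r" .
    moreover have "V\<^sup>2 \<le> r" using mult_mono[of V r V 1] V r by (simp add: power2_eq_square)
    ultimately show ?thesis by (simp add: power2_sum algebra_simps)
  qed
  have "((2 *\<^sub>R v + e) \<bullet> e)\<^sup>2 * q \<le> E * ((1 + r) * w\<^sup>2 + 2 * r) * q"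
    using inner_shift_bound[of v e] mult_left_mono[OF s, of E] V pq
    unfolding w_def[symmetric] E_def[symmetric] V_def[symmetric]
    by (intro mult_right_mono) auto
  also have "\<dots> = E * (1 - q + r * (q * w\<^sup>2) + 2 * r * q)"
    using qw by algebra
  also have "\<dots> \<le> E * (1 - q + r * 1 + 2 * r * 1)"
  proof -
    have "q * w\<^sup>2 \<le> 1" using qw pq by (simp add: algebra_simps)
    then show ?thesis using pq r V by (intro mult_left_mono add_mono) auto
  qed
  finally have A: "((2 *\<^sub>R v + e) \<bullet> e)\<^sup>2 * q - E \<le> 3 * r * E - E * q" by (simp add: algebra_simps)
  have ph: "1/2 \<le> p"
  proof -
    have "(norm v)\<^sup>2 \<le> 1\<^sup>2" using v r by (intro power_mono) auto
    then show ?thesis by (simp add: p_def bump_def divide_simps)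
  qed
  have qE: "1 / (2 * (1 + E)) \<le> q"
  proof -
    have "w\<^sup>2 \<le> (V + norm e)\<^sup>2" using norm_triangle_ineq[of v e] V by (intro power_mono) (auto simp: w_def V_def)
    also have "\<dots> \<le> 2 * V\<^sup>2 + 2 * E" using sum_squares_bound[of V "norm e"] by (simp add: power2_sum E_def)
    also have "V\<^sup>2 \<le> (1/2)\<^sup>2" using V r by (intro power_mono) auto
    finally have "1 + w\<^sup>2 \<le> 2 * (1 + E)" by (simp add: power2_eq_square)
    then have "1 / (2 * (1 + E)) \<le> 1 / (1 + w\<^sup>2)" using V by (intro divide_left_mono) (auto simp: w_def)
    then show ?thesis by (simp add: q_def w_def bump_def)
  qed
  have p2: "1/4 \<le> p\<^sup>2" "p\<^sup>2 \<le> 1" using ph pq power_mono[of "1/2" p 2] by (auto simp: power2_eq_square intro: mult_le_one)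
  have "p\<^sup>2 * (((2 *\<^sub>R v + e) \<bullet> e)\<^sup>2 * q - E) \<le> p\<^sup>2 * (3 * r * E) - p\<^sup>2 * (E * q)"
    using mult_left_mono[OF A, of "p\<^sup>2"] by (simp add: algebra_simps)
  also have "\<dots> \<le> 3 * r * E - (1/4) * (E * (1 / (2 * (1 + E))))"
  proof (intro diff_mono)
    show "p\<^sup>2 * (3 * r * E) \<le> 3 * r * E" using p2 V r by (simp add: mult_left_le_one_le)
    show "(1/4) * (E * (1 / (2 * (1 + E)))) \<le> p\<^sup>2 * (E * q)"
      using p2 qE V by (intro mult_mono mult_left_mono) auto
  qed
  also have "\<dots> \<le> 15 * r * E - E / (8 * (1 + E))" using V r by (simp add: mult_right_mono)
  finally show ?thesis
    using bump_add[of v e] unfolding p_def[symmetric] q_def[symmetric] E_def[symmetric] by simp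
qed

section \<open>A convex decreasing profile on the real line\<close>

definition decay :: "real \<Rightarrow> real" where
  "decay S = (if 0 \<le> S then 1 / (1 + S) else 1 - S)"

definition decay_slope :: "real \<Rightarrow> real" where
  "decay_slope S = (if 0 \<le> S then 1 / (1 + S)\<^sup>2 else 1)"

lemma decay_pos: "0 < decay S" by (auto simp: decay_def)

lemma decay_antimono: "S \<le> S' \<Longrightarrow> decay S' \<le> decay S"
  unfolding decay_def by (auto simp: frac_le) (smt (verit) divide_le_eq_1_pos)

lemma decay_slope_bounds: "0 \<le> decay_slope S" "decay_slope S \<le> 1" "decay_slope S \<le> decay S"
proof -
  show "0 \<le> decay_slope S" by (auto simp: decay_slope_def)
  show "decay_slope S \<le> 1" by (auto simp: decay_slope_def)
  show "decay_slope S \<le> decay S"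
    by (auto simp: decay_slope_def decay_def power2_eq_square divide_simps)
qed

text \<open>The derivative is \<open>- decay_slope\<close>. The remainder is relative to
  \<open>decay S\<close>, which is the form that a multiplicative contraction can absorb; the cases
  are the positions of \<open>S\<close> and \<open>S + w\<close> with respect to the breakpoint
  0.\<close>

lemma decay_add:
  "decay (S + w) \<le> decay S - decay_slope S * w + 2 * decay S * w\<^sup>2"
proof -
  consider "0 \<le> S" "0 \<le> S + w" | "0 \<le> S" "S + w < 0" | "S < 0" "S + w < 0" | "S < 0" "0 \<le> S + w"
    by linarith
  then show ?thesis
  proof cases
    case 1
    define A where "A = 1 + S"
    have A: "1 \<le> A" "1 \<le> A + w" using 1 by (auto simp: A_def)
    have "1 / (A + w) = 1 / A - (1 / A\<^sup>2) * w + (1/A) * w\<^sup>2 * (1 / (A * (A + w)))"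
      using A by (simp add: divide_simps power2_eq_square) (simp add: algebra_simps)
    also have "\<dots> \<le> 1 / A - (1 / A\<^sup>2) * w + (1/A) * w\<^sup>2 * 2"
    proof -
      have "1 / (A * (A + w)) \<le> 1" using A mult_mono[of 1 A 1 "A+w"] by simp
      then have "1 / (A * (A + w)) \<le> 2" by linarith
      then show ?thesis using A by (intro add_left_mono mult_left_mono) auto
    qed
    finally show ?thesis using 1 by (simp add: decay_def decay_slope_def A_def add.assoc mult.commute)
  next
    case 2
    define y where "y = - S - w"
    have y: "0 < y" "w = - S - y" using 2 by (auto simp: y_def)
    have "(1 + S)\<^sup>2 * (1 + y) \<le> (1 + S) + (S + y) + 2 * (1 + S) * (S + y)\<^sup>2"
    proof -
      have "(1 + S) + (S + y) + 2 * (1 + S) * (S + y)\<^sup>2 - (1 + S)\<^sup>2 * (1 + y)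
        = S * S + 2 * (S * y) + 2 * (y * y) + 2 * (S * S * S) + 3 * (S * S * y) + 2 * (S * y * y)"
        by (simp add: power2_eq_square algebra_simps)
      also have "0 \<le> \<dots>" using 2 y by simp
      finally show ?thesis by simp
    qed
    then have "(1 + S)\<^sup>2 * (1 + y) / (1 + S)\<^sup>2 \<le> ((1 + S) + (S + y) + 2 * (1 + S) * (S + y)\<^sup>2) / (1 + S)\<^sup>2"
      using 2 by (intro divide_right_mono) auto
    moreover have "1 / (1 + S) - (1 / (1 + S)\<^sup>2) * w + 2 * (1 / (1 + S)) * w\<^sup>2
       = ((1 + S) + (S + y) + 2 * (1 + S) * (S + y)\<^sup>2) / (1 + S)\<^sup>2"
      using 2 by (simp add: y divide_simps power2_eq_square) (simp add: algebra_simps)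
    moreover have "(1 + S)\<^sup>2 * (1 + y) / (1 + S)\<^sup>2 = 1 + y" using 2 by simp
    ultimately show ?thesis using 2 y by (simp add: decay_def decay_slope_def)
  next
    case 3
    then show ?thesis by (simp add: decay_def decay_slope_def)
  next
    case 4
    define T where "T = S + w"
    have T: "0 \<le> T" "T \<le> w" using 4 by (auto simp: T_def)
    have "1 / (1 + T) \<le> 1 - T + T\<^sup>2" using T by (simp add: divide_simps power2_eq_square algebra_simps)
    also have "T\<^sup>2 \<le> w\<^sup>2" using T by (intro power_mono) auto
    also have "w\<^sup>2 \<le> 2 * (1 - S) * w\<^sup>2" using 4 mult_right_mono[of 1 "2 * (1 - S)" "w\<^sup>2"] by simp
    finally show ?thesis using 4 by (simp add: decay_def decay_slope_def T_def)
  qed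
qed

text \<open>\<open>decay\<close> is the solution of D'(S) (1 + |S|) = - D(S) with D(0) = 1, so an
  advance of \<open>S\<close> by the fraction \<open>x\<close> of \<open>1 + \<bar>S\<bar>\<close>
  multiplies it by about \<open>1 - x\<close>; the factor \<open>1 - x / 2\<close> leaves room for
  steps of finite size.\<close>

lemma decay_contract:
  assumes x: "0 \<le> x" "x \<le> 1" and S': "S + x * (1 + \<bar>S\<bar>) \<le> S'"
  shows "decay S' \<le> (1 - x / 2) * decay S"
proof -
  have "decay S' \<le> decay (S + x * (1 + \<bar>S\<bar>))" by (rule decay_antimono[OF S'])
  also have "\<dots> \<le> (1 - x / 2) * decay S"
  proof (cases "0 \<le> S")
    case True
    then have "decay (S + x * (1 + \<bar>S\<bar>)) = 1 / (1 + x) * (1 / (1 + S))"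
    proof -
      have "1 + (S + x * (1 + S)) = (1 + x) * (1 + S)" by (simp add: algebra_simps)
      moreover have "0 \<le> S + x * (1 + S)" using True x by simp
      ultimately show ?thesis using True by (simp add: decay_def)
    qed
    also have "\<dots> \<le> (1 - x / 2) * (1 / (1 + S))"
    proof (rule mult_right_mono)
      have "0 \<le> x * (1 - x)" using x by simp
      then have "1 \<le> (1 - x / 2) * (1 + x)" by (simp add: algebra_simps)
      then show "1 / (1 + x) \<le> 1 - x / 2" using x by (simp add: pos_divide_le_eq)
    qed (use True in simp)
    finally show ?thesis using True x by (simp add: decay_def divide_right_mono)
  next
    case False
    show ?thesis
    proof (cases "S + x * (1 - S) < 0")
      case True
      then show ?thesis using False x
        using mult_nonneg_nonneg[of x "1 - S"] by (simp add: decay_def field_simps)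
    next
      case F2: False
      define y where "y = S + x * (1 - S)"
      have y: "0 \<le> y" using F2 by (simp add: y_def)
      have yx: "y \<le> x"
        using False x mult_nonneg_nonneg[of "- S" "1 - x"] by (simp add: y_def algebra_simps)
      have e: "1 - y = (1 - S) * (1 - x)" by (simp add: y_def algebra_simps)
      have "1 \<le> (1 - x / 2) * (1 - S) * (1 + y)"
      proof (cases "x = 1")
        case True
        then have "y = 1" by (simp add: y_def)
        then show ?thesis using True False by simp
      next
        case xn: False
        then have xl: "0 < 1 - x" using x by simp
        have "(1 - x) \<le> (1 - x/2) * (1 - x\<^sup>2)"
        proof -
          have "(1 - x/2) * (1 - x\<^sup>2) - (1 - x) = (x/2) * (1 - x)\<^sup>2" by (simp add: power2_eq_square field_simps)
          moreover have "0 \<le> (x/2) * (1 - x)\<^sup>2" using x by simp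
          ultimately show ?thesis by linarith
        qed
        also have "\<dots> \<le> (1 - x/2) * (1 - y\<^sup>2)" using x y yx by (intro mult_left_mono diff_mono power_mono) auto
        also have "1 - y\<^sup>2 = (1 - y) * (1 + y)" by (simp add: power2_eq_square algebra_simps)
        finally have "(1 - x) * 1 \<le> (1 - x) * ((1 - x/2) * (1 - S) * (1 + y))" by (simp add: e mult_ac)
        then show ?thesis using xl by (simp add: mult_le_cancel_left_pos)
      qed
      then have "1 / (1 + y) \<le> (1 - x / 2) * (1 - S)" using y by (simp add: divide_simps)
      then show ?thesis using False y by (simp add: decay_def y_def)
    qed
  qed
  finally show ?thesis .
qed

section \<open>The Lyapunov function and its drift\<close>

text \<open>The constants can be chosen without circularity: \<open>r0\<close> and
  \<open>kap\<close> from the noise bounds, then \<open>nu\<close>, \<open>eta\<close>,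
  \<open>c2\<close> and \<open>g\<close>, then the ratio \<open>eps1\<close> of squared noise
  amplitude to step size, then the coupling tolerance \<open>del\<close>, and last the penalty
  strength \<open>Gam\<close>. The noise gain near the origin is \<open>c1\<^sup>2 / 64\<close> per
  unit of squared amplitude; the errors due to \<open>r0\<close> and \<open>kap\<close> take at most
  \<open>c1\<^sup>2 / 256\<close> each, which leaves \<open>g\<close>.\<close>

locale rates =
  fixes lam L B c1 M r0 kap nu eta c2 eps1 g del Gam :: real
  assumes lam: "0 < lam" and L: "0 < L" and B: "0 < B" and c1: "0 < c1"
    and M: "M = B / c1"
    and r0: "0 < r0" "r0 \<le> 1/2" "15 * r0 * B \<le> c1\<^sup>2 / 128"
    and kap: "0 < kap" "kap \<le> 1" "kap * B \<le> c1\<^sup>2 / 256"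
    and nu: "0 < nu" "nu \<le> 1/4" "2 * nu * L \<le> kap * lam" "sqrt nu * L \<le> lam / 4"
    and eta: "eta = lam * r0\<^sup>2 / (34 * (1 + r0\<^sup>2))"
    and c2: "c2 = lam * sqrt kap / 128"
    and g: "g = c1\<^sup>2 / 128"
    and eps1: "0 < eps1" "eps1 * g \<le> lam / 2" "eps1 * (3 * B + g) \<le> eta / 4"
      "eps1 * B * 9 \<le> c2 / 4" "eps1 * g \<le> c2 / 4"
    and del: "0 < del" "kap * del \<le> lam / 2400" "2 * del\<^sup>2 \<le> kap * lam\<^sup>2"
      "kap * del \<le> sqrt nu * lam / 4" "del \<le> c2"
    and Gam: "0 < Gam" "L\<^sup>2 \<le> lam * kap * Gam" "L\<^sup>2 \<le> 2 * kap * Gam * del"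
begin

text \<open>The summand 1 places the origin at \<open>norm u - rad u s = - 1\<close>, where
  \<open>D2\<close> equals 2 but \<open>D1\<close> equals 1, so that near the origin
  \<open>D1\<close> is the smaller of the two.\<close>

definition rad :: "'a::real_inner \<Rightarrow> 'a \<Rightarrow> real" where
  "rad u s = sqrt (1 + nu * (norm u)\<^sup>2 + kap * (norm s)\<^sup>2)"

text \<open>\<open>D1\<close> is accurate near the origin, where the noise has to produce a gain; it fails for large \<open>u\<close>,
  because the drift then feeds \<open>u\<close> into \<open>s\<close>. \<open>D2\<close> is a decreasing function of a cone coordinate and works
  away from the origin. Their minimum works everywhere, since \<open>D1 \<le> D2\<close> only where \<open>u\<close> is bounded and
  \<open>D2 < D1\<close> only away from the origin.\<close>

definition D1 :: "'a::real_inner \<Rightarrow> 'a \<Rightarrow> real" where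
  "D1 u s = 1/2 + bump u / 2 + kap * (norm s)\<^sup>2"

definition D2 :: "'a::real_inner \<Rightarrow> 'a \<Rightarrow> real" where
  "D2 u s = decay (norm u - rad u s)"

text \<open>One noise-free step from \<open>(u, s)\<close> to \<open>(u1, s1)\<close> with step size \<open>a\<close>; \<open>z\<close> is the norm of the component
  orthogonal to the null space of the penalty matrix. It enters \<open>u\<close> with the constant \<open>L\<close>, which is not
  small, and is controlled by the large constant \<open>Gam\<close> that the growing penalty provides.\<close>

definition drift_step :: "real \<Rightarrow> 'a::real_inner \<Rightarrow> 'a \<Rightarrow> real \<Rightarrow> 'a \<Rightarrow> 'a \<Rightarrow> bool" where
  "drift_step a u s z u1 s1 \<longleftrightarrow> 0 < a \<and> a * lam \<le> 1 \<and> a * c2 \<le> 1 \<and> 0 \<le> z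
     \<and> a * norm u * (lam * norm u - del * norm s - L * z) \<le> u \<bullet> (u1 - u)
     \<and> (norm s1)\<^sup>2 \<le> (1 - a * lam) * (norm s)\<^sup>2 - a * Gam * z\<^sup>2 + a * del * (norm u)\<^sup>2
     \<and> (norm u1)\<^sup>2 \<le> (norm u)\<^sup>2 + a * L * ((norm u)\<^sup>2 + (norm s)\<^sup>2)"

lemma rad_ge_1: "1 \<le> rad u s"
  using nu kap by (simp add: rad_def)

lemma rad_sq: "(rad u s)\<^sup>2 = 1 + nu * (norm u)\<^sup>2 + kap * (norm s)\<^sup>2"
  using nu kap by (simp add: rad_def add_nonneg_nonneg)

lemma rad_le_sum: "rad u s \<le> 1 + sqrt nu * norm u + sqrt kap * norm s"
proof -
  have "rad u s \<le> sqrt 1 + sqrt (nu * (norm u)\<^sup>2) + sqrt (kap * (norm s)\<^sup>2)"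
    unfolding rad_def using nu kap
    by (intro order_trans[OF sqrt_add_le_add_sqrt] add_mono) auto
  then show ?thesis by (simp add: real_sqrt_mult)
qed

lemma sqrt_nu: "sqrt nu \<le> 1/2"
  using nu real_sqrt_le_mono[of nu "1/4"] by (simp add: real_sqrt_divide)

lemma sqrt_kap: "0 < sqrt kap" "sqrt kap \<le> 1"
  using kap by auto

lemma rad_le: "rad u s \<le> 1 + norm u / 2 + sqrt kap * norm s"
  using rad_le_sum[of u s] mult_right_mono[OF sqrt_nu, of "norm u"] by simp

lemma D1_pos: "0 < D1 u s"
  using bump_pos[of u] kap by (simp add: D1_def add_pos_nonneg)

lemma D1_le: "D1 u s \<le> 1 + kap * (norm s)\<^sup>2"
  using bump_le_1[of u] by (simp add: D1_def)

lemma D2_pos: "0 < D2 u s" by (simp add: D2_def decay_pos)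

text \<open>\<open>rad\<close> grows in \<open>u\<close> with slope at most 1/2, so the cone
  coordinate is at least \<open>norm u / 2 - 1\<close> up to a term in \<open>s\<close>. Beyond
  \<open>norm u = 4\<close> this pushes \<open>D2\<close> below 1/2 plus that term, a level under
  which \<open>D1\<close> never falls.\<close>

lemma D1_le_D2:
  assumes "D1 u s \<le> D2 u s" shows "norm u \<le> 4"
proof (rule ccontr)
  assume n: "\<not> norm u \<le> 4"
  define p y where "p = norm u / 2" and "y = kap * (norm s)\<^sup>2 / 2"
  have py: "2 < p" "0 \<le> y" using n kap by (auto simp: p_def y_def)
  have "rad u s \<le> p + 1 + y"
  proof -
    have "(rad u s)\<^sup>2 \<le> (p + 1 + y)\<^sup>2"
    proof -
      have "nu * (norm u)\<^sup>2 \<le> p\<^sup>2" using nu mult_right_mono[of nu "1/4" "(norm u)\<^sup>2"]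
        by (simp add: p_def power_divide)
      moreover have "(p + 1 + y)\<^sup>2 = p\<^sup>2 + 1 + 2 * y + (y\<^sup>2 + 2 * p + 2 * p * y)" by (simp add: power2_eq_square algebra_simps)
      moreover have "0 \<le> y\<^sup>2 + 2 * p + 2 * p * y" using py by simp
      moreover have "kap * (norm s)\<^sup>2 = 2 * y" by (simp add: y_def)
      ultimately show ?thesis unfolding rad_sq by linarith
    qed
    then show ?thesis by (rule power2_le_imp_le) (use py in simp)
  qed
  then have "D2 u s \<le> decay (p - 1 - y)"
    unfolding D2_def by (intro decay_antimono) (simp add: p_def)
  also have "\<dots> \<le> 1 / p + y"
  proof (cases "0 \<le> p - 1 - y")
    case True
    have "1 \<le> (1 / p + y) * (p - y)"
    proof -
      have "(1 / p + y) * (p - y) - 1 = y * ((p - y) - 1 / p)" using py by (simp add: field_simps)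
      moreover have "1 / p \<le> 1" using py by simp
      moreover have "0 \<le> y * ((p - y) - 1 / p)"
        using True py \<open>1 / p \<le> 1\<close> by (intro mult_nonneg_nonneg) linarith+
      ultimately show ?thesis by linarith
    qed
    then show ?thesis using True by (simp add: decay_def pos_divide_le_eq)
  next
    case False
    moreover have "0 < 1 / p" using py by simp
    ultimately have "1 - (p - 1 - y) \<le> 1 / p + y" using py by linarith
    then show ?thesis using False by (simp add: decay_def)
  qed
  also have "\<dots> < 1/2 + y" using py by (simp add: field_simps)
  also have "\<dots> \<le> D1 u s" using bump_pos[of u] py by (simp add: D1_def y_def)
  finally show False using assms by simp
qed

text \<open>Otherwise the cone coordinate would be at most \<open>- 3/4\<close>, hence
  \<open>D2 \<ge> 7/4\<close>, too large compared with
  \<open>D1 \<le> 1 + kap * (norm s)\<^sup>2\<close>. The lemma keeps the use of \<open>D2\<close>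
  away from the origin, where the drift of the cone coordinate degenerates.\<close>

lemma D2_less_D1:
  assumes "D2 u s < D1 u s" shows "1/4 < norm u \<or> 3/4 < kap * (norm s)\<^sup>2"
proof (rule ccontr)
  assume n: "\<not> ?thesis"
  then have S: "norm u - rad u s \<le> -3/4" using rad_ge_1[of u s] by simp
  have "7/4 \<le> D2 u s" unfolding D2_def
    using decay_antimono[OF S] by (simp add: decay_def)
  then show False using assms D1_le[of u s] n by simp
qed

lemma drift_u:
  assumes st: "drift_step a u s z u1 s1"
  shows "(1 + a * lam) * (norm u)\<^sup>2 - 2 * a * (kap * lam / 2 * (norm s)\<^sup>2 + kap * Gam * z\<^sup>2) \<le> (norm u1)\<^sup>2"
proof -
  have a: "0 < a" "0 \<le> z" using st by (auto simp: drift_step_def)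
  have "(norm u1)\<^sup>2 = (norm u)\<^sup>2 + 2 * (u \<bullet> (u1 - u)) + (norm (u1 - u))\<^sup>2"
    by (simp add: power2_norm_eq_inner inner_diff inner_commute)
  then have 1: "(norm u)\<^sup>2 + 2 * (a * norm u * (lam * norm u - del * norm s - L * z)) \<le> (norm u1)\<^sup>2"
  proof -
    have "a * norm u * (lam * norm u - del * norm s - L * z) \<le> u \<bullet> (u1 - u)"
      using st by (simp add: drift_step_def)
    moreover have "0 \<le> (norm (u1 - u))\<^sup>2" by simp
    ultimately show ?thesis using \<open>(norm u1)\<^sup>2 = _\<close> by linarith
  qed
  \<comment> \<open>Young's inequality: of the outward drift
    \<open>2 * lam * (norm u)\<^sup>2\<close>, one quarter pays for the coupling with
    \<open>s\<close>, one quarter for the coupling with \<open>z\<close>, and half is kept.\<close>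
  have 2: "2 * norm u * (del * norm s) \<le> lam / 2 * (norm u)\<^sup>2 + kap * lam * (norm s)\<^sup>2"
  proof -
    have "2 * norm u * (del * norm s) = 2 * (norm u * sqrt (lam/2)) * (del * norm s / sqrt (lam/2))"
      using lam by simp
    also have "\<dots> \<le> (norm u * sqrt (lam/2))\<^sup>2 + (del * norm s / sqrt (lam/2))\<^sup>2"
      by (rule sum_squares_bound)
    also have "\<dots> = lam / 2 * (norm u)\<^sup>2 + (2 * del\<^sup>2) / lam * (norm s)\<^sup>2"
      using lam by (simp add: power_mult_distrib power_divide mult_ac)
    also have "(2 * del\<^sup>2) / lam \<le> kap * lam" using del lam
      by (simp add: pos_divide_le_eq power2_eq_square mult_ac)
    finally show ?thesis by (simp add: mult_right_mono)
  qed
  have 3: "2 * norm u * (L * z) \<le> lam / 2 * (norm u)\<^sup>2 + 2 * kap * Gam * z\<^sup>2"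
  proof -
    have "2 * norm u * (L * z) = 2 * (norm u * sqrt (lam/2)) * (L * z / sqrt (lam/2))"
      using lam by simp
    also have "\<dots> \<le> (norm u * sqrt (lam/2))\<^sup>2 + (L * z / sqrt (lam/2))\<^sup>2"
      by (rule sum_squares_bound)
    also have "\<dots> = lam / 2 * (norm u)\<^sup>2 + (2 * L\<^sup>2) / lam * z\<^sup>2"
      using lam by (simp add: power_mult_distrib power_divide mult_ac)
    also have "(2 * L\<^sup>2) / lam \<le> 2 * kap * Gam" using Gam lam
      by (simp add: pos_divide_le_eq mult_ac)
    finally show ?thesis by (simp add: mult_right_mono)
  qed
  have "a * (2 * norm u * (del * norm s) + 2 * norm u * (L * z)) \<le>
     a * (lam * (norm u)\<^sup>2 + kap * lam * (norm s)\<^sup>2 + 2 * kap * Gam * z\<^sup>2)"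
    using 2 3 a by (intro mult_left_mono) auto
  then show ?thesis using 1 by (simp add: algebra_simps power2_eq_square)
qed

lemma D1_drift:
  assumes st: "drift_step a u s z u1 s1" and u4: "norm u \<le> 4"
  shows "D1 u1 s1 + (if r0 < norm u1 then a * eta / 4 else 0) + a * kap * (lam / 2) * (norm s)\<^sup>2 \<le> D1 u s"
proof -
  have a: "0 < a" "a * lam \<le> 1" "0 \<le> z"
    and s1: "(norm s1)\<^sup>2 \<le> (1 - a * lam) * (norm s)\<^sup>2 - a * Gam * z\<^sup>2 + a * del * (norm u)\<^sup>2"
    using st by (auto simp: drift_step_def)
  define U X G where "U = (norm u)\<^sup>2" and "X = (norm u1)\<^sup>2"
    and "G = kap * lam / 2 * (norm s)\<^sup>2 + kap * Gam * z\<^sup>2"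
  have X: "(1 + a * lam) * U - 2 * a * G \<le> X" using drift_u[OF st] by (simp add: U_def X_def G_def)
  have U: "0 \<le> U" "U \<le> 16" "0 \<le> X" "0 \<le> G"
    using power_mono[OF u4, of 2] kap lam Gam by (auto simp: U_def X_def G_def)
  \<comment> \<open>Adding the coupling back makes \<open>Y\<close> a pure expansion of
    \<open>U\<close>. The price \<open>2 * a * G\<close>, halved by the coefficient of the bump, is
    covered by the decrease of \<open>kap * (norm s)\<^sup>2\<close>, of which half the
    \<open>lam\<close> part is left over.\<close>
  define Y where "Y = X + 2 * a * G"
  have Y: "(1 + a * lam) * U \<le> Y" "X \<le> Y" using X a U by (auto simp: Y_def)
  have XY: "1 / (1 + X) \<le> 1 / (1 + Y) + 2 * a * G"
  proof -
    have "1 / (1 + X) - 1 / (1 + Y) = (2 * a * G) * (1 / ((1 + X) * (1 + Y)))"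
      using U Y by (simp add: Y_def field_simps)
    also have "\<dots> \<le> (2 * a * G) * 1"
    proof (rule mult_left_mono)
      have "1 * 1 \<le> (1 + X) * (1 + Y)" using U Y by (intro mult_mono) auto
      then show "1 / ((1 + X) * (1 + Y)) \<le> 1" by simp
    qed (use U a in auto)
    finally show ?thesis by simp
  qed
  have al: "0 \<le> a * lam" using a lam by simp
  \<comment> \<open>For \<open>U \<le> 16\<close> the two denominators multiply to at most 17 * 33 <
    600. This gain is meant to absorb \<open>kap * del * U\<close>, which the unstable part feeds
    into \<open>s\<close>.\<close>
  have P1: "1 / (1 + Y) \<le> 1 / (1 + U) - a * lam * U / 600"
  proof -
    have "1 / (1 + Y) \<le> 1 / (1 + (1 + a * lam) * U)" using Y U al by (intro divide_left_mono) (auto intro!: mult_pos_pos add_pos_nonneg)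
    also have "\<dots> = 1 / (1 + U) - a * lam * U * (1 / ((1 + U) * (1 + (1 + a * lam) * U)))"
    proof -
      have "0 < 1 + U" "0 < 1 + (1 + a * lam) * U" using U al by (auto intro!: add_pos_nonneg)
      then show ?thesis by (simp add: divide_simps) (simp add: algebra_simps)
    qed
    also have "\<dots> \<le> 1 / (1 + U) - a * lam * U * (1 / 600)"
    proof (intro diff_left_mono mult_left_mono)
      have "(1 + U) * (1 + (1 + a * lam) * U) \<le> 17 * (1 + 2 * 16)"
        using U a al by (intro mult_mono add_mono) auto
      then show "1 / 600 \<le> 1 / ((1 + U) * (1 + (1 + a * lam) * U))"
        using U al by (intro divide_left_mono) (auto intro!: mult_pos_pos add_pos_nonneg)
    qed (use U al in auto)
    finally show ?thesis by simp
  qed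
  have P2: "1 / (1 + Y) \<le> 1 / (1 + U) - a * eta" if "r0 < norm u1"
  proof -
    have Yr: "r0\<^sup>2 \<le> Y" using that r0 Y(2) power_mono[of r0 "norm u1" 2] unfolding X_def by linarith
    define q where "q = r0\<^sup>2 / (1 + r0\<^sup>2)"
    have q: "0 \<le> q" "q * (1 + Y) \<le> Y"
    proof -
      show "0 \<le> q" by (simp add: q_def)
      have "r0\<^sup>2 * (1 + Y) \<le> Y * (1 + r0\<^sup>2)" using Yr by (simp add: algebra_simps)
      then show "q * (1 + Y) \<le> Y" by (simp add: q_def pos_divide_le_eq add_pos_nonneg)
    qed
    have "U \<le> Y - a * lam / 2 * Y"
    proof -
      have "(1 + a * lam) * U \<le> (1 + a * lam) * (Y - a * lam / 2 * Y)"
      proof -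
        have "(1 + a * lam) * (Y - a * lam / 2 * Y) - Y = (a * lam) * (1 - a * lam) * Y / 2"
          by (simp add: field_simps)
        moreover have "0 \<le> (a * lam) * (1 - a * lam) * Y / 2" using al a U Y by simp
        ultimately show ?thesis using Y by linarith
      qed
      then show ?thesis using al by (simp add: mult_le_cancel_left_pos add_pos_nonneg)
    qed
    also have "\<dots> \<le> Y - a * lam / 2 * (q * (1 + Y))" using q al by (intro diff_left_mono mult_left_mono) auto
    finally have "1 + U \<le> (1 - a * lam / 2 * q) * (1 + Y)" by (simp add: algebra_simps)
    then have "1 / (1 + Y) \<le> (1 - a * lam / 2 * q) * (1 / (1 + U))"
      using U Y by (simp add: divide_simps mult.commute)
    also have "\<dots> = 1 / (1 + U) - a * lam / 2 * q * (1 / (1 + U))" by (simp add: algebra_simps)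
    also have "\<dots> \<le> 1 / (1 + U) - a * lam / 2 * q * (1 / 17)"
      using U q al by (intro diff_left_mono mult_left_mono divide_left_mono) auto
    also have "a * lam / 2 * q * (1 / 17) = a * eta" by (simp add: eta q_def)
    finally show ?thesis .
  qed
  have b: "bump u1 = 1 / (1 + X)" "bump u = 1 / (1 + U)" by (simp_all add: bump_def X_def U_def)
  \<comment> \<open>\<open>P1\<close> and \<open>P2\<close> bound the same quantity; their average
    keeps half of each gain.\<close>
  have "bump u1 \<le> bump u - a * lam * U / 1200 - (if r0 < norm u1 then a * eta / 2 else 0) + 2 * a * G"
  proof -
    have "0 \<le> a * lam * U" using al U by simp
    then show ?thesis unfolding b using XY P1 P2 by auto
  qed
  moreover have "kap * (norm s1)\<^sup>2 \<le> kap * ((1 - a * lam) * (norm s)\<^sup>2 - a * Gam * z\<^sup>2 + a * del * U)"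
    using s1 kap by (simp add: U_def)
  moreover have "a * (kap * del) * U \<le> a * (lam / 2400) * U" using del a U by (intro mult_right_mono mult_left_mono) auto
  ultimately show ?thesis unfolding D1_def G_def by (auto simp: algebra_simps split: if_splits)
qed

text \<open>In the increment of \<open>rad\<close> the penalty term appears divided by
  \<open>2 * r\<close>, with \<open>r\<close> the current radius, so the weights of the inequality
  between the means have to depend on \<open>r\<close>. The leftover \<open>del * r\<close> is of
  the same kind as the other small errors.\<close>

lemma weighted_amgm:
  assumes r: "1 \<le> r"
  shows "L * z \<le> kap * Gam * z\<^sup>2 / (2 * r) + del * r"
proof -
  have pos: "0 < kap * Gam" using kap Gam by simp
  define q where "q = kap * Gam"
  have q: "0 < q" using pos by (simp add: q_def)
  have "2 * (q * z) * (L * r) \<le> (q * z)\<^sup>2 + (L * r)\<^sup>2" by (rule sum_squares_bound)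
  also have "(L * r)\<^sup>2 \<le> (2 * q * del) * r\<^sup>2"
    unfolding power_mult_distrib using Gam(3) by (intro mult_right_mono) (auto simp: q_def mult_ac)
  finally have "(2 * r * q) * (L * z) \<le> (2 * r * q) * (q * z\<^sup>2 / (2 * r) + del * r)"
    using r by (simp add: distrib_left power2_eq_square mult_ac)
  then have "L * z \<le> q * z\<^sup>2 / (2 * r) + del * r" using r q by simp
  then show ?thesis by (simp add: q_def)
qed

text \<open>The cone coordinate advances by at least \<open>a * c2\<close> times 1 plus its modulus:
  \<open>norm u\<close> grows at rate \<open>lam\<close>, while \<open>rad\<close> shrinks through
  \<open>s\<close> and grows only slowly through \<open>u\<close>, \<open>nu\<close> being small.
  Both effects vanish at the origin, and the hypothesis \<open>D2 u s < D1 u s\<close> excludes its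
  neighbourhood.\<close>

lemma D2_drift:
  assumes st: "drift_step a u s z u1 s1" and less: "D2 u s < D1 u s"
  shows "D2 u1 s1 \<le> (1 - a * c2 / 2) * D2 u s"
proof -
  have a: "0 < a" "a * lam \<le> 1" "a * c2 \<le> 1" "0 \<le> z"
    and iu: "a * norm u * (lam * norm u - del * norm s - L * z) \<le> u \<bullet> (u1 - u)"
    and s1: "(norm s1)\<^sup>2 \<le> (1 - a * lam) * (norm s)\<^sup>2 - a * Gam * z\<^sup>2 + a * del * (norm u)\<^sup>2"
    and u1: "(norm u1)\<^sup>2 \<le> (norm u)\<^sup>2 + a * L * ((norm u)\<^sup>2 + (norm s)\<^sup>2)"
    using st by (auto simp: drift_step_def)
  define U S r t where "U = norm u" and "S = norm s" and "r = rad u s" and "t = sqrt kap * norm s"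
  have nn: "0 \<le> U" "0 \<le> S" "1 \<le> r" "0 \<le> t" using kap by (auto simp: U_def S_def r_def t_def rad_ge_1)
  have t2: "t\<^sup>2 = kap * S\<^sup>2" using kap by (simp add: t_def S_def power_mult_distrib)
  have rle: "r \<le> 1 + U / 2 + t" using rad_le[of u s] by (simp add: r_def U_def t_def)
  have unorm: "U + a * (lam * U - del * S - L * z) \<le> norm u1"
  proof (cases "u = 0")
    case True
    have "0 \<le> a * (del * S + L * z)" using a del L nn by simp
    moreover have "U + a * (lam * U - del * S - L * z) = - (a * (del * S + L * z))"
      using True by (simp add: U_def algebra_simps)
    ultimately show ?thesis using norm_ge_zero[of u1] by linarith
  next
    case False
    then have U: "0 < U" by (simp add: U_def)
    have "U * (U + a * (lam * U - del * S - L * z)) \<le> u \<bullet> u1"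
      using iu by (simp add: U_def S_def inner_diff power2_norm_eq_inner[symmetric] power2_eq_square algebra_simps)
    also have "\<dots> \<le> U * norm u1" by (simp add: U_def norm_cauchy_schwarz)
    finally show ?thesis using U by simp
  qed
  have rnorm: "rad u1 s1 \<le> r + a * (nu * L * (U\<^sup>2 + S\<^sup>2) - kap * lam * S\<^sup>2 - kap * Gam * z\<^sup>2 + kap * del * U\<^sup>2) / (2 * r)"
  proof -
    \<comment> \<open>The square root is linearized by the inequality between the means, so that
      only the squares occurring in the drift condition enter.\<close>
    have "2 * r * rad u1 s1 \<le> r\<^sup>2 + (rad u1 s1)\<^sup>2" by (rule sum_squares_bound)
    also have "(rad u1 s1)\<^sup>2 \<le> 1 + nu * (U\<^sup>2 + a * L * (U\<^sup>2 + S\<^sup>2)) + kap * ((1 - a * lam) * S\<^sup>2 - a * Gam * z\<^sup>2 + a * del * U\<^sup>2)"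
      unfolding rad_sq U_def S_def using u1 s1 nu kap by (intro add_mono mult_left_mono) auto
    also have "\<dots> = r\<^sup>2 + a * (nu * L * (U\<^sup>2 + S\<^sup>2) - kap * lam * S\<^sup>2 - kap * Gam * z\<^sup>2 + kap * del * U\<^sup>2)"
      by (simp add: r_def rad_sq U_def S_def algebra_simps)
    finally have "2 * r * rad u1 s1 \<le> 2 * r * r + a * (nu * L * (U\<^sup>2 + S\<^sup>2) - kap * lam * S\<^sup>2 - kap * Gam * z\<^sup>2 + kap * del * U\<^sup>2)"
      by (simp add: power2_eq_square)
    then have "rad u1 s1 \<le> (2 * r * r + a * (nu * L * (U\<^sup>2 + S\<^sup>2) - kap * lam * S\<^sup>2 - kap * Gam * z\<^sup>2 + kap * del * U\<^sup>2)) / (2 * r)"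
      using nn by (subst pos_le_divide_eq) (auto simp: mult.commute)
    also have "\<dots> = r + a * (nu * L * (U\<^sup>2 + S\<^sup>2) - kap * lam * S\<^sup>2 - kap * Gam * z\<^sup>2 + kap * del * U\<^sup>2) / (2 * r)"
      using nn by (subst add_divide_distrib) simp
    finally show ?thesis .
  qed
  have e1: "(nu * L + kap * del) * U\<^sup>2 / (2 * r) \<le> lam / 4 * U"
  proof -
    have "sqrt nu * U \<le> r"
      unfolding r_def rad_def U_def using nu kap
      by (intro real_le_rsqrt) (simp add: power_mult_distrib add_nonneg_nonneg)
    have "(nu * L + kap * del) * U\<^sup>2 \<le> (lam / 4 * sqrt nu + lam / 4 * sqrt nu) * U\<^sup>2"
    proof (intro mult_right_mono add_mono)
      have "nu * L = sqrt nu * (sqrt nu * L)" using nu by simp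
      also have "\<dots> \<le> sqrt nu * (lam / 4)" using nu by (intro mult_left_mono) auto
      finally show "nu * L \<le> lam / 4 * sqrt nu" by (simp add: mult.commute)
      show "kap * del \<le> lam / 4 * sqrt nu" using del by (simp add: mult.commute)
    qed simp
    also have "\<dots> = lam / 2 * U * (sqrt nu * U)" by (simp add: power2_eq_square algebra_simps)
    also have "\<dots> \<le> lam / 2 * U * r" using \<open>sqrt nu * U \<le> r\<close> lam nn by (intro mult_left_mono) auto
    finally show ?thesis using nn by (simp add: field_simps)
  qed
  have e2: "L * z \<le> kap * Gam * z\<^sup>2 / (2 * r) + del * r"
    by (rule weighted_amgm[OF nn(3)])
  have e3: "nu * L * S\<^sup>2 / (2 * r) \<le> kap * lam * S\<^sup>2 / (4 * r)"
    using mult_right_mono[OF nu(3), of "S\<^sup>2"] nn by (simp add: field_simps)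
  have gain: "norm u - r + a * (3/4 * lam * U - del * (S + r) + lam * t\<^sup>2 / (4 * r)) \<le> norm u1 - rad u1 s1"
  proof -
    have "a * (nu * L * (U\<^sup>2 + S\<^sup>2) - kap * lam * S\<^sup>2 - kap * Gam * z\<^sup>2 + kap * del * U\<^sup>2) / (2 * r)
      = a * ((nu * L + kap * del) * U\<^sup>2 / (2 * r) + nu * L * S\<^sup>2 / (2 * r) - kap * lam * S\<^sup>2 / (2 * r) - kap * Gam * z\<^sup>2 / (2 * r))"
      using nn by (simp add: field_simps)
    also have "\<dots> \<le> a * (lam / 4 * U + kap * lam * S\<^sup>2 / (4 * r) - kap * lam * S\<^sup>2 / (2 * r) + (del * r - L * z))"
    proof (rule mult_left_mono)
      have "kap * lam * S\<^sup>2 / (2 * r) = 2 * (kap * lam * S\<^sup>2 / (4 * r))" by simp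
      then show "(nu * L + kap * del) * U\<^sup>2 / (2 * r) + nu * L * S\<^sup>2 / (2 * r) - kap * lam * S\<^sup>2 / (2 * r) - kap * Gam * z\<^sup>2 / (2 * r)
        \<le> lam / 4 * U + kap * lam * S\<^sup>2 / (4 * r) - kap * lam * S\<^sup>2 / (2 * r) + (del * r - L * z)"
        using e1 e2 e3 by linarith
    qed (use a in simp)
    also have "\<dots> = a * (lam / 4 * U - lam * t\<^sup>2 / (4 * r) + (del * r - L * z))"
      using nn by (simp add: t2 field_simps)
    finally show ?thesis using rnorm unorm by (simp add: algebra_simps U_def)
  qed
  \<comment> \<open>If \<open>U\<close> exceeds 1/4, the term in \<open>U\<close> also controls the
    constant 1; otherwise \<open>t\<^sup>2\<close> exceeds 3/4 and the second term does.\<close>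
  have main: "lam / 32 * (1 + U + t) \<le> 3/4 * lam * U + lam * t\<^sup>2 / (4 * r)"
  proof -
    have tr: "t\<^sup>2 / (1 + U + t) \<le> t\<^sup>2 / r" using rle nn by (intro divide_left_mono) auto
    define q where "q = t\<^sup>2 / (1 + U + t)"
    have q0: "0 \<le> q" unfolding q_def using nn by simp
    have q1: "t - (1 + U) \<le> q"
    proof -
      have "(t - (1 + U)) * (1 + U + t) = t\<^sup>2 - (1 + U)\<^sup>2" by (simp add: power2_eq_square algebra_simps)
      also have "\<dots> \<le> t\<^sup>2" by simp
      finally show ?thesis unfolding q_def using nn by (subst pos_le_divide_eq) auto
    qed
    note q = q0 q1
    have "1/32 * (1 + U + t) \<le> 3/4 * U + t\<^sup>2 / (1 + U + t) / 4"
    proof (cases "1/4 < U")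
      case True
      have "t - (1 + U) \<le> 4 * q" using q by linarith
      then have "1 + U + t \<le> 24 * U + 8 * q" using True nn by linarith
      then show ?thesis unfolding q_def[symmetric] by simp
    next
      case False
      then have t34: "3/4 < t\<^sup>2" using D2_less_D1[OF less] by (simp add: t2 U_def S_def)
      have t86: "86/100 \<le> t"
      proof (rule ccontr)
        assume "\<not> ?thesis"
        then have "t\<^sup>2 \<le> (86/100)\<^sup>2" using nn by (intro power_mono) auto
        then show False using t34 by (simp add: power2_eq_square)
      qed
      have "86 \<le> 100 * t" using t86 by simp
      moreover have U4: "4 * U \<le> 1" using False by simp
      ultimately have "2 * (1 + U + t) \<le> 5 * t" by simp
      then have "t * (2 * (1 + U + t)) \<le> t * (5 * t)" using nn by (intro mult_left_mono)
      then have "2 / 5 * t \<le> q" using nn by (simp add: q_def pos_le_divide_eq power2_eq_square mult_ac)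
      then have "1 + U + t \<le> 24 * U + 8 * q" using \<open>86 \<le> 100 * t\<close> U4 nn by simp
      then show ?thesis unfolding q_def[symmetric] by simp
    qed
    also have "\<dots> \<le> 3/4 * U + t\<^sup>2 / r / 4" by (intro add_left_mono divide_right_mono tr) simp
    finally have "lam * (1/32 * (1 + U + t)) \<le> lam * (3/4 * U + t\<^sup>2 / r / 4)" using lam by simp
    then show ?thesis by (simp add: algebra_simps)
  qed
  \<comment> \<open>By the choice of \<open>c2\<close> the available drift is at least
    \<open>4 * c2 * (1 + U + S)\<close>; half of it is spent on the coupling \<open>del\<close>, the
    other half is the advance.\<close>
  have "c2 * (1 + \<bar>norm u - r\<bar>) \<le> 3/4 * lam * U - del * (S + r) + lam * t\<^sup>2 / (4 * r)"
  proof -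
    have kS: "sqrt kap * (1 + U + S) \<le> 1 + U + t"
      using sqrt_kap nn by (simp add: t_def S_def distrib_left add_mono mult_left_le_one_le)
    have "4 * c2 * (1 + U + S) = lam / 32 * (sqrt kap * (1 + U + S))" by (simp add: c2)
    also have "\<dots> \<le> lam / 32 * (1 + U + t)" using kS lam by (intro mult_left_mono) auto
    finally have 1: "4 * c2 * (1 + U + S) \<le> 3/4 * lam * U + lam * t\<^sup>2 / (4 * r)" using main by linarith
    have tS: "t \<le> S" using sqrt_kap nn by (simp add: t_def S_def mult_left_le_one_le)
    have c2p: "0 < c2" using lam kap by (simp add: c2)
    have 2: "del * (S + r) \<le> c2 * (2 * (1 + U + S))"
      using del nn tS rle c2p by (intro mult_mono) auto
    have "\<bar>norm u - r\<bar> \<le> U + r" using nn by (auto simp: U_def abs_le_iff)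
    then have 3: "c2 * (1 + \<bar>norm u - r\<bar>) \<le> c2 * (2 * (1 + U + S))"
      using c2p nn tS rle by (intro mult_left_mono) auto
    show ?thesis using 1 2 3 by (simp add: algebra_simps)
  qed
  then have "norm u - r + a * c2 * (1 + \<bar>norm u - r\<bar>) \<le> norm u1 - rad u1 s1"
    using gain mult_left_mono[of "c2 * (1 + \<bar>norm u - r\<bar>)" "3/4 * lam * U - del * (S + r) + lam * t\<^sup>2 / (4 * r)" a] a
    unfolding mult.assoc by linarith
  then show ?thesis unfolding D2_def using a lam kap
    by (intro decay_contract) (auto simp: r_def c2)
qed

section \<open>Effect of the noise on the two profiles\<close>

lemma D1_noise:
  "D1 (u + e) (s + f) \<le> D1 u s + (2 * kap) *\<^sub>R s \<bullet> f - (bump u)\<^sup>2 *\<^sub>R u \<bullet> e + 2 * (norm e)\<^sup>2 + kap * (norm f)\<^sup>2"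
proof -
  have "(norm (s + f))\<^sup>2 = (norm s)\<^sup>2 + 2 * (s \<bullet> f) + (norm f)\<^sup>2"
    by (simp add: power2_norm_eq_inner inner_add inner_commute)
  then show ?thesis using bump_noise_global[of u e] by (simp add: D1_def algebra_simps)
qed

lemma D1_noise_near:
  assumes "norm u \<le> r0"
  shows "D1 (u + e) (s + f) \<le> D1 u s + (2 * kap) *\<^sub>R s \<bullet> f - (bump u)\<^sup>2 *\<^sub>R u \<bullet> e
    - (norm e)\<^sup>2 / (16 * (1 + (norm e)\<^sup>2)) + 15/2 * r0 * (norm e)\<^sup>2 + kap * (norm f)\<^sup>2"
proof -
  have "(norm (s + f))\<^sup>2 = (norm s)\<^sup>2 + 2 * (s \<bullet> f) + (norm f)\<^sup>2"
    by (simp add: power2_norm_eq_inner inner_add inner_commute)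
  moreover have "(norm e)\<^sup>2 / (8 * (1 + (norm e)\<^sup>2)) = 2 * ((norm e)\<^sup>2 / (16 * (1 + (norm e)\<^sup>2)))"
    by (simp add: divide_simps)
  moreover note bump_noise_local[OF assms r0(1,2), of e]
  ultimately have "bump (u + e) / 2 \<le> bump u / 2 - (bump u)\<^sup>2 * (u \<bullet> e)
      - (norm e)\<^sup>2 / (16 * (1 + (norm e)\<^sup>2)) + 15/2 * r0 * (norm e)\<^sup>2" by (simp add: algebra_simps)
  then show ?thesis unfolding D1_def \<open>(norm (s + f))\<^sup>2 = _\<close> by (simp add: algebra_simps)
qed

lemma rad_Pair: "rad u s = norm (1::real, sqrt nu *\<^sub>R u, sqrt kap *\<^sub>R s)"
  using nu kap by (simp add: rad_def norm_Pair power_mult_distrib add.assoc)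

lemma rad_lipschitz: "\<bar>rad (u + e) (s + f) - rad u s\<bar> \<le> sqrt ((norm e)\<^sup>2 + (norm f)\<^sup>2)"
proof -
  have "\<bar>rad (u + e) (s + f) - rad u s\<bar> \<le>
     norm ((1::real, sqrt nu *\<^sub>R (u + e), sqrt kap *\<^sub>R (s + f)) - (1::real, sqrt nu *\<^sub>R u, sqrt kap *\<^sub>R s))"
    unfolding rad_Pair by (rule norm_triangle_ineq3)
  also have "\<dots> = sqrt (nu * (norm e)\<^sup>2 + kap * (norm f)\<^sup>2)"
    using nu kap by (simp add: norm_Pair scaleR_add_right power_mult_distrib)
  also have "\<dots> \<le> sqrt ((norm e)\<^sup>2 + (norm f)\<^sup>2)"
    using nu kap by (intro real_sqrt_le_mono add_mono) (auto simp: mult_left_le_one_le)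
  finally show ?thesis .
qed

text \<open>Since \<open>decay\<close> is decreasing, a lower bound for the linear part of the cone
  increment is what counts: \<open>norm\<close> lies above its supporting hyperplane, with the
  subgradient \<open>sgn 0 = 0\<close> at the origin, and \<open>rad\<close> below a quadratic upper
  bound. The factor 9 is 1 from this estimate plus 8 from the squared increment.\<close>

lemma D2_noise:
  "D2 (u + e) (s + f) \<le> D2 u s
     - decay_slope (norm u - rad u s) *\<^sub>R (sgn u - (nu / rad u s) *\<^sub>R u) \<bullet> e
     + (decay_slope (norm u - rad u s) * kap / rad u s) *\<^sub>R s \<bullet> f
     + 9 * D2 u s * ((norm e)\<^sup>2 + (norm f)\<^sup>2)"
proof -
  define S r q E w where "S = norm u - rad u s" and "r = rad u s" and "q = decay_slope (norm u - rad u s)"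
    and "E = (norm e)\<^sup>2 + (norm f)\<^sup>2" and "w = (norm (u + e) - rad (u + e) (s + f)) - (norm u - rad u s)"
  have r: "1 \<le> r" by (simp add: r_def rad_ge_1)
  have E: "0 \<le> E" by (simp add: E_def)
  have wabs: "w\<^sup>2 \<le> 4 * E"
  proof -
    have "\<bar>norm (u + e) - norm u\<bar> \<le> norm e" using norm_triangle_ineq3[of "u+e" u] by simp
    also have "norm e \<le> sqrt E" by (simp add: E_def real_le_rsqrt)
    finally have "\<bar>w\<bar> \<le> 2 * sqrt E" using rad_lipschitz[of u e s f] by (simp add: w_def E_def)
    then have "w\<^sup>2 \<le> (2 * sqrt E)\<^sup>2" by (rule abs_le_square_iff[THEN iffD1, OF order_trans]) simp
    then show ?thesis using E by simp
  qed
  have wl: "sgn u \<bullet> e - (nu * (u \<bullet> e) + kap * (s \<bullet> f)) / r - E \<le> w"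
  proof -
    have "norm u + sgn u \<bullet> e \<le> norm (u + e)"
    proof (cases "u = 0")
      case False
      have "norm u * (norm u + sgn u \<bullet> e) = u \<bullet> (u + e)"
        using False by (simp add: sgn_div_norm inner_add power2_norm_eq_inner[symmetric] power2_eq_square algebra_simps)
      also have "\<dots> \<le> norm u * norm (u + e)" by (rule norm_cauchy_schwarz)
      finally show ?thesis using False by simp
    qed simp
    moreover have "rad (u + e) (s + f) \<le> r + (nu * (u \<bullet> e) + kap * (s \<bullet> f)) / r + E"
    proof -
      have "2 * r * rad (u + e) (s + f) \<le> r\<^sup>2 + (rad (u + e) (s + f))\<^sup>2" by (rule sum_squares_bound)
      also have "(rad (u + e) (s + f))\<^sup>2 = r\<^sup>2 + 2 * (nu * (u \<bullet> e) + kap * (s \<bullet> f)) + (nu * (norm e)\<^sup>2 + kap * (norm f)\<^sup>2)"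
        by (simp add: rad_sq r_def power2_norm_eq_inner inner_add inner_commute algebra_simps)
      also have "nu * (norm e)\<^sup>2 + kap * (norm f)\<^sup>2 \<le> E"
        unfolding E_def using nu kap by (intro add_mono) (auto simp: mult_left_le_one_le)
      also have "E \<le> 2 * r * E" using r E mult_right_mono[of 1 "2 * r" E] by simp
      finally have "2 * r * rad (u + e) (s + f) \<le> 2 * r * (r + (nu * (u \<bullet> e) + kap * (s \<bullet> f)) / r + E)"
        using r by (simp add: distrib_left add_divide_distrib power2_eq_square)
      then show ?thesis using r by simp
    qed
    ultimately show ?thesis by (simp add: w_def r_def)
  qed
  have q: "0 \<le> q" "q \<le> decay S" using decay_slope_bounds[of S] by (auto simp: q_def S_def)
  have "D2 (u + e) (s + f) = decay (S + w)" by (simp add: D2_def S_def w_def)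
  also have "\<dots> \<le> decay S - q * w + 2 * decay S * w\<^sup>2" using decay_add[of S w] by (simp add: q_def S_def)
  also have "\<dots> \<le> decay S - q * (sgn u \<bullet> e - (nu * (u \<bullet> e) + kap * (s \<bullet> f)) / r - E) + 2 * decay S * (4 * E)"
    using q wl wabs decay_pos[of S] by (intro add_mono diff_left_mono mult_left_mono) auto
  also have "\<dots> = decay S - q * (sgn u \<bullet> e - (nu * (u \<bullet> e) + kap * (s \<bullet> f)) / r) + q * E + 8 * decay S * E"
    by (simp add: algebra_simps)
  also have "q * E \<le> decay S * E" using q E by (intro mult_right_mono) auto
  finally have "D2 (u + e) (s + f) \<le> decay S - q * (sgn u \<bullet> e - (nu * (u \<bullet> e) + kap * (s \<bullet> f)) / r) + 9 * decay S * E"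
    by (simp add: mult_ac)
  also have "\<dots> = D2 u s
     - decay_slope (norm u - rad u s) *\<^sub>R (sgn u - (nu / rad u s) *\<^sub>R u) \<bullet> e
     + (decay_slope (norm u - rad u s) * kap / rad u s) *\<^sub>R s \<bullet> f
     + 9 * D2 u s * ((norm e)\<^sup>2 + (norm f)\<^sup>2)"
    by (simp add: D2_def S_def q_def r_def E_def inner_diff_left algebra_simps add_divide_distrib)
  finally show ?thesis .
qed

end

context rates begin

definition lyapunov :: "'a::real_inner \<Rightarrow> 'a \<Rightarrow> real" where
  "lyapunov u s = min (D1 u s) (D2 u s)"

text \<open>The coefficients in \<open>noise_pointwise\<close>, an upper bound for \<open>lyapunov\<close> after a noisy step that is affine in
  \<open>e\<close>, \<open>f\<close>, in a first-order lower bound \<open>y\<close> for the noise and in its squared norm. The term linear in \<open>y\<close> is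
  the gain, which is present only where \<open>u1\<close> is small.\<close>

definition step_const :: "real \<Rightarrow> 'a::real_inner \<Rightarrow> 'a \<Rightarrow> 'a \<Rightarrow> 'a \<Rightarrow> real" where
  "step_const b u s u1 s1 = (if D1 u s \<le> D2 u s then D1 u1 s1 + (if norm u1 \<le> r0 then b * c1\<^sup>2 / 128 else 0) else D2 u1 s1)"

definition step_gain :: "real \<Rightarrow> 'a::real_inner \<Rightarrow> 'a \<Rightarrow> 'a \<Rightarrow> real" where
  "step_gain b u s u1 = (if D1 u s \<le> D2 u s \<and> norm u1 \<le> r0 then b * c1 / 32 else 0)"

definition step_cost :: "real \<Rightarrow> 'a::real_inner \<Rightarrow> 'a \<Rightarrow> 'a \<Rightarrow> 'a \<Rightarrow> real" where
  "step_cost b u s u1 s1 = (if D1 u s \<le> D2 u s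
     then (if norm u1 \<le> r0 then b * (c1\<^sup>2 / (128 * B) + 15/2 * r0 + kap) else b * (2 + kap))
     else 9 * b * D2 u1 s1)"

definition step_lin_u :: "'a::real_inner \<Rightarrow> 'a \<Rightarrow> 'a \<Rightarrow> 'a \<Rightarrow> 'a" where
  "step_lin_u u s u1 s1 = (if D1 u s \<le> D2 u s then - ((bump u1)\<^sup>2 *\<^sub>R u1)
     else - (decay_slope (norm u1 - rad u1 s1) *\<^sub>R (sgn u1 - (nu / rad u1 s1) *\<^sub>R u1)))"

definition step_lin_s :: "'a::real_inner \<Rightarrow> 'a \<Rightarrow> 'a \<Rightarrow> 'a \<Rightarrow> 'a" where
  "step_lin_s u s u1 s1 = (if D1 u s \<le> D2 u s then (2 * kap) *\<^sub>R s1
     else (decay_slope (norm u1 - rad u1 s1) * kap / rad u1 s1) *\<^sub>R s1)"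

lemma lyapunov_pos: "0 < lyapunov u s"
  by (simp add: lyapunov_def D1_pos D2_pos)

lemma step_gain_nonneg: "0 \<le> b \<Longrightarrow> 0 \<le> step_gain b u s u1"
  using c1 by (simp add: step_gain_def)

lemma step_cost_nonneg: "0 \<le> b \<Longrightarrow> 0 \<le> step_cost b u s u1 s1"
  using B r0 kap D2_pos[of u1 s1] by (simp add: step_cost_def)

lemma noise_pointwise:
  assumes t: "t\<^sup>2 = b" "\<bar>t\<bar> * M \<le> 1"
    and e: "e = t *\<^sub>R n1" "f = t *\<^sub>R n2" "(norm n1)\<^sup>2 + (norm n2)\<^sup>2 \<le> m"
    and y: "0 \<le> y" "y \<le> norm n1"
  shows "lyapunov (u1 + e) (s1 + f) \<le> step_const b u s u1 s1 + (step_lin_u u s u1 s1 \<bullet> e + step_lin_s u s u1 s1 \<bullet> f)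
     - step_gain b u s u1 * y + step_cost b u s u1 s1 * m"
proof -
  have b: "0 \<le> b" using t by auto
  have ne: "(norm e)\<^sup>2 = b * (norm n1)\<^sup>2" "(norm f)\<^sup>2 = b * (norm n2)\<^sup>2"
    using t by (simp_all add: e power_mult_distrib)
  have n12: "(norm n1)\<^sup>2 \<le> m" "(norm n2)\<^sup>2 \<le> m"
    using e(3) zero_le_power2[of "norm n1"] zero_le_power2[of "norm n2"] by linarith+
  have M0: "0 < M" using M B c1 by simp
  consider "D1 u s \<le> D2 u s" "norm u1 \<le> r0" | "D1 u s \<le> D2 u s" "r0 < norm u1" | "D2 u s < D1 u s"
    by linarith
  then show ?thesis
  proof cases
    case 1
    define Y where "Y = norm n1"
    have Y: "0 \<le> Y" "y \<le> Y" using y by (auto simp: Y_def)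
    \<comment> \<open>The square in the profile saturates at level \<open>1 / \<bar>t\<bar>\<close>,
      which is beyond \<open>M\<close> by assumption, so truncation at \<open>M\<close> gives a
      lower bound. The slope \<open>c1 / 2\<close> together with \<open>M = B / c1\<close> yields
      \<open>c1\<^sup>2 / 4\<close> once the moments \<open>c1\<close> and \<open>B\<close> are
      inserted.\<close>
    have q1: "b * ((c1/2) * (Y - Y\<^sup>2 / (4 * M)) - (c1/2)\<^sup>2 / 2) / 16 \<le> (norm e)\<^sup>2 / (16 * (1 + (norm e)\<^sup>2))"
    proof -
      have "b * M\<^sup>2 = (\<bar>t\<bar> * M)\<^sup>2" using t by (simp add: power_mult_distrib)
      also have "\<dots> \<le> 1" using t M0 by (simp add: abs_square_le_1 abs_mult)
      finally have "b \<le> 1 / M\<^sup>2" using M0 by (simp add: pos_le_divide_eq)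
      then have le: "1 + b * Y\<^sup>2 \<le> 1 + Y\<^sup>2 / M\<^sup>2" using mult_right_mono[of b "1/M\<^sup>2" "Y\<^sup>2"] by simp
      have "(c1/2) * (Y - Y\<^sup>2 / (4 * M)) - (c1/2)\<^sup>2 / 2 \<le> Y\<^sup>2 / (1 + Y\<^sup>2 / M\<^sup>2)"
        using c1 Y M0 by (intro truncated_square_lower_bound) auto
      also have "\<dots> \<le> Y\<^sup>2 / (1 + b * Y\<^sup>2)"
        using le b Y by (intro divide_left_mono mult_pos_pos) (auto intro!: add_pos_nonneg)
      finally have "b * ((c1/2) * (Y - Y\<^sup>2 / (4 * M)) - (c1/2)\<^sup>2 / 2) \<le> b * (Y\<^sup>2 / (1 + b * Y\<^sup>2))"
        using b by (intro mult_left_mono)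
      then have "b * ((c1/2) * (Y - Y\<^sup>2 / (4 * M)) - (c1/2)\<^sup>2 / 2) / 16 \<le> b * (Y\<^sup>2 / (1 + b * Y\<^sup>2)) / 16"
        by (rule divide_right_mono) simp
      moreover have "b * Y\<^sup>2 / (16 * (1 + b * Y\<^sup>2)) = b * (Y\<^sup>2 / (1 + b * Y\<^sup>2)) / 16"
        by (simp only: times_divide_eq_right divide_divide_eq_left mult.commute[of 16])
      ultimately show ?thesis unfolding ne Y_def[symmetric] by (simp only:)
    qed
    have "b * (c1/2) * y \<le> b * (c1/2) * Y" using b c1 Y by (intro mult_left_mono) auto
    moreover have "b * (c1/2) * (Y\<^sup>2 / (4 * M)) \<le> b * (c1/2) * (m / (4 * M))"
      using n12 b c1 M0 by (intro mult_left_mono divide_right_mono) (auto simp: Y_def)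
    moreover have "b * (c1/2) * (m / (4 * M)) = 16 * (b * (c1\<^sup>2 / (128 * B)) * m)"
      using c1 B by (simp add: M power2_eq_square)
    ultimately have q2: "b * c1 / 32 * y - b * (c1\<^sup>2 / (128 * B)) * m - b * c1\<^sup>2 / 128
       \<le> (norm e)\<^sup>2 / (16 * (1 + (norm e)\<^sup>2))"
      using q1 by (simp add: algebra_simps power2_eq_square)
    have q3: "15/2 * r0 * (norm e)\<^sup>2 \<le> b * (15/2 * r0) * m" unfolding ne
      using n12 r0 b by (simp add: mult_left_mono)
    have q4: "kap * (norm f)\<^sup>2 \<le> b * kap * m" unfolding ne
      using n12 kap b by (simp add: mult_left_mono)
    have "lyapunov (u1 + e) (s1 + f) \<le> D1 (u1 + e) (s1 + f)" by (simp add: lyapunov_def)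
    also note D1_noise_near[OF 1(2), of e s1 f]
    finally show ?thesis using q2 q3 q4 1 by (simp add: step_const_def step_gain_def step_cost_def step_lin_u_def step_lin_s_def algebra_simps)
  next
    case 2
    have q3: "2 * (norm e)\<^sup>2 \<le> b * 2 * m" unfolding ne
      using n12 b by (simp add: mult_left_mono)
    have q4: "kap * (norm f)\<^sup>2 \<le> b * kap * m" unfolding ne
      using n12 kap b by (simp add: mult_left_mono)
    have "lyapunov (u1 + e) (s1 + f) \<le> D1 (u1 + e) (s1 + f)" by (simp add: lyapunov_def)
    also note D1_noise[of u1 e s1 f]
    finally show ?thesis using q3 q4 2 by (simp add: step_const_def step_gain_def step_cost_def step_lin_u_def step_lin_s_def algebra_simps)
  next
    case 3
    have "(norm e)\<^sup>2 + (norm f)\<^sup>2 \<le> b * m"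
      unfolding ne using mult_left_mono[OF e(3) b] by (simp add: algebra_simps)
    then have q: "9 * D2 u1 s1 * ((norm e)\<^sup>2 + (norm f)\<^sup>2) \<le> 9 * D2 u1 s1 * (b * m)"
      using D2_pos[of u1 s1] by (intro mult_left_mono) auto
    have "lyapunov (u1 + e) (s1 + f) \<le> D2 (u1 + e) (s1 + f)" by (simp add: lyapunov_def)
    also note D2_noise[of u1 e s1 f]
    finally show ?thesis using q 3 by (simp add: step_const_def step_gain_def step_cost_def step_lin_u_def step_lin_s_def algebra_simps)
  qed
qed

text \<open>The left side is the pointwise bound after averaging, with the first-order moment
  replaced by \<open>c1\<close> and the second by \<open>B\<close>. In the region of
  \<open>D1\<close> with \<open>norm u1 \<le> r0\<close> the noise gain wins; elsewhere the drift,
  of order \<open>a\<close>, pays for the noise, of order \<open>b\<close>, because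
  \<open>b \<le> eps1 * a\<close>.\<close>

lemma contraction:
  assumes st: "drift_step a u s z u1 s1" and b: "0 \<le> b" "b \<le> eps1 * a"
  shows "step_const b u s u1 s1 - step_gain b u s u1 * c1 + step_cost b u s u1 s1 * B \<le> (1 - g * b) * lyapunov u s"
proof -
  have a: "0 < a" "a * lam \<le> 1" "a * c2 \<le> 1" using st by (auto simp: drift_step_def)
  have g0: "0 < g" using c1 by (simp add: g)
  define S where "S = kap * (norm s)\<^sup>2"
  have S: "0 \<le> S" using kap by (simp add: S_def)
  have bg: "b * g \<le> a * (lam / 2)"
  proof -
    have "b * g \<le> eps1 * a * g" using b g0 by (intro mult_right_mono) auto
    also have "\<dots> = a * (eps1 * g)" by simp
    also have "\<dots> \<le> a * (lam / 2)" using a eps1 by (intro mult_left_mono) auto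
    finally show ?thesis .
  qed
  have bgS: "b * g * S \<le> a * (lam / 2) * S" using bg S by (intro mult_right_mono)
  \<comment> \<open>\<open>D1\<close> can exceed 1 by as much as \<open>S\<close>; the corresponding
    surplus \<open>b * g * S\<close> is paid by the contraction of \<open>s\<close>.\<close>
  have fin: "D1 u s - b * g - b * g * S \<le> (1 - g * b) * D1 u s"
  proof -
    have "g * b * D1 u s \<le> g * b * (1 + S)"
      using D1_le[of u s] g0 b by (intro mult_left_mono) (auto simp: S_def)
    then show ?thesis by (simp add: algebra_simps)
  qed
  consider "D1 u s \<le> D2 u s" "norm u1 \<le> r0" | "D1 u s \<le> D2 u s" "r0 < norm u1" | "D2 u s < D1 u s"
    by linarith
  then show ?thesis
  proof cases
    case 1
    have d: "D1 u1 s1 + a * (lam / 2) * S \<le> D1 u s"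
      using D1_drift[OF st D1_le_D2[OF 1(1)]] 1 by (simp add: S_def mult_ac)
    have "b * (c1\<^sup>2 / 128 + (- (c1\<^sup>2 / 32)) + c1\<^sup>2/128 + 15/2 * r0 * B + kap * B) \<le> b * (- g)"
    proof (rule mult_left_mono[OF _ b(1)])
      show "c1\<^sup>2 / 128 + (- (c1\<^sup>2 / 32)) + c1\<^sup>2/128 + 15/2 * r0 * B + kap * B \<le> - g"
        using r0(3) kap(3) unfolding g by simp
    qed
    moreover have "b * (c1\<^sup>2 / (128 * B) + 15/2 * r0 + kap) * B = b * (c1\<^sup>2/128 + 15/2 * r0 * B + kap * B)"
      using B by (simp add: field_simps)
    ultimately have "b * c1\<^sup>2 / 128 - b * c1 / 32 * c1 + b * (c1\<^sup>2 / (128 * B) + 15/2 * r0 + kap) * B \<le> - (b * g)"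
      by (simp add: algebra_simps power2_eq_square)
    then show ?thesis using d bgS fin 1 by (simp add: step_const_def step_gain_def step_cost_def lyapunov_def min_def)
  next
    case 2
    have d: "D1 u1 s1 + a * eta / 4 + a * (lam / 2) * S \<le> D1 u s"
      using D1_drift[OF st D1_le_D2[OF 2(1)]] 2 by (simp add: S_def mult_ac)
    have "b * (3 * B + g) \<le> eps1 * a * (3 * B + g)" using b B g0 by (intro mult_right_mono) auto
    also have "\<dots> = a * (eps1 * (3 * B + g))" by simp
    also have "\<dots> \<le> a * (eta / 4)" using a eps1 by (intro mult_left_mono) auto
    finally have "b * (3 * B + g) \<le> a * eta / 4" by simp
    moreover have "b * (2 + kap) * B \<le> b * 3 * B" using b B kap by (intro mult_right_mono mult_left_mono) auto
    ultimately have "b * (2 + kap) * B \<le> a * eta / 4 - b * g" by (simp add: algebra_simps)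
    then show ?thesis using d bgS fin 2 by (simp add: step_const_def step_gain_def step_cost_def lyapunov_def min_def)
  next
    case 3
    have d: "D2 u1 s1 \<le> (1 - a * c2 / 2) * D2 u s" using D2_drift[OF st 3] .
    have e9: "b * B * 9 \<le> a * (c2 / 4)"
    proof -
      have "b * (B * 9) \<le> eps1 * a * (B * 9)" using b B by (intro mult_right_mono) auto
      also have "\<dots> = a * (eps1 * B * 9)" by simp
      also have "\<dots> \<le> a * (c2 / 4)" using a eps1 by (intro mult_left_mono) auto
      finally show ?thesis by simp
    qed
    have eg: "b * g \<le> a * (c2 / 4)"
    proof -
      have "b * g \<le> eps1 * a * g" using b g0 by (intro mult_right_mono) auto
      also have "\<dots> = a * (eps1 * g)" by simp
      also have "\<dots> \<le> a * (c2 / 4)" using a eps1 by (intro mult_left_mono) auto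
      finally show ?thesis .
    qed
    have c20: "0 \<le> c2" using lam kap by (simp add: c2)
    have "D2 u1 s1 * (1 + b * B * 9) \<le> (1 - a * c2 / 2) * D2 u s * (1 + b * B * 9)"
      using d b B by (intro mult_right_mono) auto
    also have "\<dots> = ((1 - a * c2 / 2) * (1 + b * B * 9)) * D2 u s" by simp
    also have "\<dots> \<le> (1 - g * b) * D2 u s"
    proof (rule mult_right_mono)
      have "0 \<le> a * c2 / 2 * (b * B * 9)" using a b B c20 by simp
      moreover have "(1 - a * c2 / 2) * (1 + b * B * 9) = 1 - a * c2 / 2 + b * B * 9 - a * c2 / 2 * (b * B * 9)"
        by (simp add: algebra_simps)
      ultimately show "(1 - a * c2 / 2) * (1 + b * B * 9) \<le> 1 - g * b" using e9 eg mult.commute[of g b] by linarith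
    qed (use D2_pos[of u s] in simp)
    finally have "D2 u1 s1 + 9 * b * D2 u1 s1 * B \<le> (1 - g * b) * D2 u s" by (simp add: algebra_simps)
    then show ?thesis using 3 by (simp add: step_const_def step_gain_def step_cost_def lyapunov_def min_def)
  qed
qed

lemma D1_measurable [measurable (raw)]:
  fixes u s :: "'o \<Rightarrow> 'a::euclidean_space"
  assumes [measurable]: "u \<in> borel_measurable N" "s \<in> borel_measurable N"
  shows "(\<lambda>w. D1 (u w) (s w)) \<in> borel_measurable N"
  unfolding D1_def bump_def by measurable

lemma rad_measurable [measurable (raw)]:
  fixes u s :: "'o \<Rightarrow> 'a::euclidean_space"
  assumes [measurable]: "u \<in> borel_measurable N" "s \<in> borel_measurable N"
  shows "(\<lambda>w. rad (u w) (s w)) \<in> borel_measurable N"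
  unfolding rad_def by measurable

lemma D2_measurable [measurable (raw)]:
  fixes u s :: "'o \<Rightarrow> 'a::euclidean_space"
  assumes [measurable]: "u \<in> borel_measurable N" "s \<in> borel_measurable N"
  shows "(\<lambda>w. D2 (u w) (s w)) \<in> borel_measurable N"
  unfolding D2_def decay_def by measurable

text \<open>Crude bounds that serve integrability: on an event where the arguments are bounded, the
  coefficients become bounded weights.\<close>

lemma coefficient_bounds:
  fixes u s u1 s1 :: "'a::euclidean_space"
  assumes b: "0 \<le> b" "b \<le> 1" and K: "norm u1 \<le> K" "norm s1 \<le> K" "norm s \<le> K"
  shows "\<bar>step_const b u s u1 s1\<bar> \<le> (2 + K)\<^sup>2 + c1\<^sup>2" "\<bar>step_gain b u s u1\<bar> \<le> c1"
    "\<bar>step_cost b u s u1 s1\<bar> \<le> c1\<^sup>2 / B + 10 + 9 * (2 + K)\<^sup>2"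
    "norm (step_lin_u u s u1 s1) \<le> 1 + K" "norm (step_lin_s u s u1 s1) \<le> 2 * K" "\<bar>lyapunov u s\<bar> \<le> (2 + K)\<^sup>2"
proof -
  have K0: "0 \<le> K" using K norm_ge_zero order_trans by blast
  have kn: "kap * (norm v)\<^sup>2 \<le> K\<^sup>2" if "norm v \<le> K" for v :: 'a
    using kap mult_mono[of kap 1 "(norm v)\<^sup>2" "K\<^sup>2"] power_mono[OF that] by simp
  have K2: "1 + K\<^sup>2 \<le> (2 + K)\<^sup>2" "2 + 2 * K \<le> (2 + K)\<^sup>2" using K0 by (auto simp: power2_eq_square algebra_simps)
  have d1: "D1 v w \<le> (2 + K)\<^sup>2" if "norm w \<le> K" for v w :: 'a
    using D1_le[of v w] kn[OF that] K2 by linarith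
  have d2: "D2 v w \<le> (2 + K)\<^sup>2" if "norm v \<le> K" "norm w \<le> K" for v w :: 'a
  proof -
    have r: "rad v w \<le> 1 + 2 * K"
      using rad_le[of v w] that sqrt_kap mult_mono[of "sqrt kap" 1 "norm w" K] K0 by simp
    have "D2 v w \<le> decay (- rad v w)" unfolding D2_def by (intro decay_antimono) simp
    also have "\<dots> = 1 + rad v w" using rad_ge_1[of v w] by (simp add: decay_def)
    finally show ?thesis using r K2 by linarith
  qed
  note p = D1_pos D2_pos
  have bc: "b * c1\<^sup>2 \<le> c1\<^sup>2" "b * c1 \<le> c1" using b c1 by (auto simp: mult_left_le_one_le)
  show "\<bar>step_const b u s u1 s1\<bar> \<le> (2 + K)\<^sup>2 + c1\<^sup>2"
  proof -
    have "0 \<le> b * c1\<^sup>2" using b by simp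
    then show ?thesis
      using d1[of s1 u1] d2[of u1 s1] K p[of u1 s1] bc by (auto simp: step_const_def abs_le_iff)
  qed
  show "\<bar>step_gain b u s u1\<bar> \<le> c1" using bc c1 b mult_nonneg_nonneg[of b c1] by (auto simp: step_gain_def)
  show "\<bar>step_cost b u s u1 s1\<bar> \<le> c1\<^sup>2 / B + 10 + 9 * (2 + K)\<^sup>2"
  proof -
    have "step_cost b u s u1 s1 \<le> 1 * (c1\<^sup>2 / B + 10 + 9 * (2 + K)\<^sup>2)"
    proof -
      have B0: "0 \<le> c1\<^sup>2 / B" using B by simp
      have "c1\<^sup>2 / (128 * B) = c1\<^sup>2 / B / 128" by simp
      then have x: "c1\<^sup>2 / (128 * B) \<le> c1\<^sup>2 / B" using B0 by linarith
      have 1: "b * (c1\<^sup>2 / (128 * B) + 15/2 * r0 + kap) \<le> 1 * (c1\<^sup>2 / B + 10 + 9 * (2 + K)\<^sup>2)"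
      proof (intro mult_mono)
        have "0 \<le> (2 + K)\<^sup>2" by simp
        then show "c1\<^sup>2 / (128 * B) + 15/2 * r0 + kap \<le> c1\<^sup>2 / B + 10 + 9 * (2 + K)\<^sup>2"
          using x r0 kap by linarith
      qed (use b r0 kap B in auto)
      have 2: "b * (2 + kap) \<le> 1 * (c1\<^sup>2 / B + 10 + 9 * (2 + K)\<^sup>2)"
      proof (intro mult_mono)
        have "0 \<le> (2 + K)\<^sup>2" by simp
        then show "2 + kap \<le> c1\<^sup>2 / B + 10 + 9 * (2 + K)\<^sup>2" using B0 kap by linarith
      qed (use b kap in auto)
      have 3: "b * (9 * D2 u1 s1) \<le> 1 * (c1\<^sup>2 / B + 10 + 9 * (2 + K)\<^sup>2)"
        using b B0 d2[of u1 s1] K p(2)[of u1 s1] by (intro mult_mono) auto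
      show ?thesis using 1 2 3 by (auto simp: step_cost_def mult_ac)
    qed
    then show ?thesis using step_cost_nonneg[OF b(1), of u s u1 s1] by simp
  qed
  have ds: "0 \<le> decay_slope x" "decay_slope x \<le> 1" for x using decay_slope_bounds by auto
  have r1: "nu / rad u1 s1 \<le> 1" "0 \<le> nu / rad u1 s1" "kap / rad u1 s1 \<le> 1" "0 \<le> kap / rad u1 s1"
    using nu kap rad_ge_1[of u1 s1] by (auto simp: divide_le_eq_1)
  show "norm (step_lin_u u s u1 s1) \<le> 1 + K"
  proof -
    have "norm ((bump u1)\<^sup>2 *\<^sub>R u1) \<le> 1 * K"
      using bump_pos[of u1] bump_le_1[of u1] K unfolding norm_scaleR by (intro mult_mono) (auto simp: power_le_one)
    moreover have "norm (decay_slope (norm u1 - rad u1 s1) *\<^sub>R (sgn u1 - (nu / rad u1 s1) *\<^sub>R u1)) \<le> 1 * (1 + 1 * K)"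
    proof -
      have "norm (sgn u1 - (nu / rad u1 s1) *\<^sub>R u1) \<le> norm (sgn u1) + norm ((nu / rad u1 s1) *\<^sub>R u1)"
        by (rule norm_triangle_ineq4)
      also have "\<dots> \<le> 1 + 1 * K"
      proof (rule add_mono)
        show "norm (sgn u1) \<le> 1" by (simp add: norm_sgn)
        have "norm ((nu / rad u1 s1) *\<^sub>R u1) = nu / rad u1 s1 * norm u1" unfolding norm_scaleR using r1 by (simp only: abs_of_nonneg)
        also have "\<dots> \<le> 1 * K" using r1 K by (intro mult_mono) auto
        finally show "norm ((nu / rad u1 s1) *\<^sub>R u1) \<le> 1 * K" .
      qed
      finally show ?thesis using ds K0 unfolding norm_scaleR by (intro mult_mono) auto
    qed
    ultimately show ?thesis using K0 by (auto simp: step_lin_u_def)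
  qed
  show "norm (step_lin_s u s u1 s1) \<le> 2 * K"
  proof -
    have "norm ((2 * kap) *\<^sub>R s1) \<le> 2 * K"
    proof -
      have "norm ((2 * kap) *\<^sub>R s1) = 2 * kap * norm s1" using kap by simp
      also have "\<dots> \<le> 2 * K" using kap K by (intro mult_mono) auto
      finally show ?thesis .
    qed
    moreover have "norm ((decay_slope (norm u1 - rad u1 s1) * kap / rad u1 s1) *\<^sub>R s1) \<le> 2 * K"
    proof -
      have q: "0 \<le> decay_slope (norm u1 - rad u1 s1) * (kap / rad u1 s1)"
        by (intro mult_nonneg_nonneg ds r1)
      have "norm ((decay_slope (norm u1 - rad u1 s1) * kap / rad u1 s1) *\<^sub>R s1)
         = (decay_slope (norm u1 - rad u1 s1) * (kap / rad u1 s1)) * norm s1"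
        unfolding norm_scaleR times_divide_eq_right[symmetric] using q by (simp only: abs_of_nonneg)
      also have "\<dots> \<le> (1 * 1) * K" using ds r1 K by (intro mult_mono) auto
      finally show ?thesis using K0 by simp
    qed
    ultimately show ?thesis by (auto simp: step_lin_s_def)
  qed
  show "\<bar>lyapunov u s\<bar> \<le> (2 + K)\<^sup>2"
    using d1[of s u] K p[of u s] by (auto simp: lyapunov_def)
qed

end

section \<open>Averaging one step over the noise\<close>

context rates begin

text \<open>The pointwise bound is affine in the noise with coefficients known from the past
  \<open>Gs\<close>, so it integrates term by term: \<open>N1\<close> removes the linear term,
  \<open>N2\<close> and \<open>N3\<close> insert the moments, and \<open>contraction\<close>
  finishes. The event \<open>al\<close> belongs to the past and is simply part of the
  weight.\<close>

lemma expected_step: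
  fixes u s u1 s1 n :: "'o \<Rightarrow> 'a::euclidean_space" and y z :: "'o \<Rightarrow> real" and Pu Ps :: "'a \<Rightarrow> 'a"
  assumes fm: "finite_measure Mm" and sub: "subalgebra Mm Gs"
    and mG [measurable]: "u \<in> borel_measurable Gs" "s \<in> borel_measurable Gs"
      "u1 \<in> borel_measurable Gs" "s1 \<in> borel_measurable Gs"
    and mM [measurable]: "n \<in> borel_measurable Mm" "y \<in> borel_measurable Mm"
    and al [measurable]: "al \<in> sets Gs"
    and st: "\<And>w. w \<in> al \<Longrightarrow> drift_step a (u w) (s w) (z w) (u1 w) (s1 w)"
    and K: "\<And>w. w \<in> al \<Longrightarrow> norm (u1 w) \<le> K" "\<And>w. w \<in> al \<Longrightarrow> norm (s1 w) \<le> K" "\<And>w. w \<in> al \<Longrightarrow> norm (s w) \<le> K"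
    and lin: "linear Pu" "linear Ps"
    and adj: "\<And>v w. Pu v \<bullet> w = v \<bullet> Pu w" "\<And>v w. Ps v \<bullet> w = v \<bullet> Ps w"
    and pyth: "\<And>v. (norm (Pu v))\<^sup>2 + (norm (Ps v))\<^sup>2 \<le> (norm v)\<^sup>2"
    and t: "t\<^sup>2 = b" "\<bar>t\<bar> * M \<le> 1" "b \<le> eps1 * a" "b \<le> 1"
    and y: "\<And>w. 0 \<le> y w" "\<And>w. y w \<le> norm (Pu (n w))"
    and int: "integrable Mm (\<lambda>w. (norm (n w))\<^sup>2)"
    and N1: "\<And>G i C. G \<in> borel_measurable Gs \<Longrightarrow> (\<And>w. \<bar>G w\<bar> \<le> C) \<Longrightarrow> i \<in> Basis \<Longrightarrow>
        (\<integral>w. G w * (n w \<bullet> i) \<partial>Mm) = 0"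
    and N2: "\<And>G C. G \<in> borel_measurable Gs \<Longrightarrow> (\<And>w. 0 \<le> G w) \<Longrightarrow> (\<And>w. G w \<le> C) \<Longrightarrow>
        (\<integral>w. G w * (norm (n w))\<^sup>2 \<partial>Mm) \<le> B * (\<integral>w. G w \<partial>Mm)"
    and N3: "\<And>G C. G \<in> borel_measurable Gs \<Longrightarrow> (\<And>w. 0 \<le> G w) \<Longrightarrow> (\<And>w. G w \<le> C) \<Longrightarrow>
        c1 * (\<integral>w. G w \<partial>Mm) \<le> (\<integral>w. G w * y w \<partial>Mm)"
  shows "integrable Mm (\<lambda>w. indicator al w * lyapunov (u1 w + t *\<^sub>R Pu (n w)) (s1 w + t *\<^sub>R Ps (n w)))" (is ?int)
    and "(\<integral>w. indicator al w * lyapunov (u1 w + t *\<^sub>R Pu (n w)) (s1 w + t *\<^sub>R Ps (n w)) \<partial>Mm)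
      \<le> (1 - g * b) * (\<integral>w. indicator al w * lyapunov (u w) (s w) \<partial>Mm)"
proof -
  interpret finite_measure Mm by fact
  have b: "0 \<le> b" using t by auto
  define k where "k = \<bar>K\<bar>"
  have k: "0 \<le> k" by (simp add: k_def)
  have kK: "norm (u1 w) \<le> k" "norm (s1 w) \<le> k" "norm (s w) \<le> k" if "w \<in> al" for w
    using K[OF that] unfolding k_def by linarith+
  have cb: "\<bar>step_const b (u w) (s w) (u1 w) (s1 w)\<bar> \<le> (2 + k)\<^sup>2 + c1\<^sup>2" "\<bar>step_gain b (u w) (s w) (u1 w)\<bar> \<le> c1"
    "\<bar>step_cost b (u w) (s w) (u1 w) (s1 w)\<bar> \<le> c1\<^sup>2 / B + 10 + 9 * (2 + k)\<^sup>2"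
    "norm (step_lin_u (u w) (s w) (u1 w) (s1 w)) \<le> 1 + k" "norm (step_lin_s (u w) (s w) (u1 w) (s1 w)) \<le> 2 * k"
    "\<bar>lyapunov (u w) (s w)\<bar> \<le> (2 + k)\<^sup>2" if "w \<in> al" for w
    using coefficient_bounds[OF b t(4) kK[OF that]] by auto
  have [measurable]: "Pu \<in> borel_measurable borel" "Ps \<in> borel_measurable borel"
    using lin by (auto intro!: borel_measurable_continuous_onI linear_continuous_on linear_conv_bounded_linear[THEN iffD1])
  define I where "I = (indicator al :: 'o \<Rightarrow> real)"
  have I [measurable]: "I \<in> borel_measurable Gs" by (simp add: I_def)
  have I01: "I w = 1 \<or> I w = 0" "I w \<noteq> 0 \<Longrightarrow> w \<in> al" for w by (auto simp: I_def indicator_def)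
  define X where "X w = I w * step_const b (u w) (s w) (u1 w) (s1 w)" for w
  define p where "p w = I w * step_gain b (u w) (s w) (u1 w)" for w
  define q where "q w = I w * step_cost b (u w) (s w) (u1 w) (s1 w)" for w
  \<comment> \<open>Self-adjointness moves \<open>Pu\<close> and \<open>Ps\<close> from the noise to
    the coefficients, so the linear term is an inner product with the raw noise
    \<open>n\<close>.\<close>
  define l where "l w = (I w * t) *\<^sub>R (Pu (step_lin_u (u w) (s w) (u1 w) (s1 w)) + Ps (step_lin_s (u w) (s w) (u1 w) (s1 w)))" for w
  have mX [measurable]: "X \<in> borel_measurable Gs" unfolding X_def step_const_def by measurable
  have mp [measurable]: "p \<in> borel_measurable Gs" unfolding p_def step_gain_def by measurable
  have mq [measurable]: "q \<in> borel_measurable Gs" unfolding q_def step_cost_def by measurable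
  have ml [measurable]: "l \<in> borel_measurable Gs"
    unfolding l_def step_lin_u_def step_lin_s_def bump_def decay_slope_def sgn_div_norm by measurable
  note toM = measurable_from_subalg[OF sub]
  have Xb: "\<bar>X w\<bar> \<le> (2 + k)\<^sup>2 + c1\<^sup>2" for w
    using I01[of w] cb(1)[of w] by (auto simp: X_def)
  have pb: "0 \<le> p w" "p w \<le> c1" for w
    using I01[of w] cb(2)[of w] c1 step_gain_nonneg[OF b] by (auto simp: p_def)
  have qb: "0 \<le> q w" "q w \<le> c1\<^sup>2 / B + 10 + 9 * (2 + k)\<^sup>2" for w
    using I01[of w] cb(3)[of w] B step_cost_nonneg[OF b] by (auto simp: q_def)
  have Pn: "norm (Pu v) \<le> norm v" "norm (Ps v) \<le> norm v" for v
  proof -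
    have "(norm (Pu v))\<^sup>2 \<le> (norm v)\<^sup>2" "(norm (Ps v))\<^sup>2 \<le> (norm v)\<^sup>2"
      using pyth[of v] zero_le_power2[of "norm (Pu v)"] zero_le_power2[of "norm (Ps v)"] by linarith+
    then show "norm (Pu v) \<le> norm v" "norm (Ps v) \<le> norm v" by auto
  qed
  have lb: "norm (l w) \<le> \<bar>t\<bar> * (1 + k + 2 * k)" for w
  proof (cases "w \<in> al")
    case True
    have "norm (Pu (step_lin_u (u w) (s w) (u1 w) (s1 w)) + Ps (step_lin_s (u w) (s w) (u1 w) (s1 w))) \<le> (1 + k) + 2 * k"
      using cb(4,5)[OF True] Pn by (intro norm_triangle_le add_mono) (meson order_trans)+
    then show ?thesis using True by (simp add: l_def I_def mult_left_mono)
  next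
    case False then show ?thesis using k by (simp add: l_def I_def)
  qed
  \<comment> \<open>Every integrand in the final estimate is dominated by a multiple of
    \<open>1 + (norm (n w))\<^sup>2\<close> or by a sum of such terms; square integrability is all
    that the noise provides.\<close>
  have dom: "integrable Mm f" if "f \<in> borel_measurable Mm" "\<And>w. \<bar>f w\<bar> \<le> C * (1 + (norm (n w))\<^sup>2)" for f :: "'o \<Rightarrow> real" and C
  proof (rule Bochner_Integration.integrable_bound[of _ "\<lambda>w. C * (1 + (norm (n w))\<^sup>2)"])
    show "integrable Mm (\<lambda>w. C * (1 + (norm (n w))\<^sup>2))" using int by (intro integrable_mult_right Bochner_Integration.integrable_add) auto
    show "AE w in Mm. norm (f w) \<le> norm (C * (1 + (norm (n w))\<^sup>2))"
      using that(2) by (intro AE_I2) (smt (verit, best) real_norm_def)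
  qed fact
  have sq1: "r \<le> 1 + r\<^sup>2" for r :: real using sum_squares_bound[of 1 r] by (smt (verit) one_power2 zero_le_power2 power2_eq_square mult_le_cancel_right1 zero_less_mult_iff mult_nonneg_nonneg)
  have iX: "integrable Mm X"
    by (rule dom[of _ "(2 + k)\<^sup>2 + c1\<^sup>2"]) (use toM[OF mX] in simp, use Xb in \<open>smt (verit) mult_le_cancel_left1 zero_le_power2\<close>)
  have ip0: "integrable Mm p"
    by (rule dom[of _ "c1"]) (use toM[OF mp] in simp, use pb c1 in \<open>smt (verit) mult_le_cancel_left1 zero_le_power2\<close>)
  have iq0: "integrable Mm q"
    by (rule dom[of _ "c1\<^sup>2 / B + 10 + 9 * (2 + k)\<^sup>2"]) (use toM[OF mq] in simp, use qb in \<open>smt (verit) mult_le_cancel_left1 zero_le_power2\<close>)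
  have ip: "integrable Mm (\<lambda>w. p w * y w)"
  proof (rule dom[of _ "c1"])
    show "(\<lambda>w. p w * y w) \<in> borel_measurable Mm" using toM[OF mp] by measurable
    fix w
    have "y w \<le> 1 + (norm (n w))\<^sup>2" using y(2)[of w] Pn(1)[of "n w"] sq1[of "norm (n w)"] by linarith
    then have "p w * y w \<le> c1 * (1 + (norm (n w))\<^sup>2)" using pb[of w] y(1)[of w] c1 by (intro mult_mono) auto
    then show "\<bar>p w * y w\<bar> \<le> c1 * (1 + (norm (n w))\<^sup>2)" using pb[of w] y(1)[of w] by simp
  qed
  have iq: "integrable Mm (\<lambda>w. q w * (norm (n w))\<^sup>2)"
  proof (rule dom[of _ "c1\<^sup>2 / B + 10 + 9 * (2 + k)\<^sup>2"])
    show "(\<lambda>w. q w * (norm (n w))\<^sup>2) \<in> borel_measurable Mm" using toM[OF mq] by measurable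
    fix w
    have "q w * (norm (n w))\<^sup>2 \<le> (c1\<^sup>2 / B + 10 + 9 * (2 + k)\<^sup>2) * (1 + (norm (n w))\<^sup>2)"
      using qb[of w] by (intro mult_mono) auto
    then show "\<bar>q w * (norm (n w))\<^sup>2\<bar> \<le> (c1\<^sup>2 / B + 10 + 9 * (2 + k)\<^sup>2) * (1 + (norm (n w))\<^sup>2)"
      using qb[of w] by simp
  qed
  define T where "T = \<bar>t\<bar> * (1 + k + 2 * k)"
  have T0: "0 \<le> T" using k by (simp add: T_def)
  have li: "\<bar>l w \<bullet> i\<bar> \<le> T" if "i \<in> Basis" for w i
    using Basis_le_norm[OF that, of "l w"] lb[of w] by (simp add: T_def)
  have il: "integrable Mm (\<lambda>w. (l w \<bullet> i) * (n w \<bullet> i))" if i: "i \<in> Basis" for i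
  proof (rule dom[of _ T])
    show "(\<lambda>w. (l w \<bullet> i) * (n w \<bullet> i)) \<in> borel_measurable Mm" using toM[OF ml] by measurable
    fix w
    have "\<bar>n w \<bullet> i\<bar> \<le> 1 + (norm (n w))\<^sup>2" using Basis_le_norm[OF i, of "n w"] sq1[of "norm (n w)"] by linarith
    then show "\<bar>(l w \<bullet> i) * (n w \<bullet> i)\<bar> \<le> T * (1 + (norm (n w))\<^sup>2)"
      unfolding abs_mult using li[OF i] T0 by (intro mult_mono) auto
  qed
  have leq: "l w \<bullet> n w = (\<Sum>i\<in>Basis. (l w \<bullet> i) * (n w \<bullet> i))" for w by (rule euclidean_inner)
  have iln: "integrable Mm (\<lambda>w. l w \<bullet> n w)" unfolding leq using il by (intro Bochner_Integration.integrable_sum)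
  have l0: "(\<integral>w. l w \<bullet> n w \<partial>Mm) = 0"
  proof -
    have "(\<integral>w. l w \<bullet> n w \<partial>Mm) = (\<Sum>i\<in>Basis. (\<integral>w. (l w \<bullet> i) * (n w \<bullet> i) \<partial>Mm))"
      unfolding leq using il by (intro Bochner_Integration.integral_sum)
    also have "\<dots> = 0"
    proof (intro sum.neutral ballI)
      fix i :: 'a assume i: "i \<in> Basis"
      show "(\<integral>w. (l w \<bullet> i) * (n w \<bullet> i) \<partial>Mm) = 0"
        by (rule N1[of _ T]) (use li[OF i] i in auto)
    qed
    finally show ?thesis .
  qed
  define D' where "D' w = I w * lyapunov (u1 w + t *\<^sub>R Pu (n w)) (s1 w + t *\<^sub>R Ps (n w))" for w
  define R where "R w = X w + l w \<bullet> n w - p w * y w + q w * (norm (n w))\<^sup>2" for w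
  have pw: "D' w \<le> R w" for w
  proof (cases "w \<in> al")
    case True
    have "lyapunov (u1 w + t *\<^sub>R Pu (n w)) (s1 w + t *\<^sub>R Ps (n w)) \<le> step_const b (u w) (s w) (u1 w) (s1 w)
      + (step_lin_u (u w) (s w) (u1 w) (s1 w) \<bullet> (t *\<^sub>R Pu (n w)) + step_lin_s (u w) (s w) (u1 w) (s1 w) \<bullet> (t *\<^sub>R Ps (n w)))
      - step_gain b (u w) (s w) (u1 w) * y w + step_cost b (u w) (s w) (u1 w) (s1 w) * (norm (n w))\<^sup>2"
      by (rule noise_pointwise[OF t(1,2) refl refl pyth y])
    then show ?thesis using True
      by (simp add: D'_def R_def X_def l_def p_def q_def I_def adj inner_add_left algebra_simps)
  next
    case False then show ?thesis by (simp add: D'_def R_def X_def l_def p_def q_def I_def)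
  qed
  have D0: "0 \<le> D' w" for w using lyapunov_pos[of "u1 w + t *\<^sub>R Pu (n w)" "s1 w + t *\<^sub>R Ps (n w)"] by (simp add: D'_def I_def)
  have iR: "integrable Mm R" unfolding R_def using iX iln ip iq
    by (intro Bochner_Integration.integrable_add Bochner_Integration.integrable_diff)
  have iD': "integrable Mm D'"
  proof (rule Bochner_Integration.integrable_bound[OF iR])
    show "D' \<in> borel_measurable Mm"
      using toM[OF mG(3)] toM[OF mG(4)] toM[OF I] unfolding D'_def lyapunov_def by measurable
    show "AE w in Mm. norm (D' w) \<le> norm (R w)"
      using pw D0 by (intro AE_I2) (smt (verit) real_norm_def)
  qed
  then show ?int by (simp add: D'_def[abs_def] I_def)
  have iD: "integrable Mm (\<lambda>w. I w * lyapunov (u w) (s w))"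
  proof (rule dom[of _ "(2 + k)\<^sup>2"])
    show "(\<lambda>w. I w * lyapunov (u w) (s w)) \<in> borel_measurable Mm"
      using toM[OF mG(1)] toM[OF mG(2)] toM[OF I] unfolding lyapunov_def by measurable
    fix w
    have "\<bar>I w * lyapunov (u w) (s w)\<bar> \<le> (2 + k)\<^sup>2 * 1"
      using I01[of w] cb(6)[of w] by auto
    also have "\<dots> \<le> (2 + k)\<^sup>2 * (1 + (norm (n w))\<^sup>2)" by (intro mult_left_mono) auto
    finally show "\<bar>I w * lyapunov (u w) (s w)\<bar> \<le> (2 + k)\<^sup>2 * (1 + (norm (n w))\<^sup>2)" .
  qed
  have "(\<integral>w. D' w \<partial>Mm) \<le> (\<integral>w. R w \<partial>Mm)" by (intro integral_mono iD' iR pw)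
  also have "\<dots> = (\<integral>w. X w \<partial>Mm) - (\<integral>w. p w * y w \<partial>Mm) + (\<integral>w. q w * (norm (n w))\<^sup>2 \<partial>Mm)"
    unfolding R_def using iX iln ip iq l0 by simp
  also have "\<dots> \<le> (\<integral>w. X w \<partial>Mm) - c1 * (\<integral>w. p w \<partial>Mm) + B * (\<integral>w. q w \<partial>Mm)"
    by (intro add_mono diff_mono order_refl N2[OF mq] N3[OF mp]) (use pb qb in auto)
  also have "\<dots> = (\<integral>w. X w - c1 * p w + B * q w \<partial>Mm)"
    using iX ip0 iq0 by simp
  also have "\<dots> \<le> (\<integral>w. (1 - g * b) * (I w * lyapunov (u w) (s w)) \<partial>Mm)"
  proof (intro integral_mono)
    show "integrable Mm (\<lambda>w. X w - c1 * p w + B * q w)" using iX ip0 iq0 by simp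
    show "integrable Mm (\<lambda>w. (1 - g * b) * (I w * lyapunov (u w) (s w)))" using iD by simp
    fix w
    show "X w - c1 * p w + B * q w \<le> (1 - g * b) * (I w * lyapunov (u w) (s w))"
    proof (cases "w \<in> al")
      case True
      then show ?thesis using contraction[OF st[OF True] b t(3)]
        by (simp add: X_def p_def q_def I_def mult.commute)
    next
      case False then show ?thesis by (simp add: X_def p_def q_def I_def)
    qed
  qed
  finally show "(\<integral>w. indicator al w * lyapunov (u1 w + t *\<^sub>R Pu (n w)) (s1 w + t *\<^sub>R Ps (n w)) \<partial>Mm)
      \<le> (1 - g * b) * (\<integral>w. indicator al w * lyapunov (u w) (s w) \<partial>Mm)"
    by (simp add: D'_def I_def)
qed

end

section \<open>Two independent copies of the noise\<close>

text \<open>Conditional moments are expressed through integrals against bounded \<open>F\<close>-measurable weights, because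
  in this form they pass to the product space by Fubini's theorem.\<close>

definition cond_noise :: "'w measure \<Rightarrow> 'w measure \<Rightarrow> ('w \<Rightarrow> 'a::euclidean_space) \<Rightarrow> 'a \<Rightarrow> real \<Rightarrow> real \<Rightarrow> bool" where
  "cond_noise P F \<xi> \<theta> B c \<longleftrightarrow> \<xi> \<in> borel_measurable P \<and> integrable P (\<lambda>w. (norm (\<xi> w))\<^sup>2)
    \<and> (\<forall>G C v. G \<in> borel_measurable F \<longrightarrow> (\<forall>w. \<bar>G w\<bar> \<le> C) \<longrightarrow> (\<integral>w. G w * (\<xi> w \<bullet> v) \<partial>P) = 0)
    \<and> (\<forall>G C. G \<in> borel_measurable F \<longrightarrow> (\<forall>w. 0 \<le> G w \<and> G w \<le> C) \<longrightarrow>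
        (\<integral>w. G w * (norm (\<xi> w))\<^sup>2 \<partial>P) \<le> B * (\<integral>w. G w \<partial>P)
        \<and> c * (\<integral>w. G w \<partial>P) \<le> (\<integral>w. G w * max 0 (\<xi> w \<bullet> \<theta>) \<partial>P))"

lemma subalgebra_pair:
  assumes "subalgebra P F" "subalgebra P' F'"
  shows "subalgebra (P \<Otimes>\<^sub>M P') (F \<Otimes>\<^sub>M F')"
proof -
  have "sets (F \<Otimes>\<^sub>M F') \<subseteq> sets (P \<Otimes>\<^sub>M P')"
  proof -
    have sp: "space F = space P" "space F' = space P'" using assms by (auto simp: subalgebra_def)
    have "{a \<times> b | a b. a \<in> sets F \<and> b \<in> sets F'} \<subseteq> sets (P \<Otimes>\<^sub>M P')"
      using assms by (auto simp: subalgebra_def)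
    from sets.sigma_sets_subset[OF this] show ?thesis
      unfolding sets_pair_measure[of F F'] sp space_pair_measure .
  qed
  then show ?thesis using assms by (simp add: subalgebra_def space_pair_measure)
qed

context prob_space begin

lemma integrable_comp_fst:
  fixes f :: "'a \<Rightarrow> real"
  assumes "integrable M f" shows "integrable (M \<Otimes>\<^sub>M M) (\<lambda>z. f (fst z))"
  using integrable_distr[of fst "M \<Otimes>\<^sub>M M" M f] assms by (simp add: distr_pair_fst)

lemma integrable_comp_snd:
  fixes f :: "'a \<Rightarrow> real"
  assumes "integrable M f" shows "integrable (M \<Otimes>\<^sub>M M) (\<lambda>z. f (snd z))"
proof -
  interpret pp: pair_sigma_finite M M by standard
  show ?thesis using pp.integrable_product_swap[OF integrable_comp_fst[OF assms]] by (simp add: case_prod_beta')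
qed

text \<open>When the second copy is frozen, the section of \<open>G\<close> is a weight for the
  first copy, so facts about a single copy apply under the outer integral.\<close>

lemma weighted_fst:
  fixes f :: "'a \<Rightarrow> real" and G :: "'a \<times> 'a \<Rightarrow> real"
  assumes f: "integrable M f" and G [measurable]: "G \<in> borel_measurable (M \<Otimes>\<^sub>M M)" and b: "\<And>z. \<bar>G z\<bar> \<le> C"
  shows "integrable (M \<Otimes>\<^sub>M M) (\<lambda>z. G z * f (fst z))"
    "(\<integral>z. G z * f (fst z) \<partial>(M \<Otimes>\<^sub>M M)) = (\<integral>w'. (\<integral>w. G (w, w') * f w \<partial>M) \<partial>M)"
proof -
  interpret pp: pair_sigma_finite M M by standard
  have [measurable]: "f \<in> borel_measurable M" using f by simp
  show i: "integrable (M \<Otimes>\<^sub>M M) (\<lambda>z. G z * f (fst z))"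
  proof (rule Bochner_Integration.integrable_bound[of _ "\<lambda>z. C * f (fst z)"])
    show "integrable (M \<Otimes>\<^sub>M M) (\<lambda>z. C * f (fst z))" using integrable_comp_fst[OF f] by simp
    have "\<bar>G z * f (fst z)\<bar> \<le> \<bar>C * f (fst z)\<bar>" for z
      unfolding abs_mult using b[of z] by (intro mult_right_mono) auto
    then show "AE z in M \<Otimes>\<^sub>M M. norm (G z * f (fst z)) \<le> norm (C * f (fst z))" by simp
  qed measurable
  have i': "integrable (M \<Otimes>\<^sub>M M) (\<lambda>(w, w'). G (w, w') * f w)"
    using i by (simp add: case_prod_beta')
  have "(\<integral>w'. (\<integral>w. G (w, w') * f w \<partial>M) \<partial>M) = integral\<^sup>L (M \<Otimes>\<^sub>M M) (\<lambda>(w, w'). G (w, w') * f w)"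
    using pp.Fubini_integral[OF i'] pp.integral_fst[OF i'] by simp
  then show "(\<integral>z. G z * f (fst z) \<partial>(M \<Otimes>\<^sub>M M)) = (\<integral>w'. (\<integral>w. G (w, w') * f w \<partial>M) \<partial>M)"
    by (simp add: case_prod_beta')
qed

lemma weighted_snd:
  fixes f :: "'a \<Rightarrow> real" and G :: "'a \<times> 'a \<Rightarrow> real"
  assumes f: "integrable M f" and G [measurable]: "G \<in> borel_measurable (M \<Otimes>\<^sub>M M)" and b: "\<And>z. \<bar>G z\<bar> \<le> C"
  shows "integrable (M \<Otimes>\<^sub>M M) (\<lambda>z. G z * f (snd z))"
    "(\<integral>z. G z * f (snd z) \<partial>(M \<Otimes>\<^sub>M M)) = (\<integral>w. (\<integral>w'. G (w, w') * f w' \<partial>M) \<partial>M)"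
proof -
  interpret pp: pair_sigma_finite M M by standard
  define H where "H z = G (snd z, fst z)" for z
  have H: "H \<in> borel_measurable (M \<Otimes>\<^sub>M M)" "\<And>z. \<bar>H z\<bar> \<le> C"
    unfolding H_def using b by measurable
  note w = weighted_fst[OF f H]
  show i: "integrable (M \<Otimes>\<^sub>M M) (\<lambda>z. G z * f (snd z))"
    using pp.integrable_product_swap[OF w(1)] by (simp add: H_def case_prod_beta')
  have i': "integrable (M \<Otimes>\<^sub>M M) (\<lambda>(w, w'). G (w, w') * f w')"
    using i by (simp add: case_prod_beta')
  have "(\<integral>w. (\<integral>w'. G (w, w') * f w' \<partial>M) \<partial>M) = integral\<^sup>L (M \<Otimes>\<^sub>M M) (\<lambda>(w, w'). G (w, w') * f w')"
    using pp.integral_fst[OF i'] by simp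
  then show "(\<integral>z. G z * f (snd z) \<partial>(M \<Otimes>\<^sub>M M)) = (\<integral>w. (\<integral>w'. G (w, w') * f w' \<partial>M) \<partial>M)"
    by (simp add: case_prod_beta')
qed

end

text \<open>The delicate part is the lower bound, since two noises might cancel. Where the first one
  points along \<open>\<theta>\<close>, the positive part of the difference is at least the
  difference itself, and the second noise has mean zero given the first; so the constant
  \<open>c\<close> survives. The factor 4 comes from |a - b|^2 \<le> 2 |a|^2 + 2 |b|^2.\<close>

lemma cond_noise_pair:
  fixes \<xi> :: "'w \<Rightarrow> 'a::euclidean_space"
  assumes P: "prob_space P" and sub: "subalgebra P F" and cn: "cond_noise P F \<xi> \<theta> B c"
  shows "cond_noise (P \<Otimes>\<^sub>M P) (F \<Otimes>\<^sub>M F) (\<lambda>z. \<xi> (fst z) - \<xi> (snd z)) \<theta> (4 * B) c"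
proof -
  interpret prob_space P by fact
  interpret pp: pair_prob_space P P by standard
  note sub2 = subalgebra_pair[OF sub sub]
  have sp: "space F = space P" using sub by (simp add: subalgebra_def)
  have \<xi> [measurable]: "\<xi> \<in> borel_measurable P" and i2: "integrable P (\<lambda>w. (norm (\<xi> w))\<^sup>2)"
    and z: "\<And>G C v. G \<in> borel_measurable F \<Longrightarrow> (\<And>w. \<bar>G w\<bar> \<le> C) \<Longrightarrow> (\<integral>w. G w * (\<xi> w \<bullet> v) \<partial>P) = 0"
    and s: "\<And>G C. G \<in> borel_measurable F \<Longrightarrow> (\<And>w. 0 \<le> G w) \<Longrightarrow> (\<And>w. G w \<le> C) \<Longrightarrow>
        (\<integral>w. G w * (norm (\<xi> w))\<^sup>2 \<partial>P) \<le> B * (\<integral>w. G w \<partial>P)"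
    and l: "\<And>G C. G \<in> borel_measurable F \<Longrightarrow> (\<And>w. 0 \<le> G w) \<Longrightarrow> (\<And>w. G w \<le> C) \<Longrightarrow>
        c * (\<integral>w. G w \<partial>P) \<le> (\<integral>w. G w * max 0 (\<xi> w \<bullet> \<theta>) \<partial>P)"
    using cn unfolding cond_noise_def by blast+
  have iv: "integrable P (\<lambda>w. \<xi> w \<bullet> v)" for v
  proof (rule Bochner_Integration.integrable_bound[of _ "\<lambda>w. (norm (\<xi> w))\<^sup>2 + (norm v)\<^sup>2"])
    show "integrable P (\<lambda>w. (norm (\<xi> w))\<^sup>2 + (norm v)\<^sup>2)" using i2 by simp
    have "\<bar>\<xi> w \<bullet> v\<bar> \<le> \<bar>(norm (\<xi> w))\<^sup>2 + (norm v)\<^sup>2\<bar>" for w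
    proof -
      have "\<bar>\<xi> w \<bullet> v\<bar> \<le> norm (\<xi> w) * norm v" by (rule Cauchy_Schwarz_ineq2)
      moreover have "0 \<le> norm (\<xi> w) * norm v" by simp
      ultimately show ?thesis using sum_squares_bound[of "norm (\<xi> w)" "norm v"] by simp
    qed
    then show "AE w in P. norm (\<xi> w \<bullet> v) \<le> norm ((norm (\<xi> w))\<^sup>2 + (norm v)\<^sup>2)" by simp
  qed measurable
  have im: "integrable P (\<lambda>w. max 0 (\<xi> w \<bullet> \<theta>))"
    by (rule Bochner_Integration.integrable_bound[OF iv[of \<theta>]]) auto
  have sec: "(\<lambda>w. G (w, w')) \<in> borel_measurable F" "(\<lambda>w. G (w', w)) \<in> borel_measurable F"
    if "G \<in> borel_measurable (F \<Otimes>\<^sub>M F)" "w' \<in> space P" for G :: "_ \<Rightarrow> real" and w'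
    using measurable_Pair1[OF that(1), of w'] measurable_Pair2[OF that(1), of w'] that(2) sp by auto
  have toP: "G \<in> borel_measurable (P \<Otimes>\<^sub>M P)" if "G \<in> borel_measurable (F \<Otimes>\<^sub>M F)" for G :: "_ \<Rightarrow> real"
    by (rule measurable_from_subalg[OF sub2 that])
  have z1: "(\<integral>z. G z * (\<xi> (fst z) \<bullet> v) \<partial>(P \<Otimes>\<^sub>M P)) = 0"
    if "G \<in> borel_measurable (F \<Otimes>\<^sub>M F)" "\<And>z. \<bar>G z\<bar> \<le> C" for G :: "_ \<Rightarrow> real" and C v
  proof -
    have "(\<integral>w. G (w, w') * (\<xi> w \<bullet> v) \<partial>P) = 0" if "w' \<in> space P" for w'
      by (rule z[of _ C]) (use sec that \<open>G \<in> _\<close> \<open>\<And>z. \<bar>G z\<bar> \<le> C\<close> in auto)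
    then show ?thesis unfolding weighted_fst(2)[OF iv toP[OF that(1)] that(2)]
      by (simp cong: Bochner_Integration.integral_cong)
  qed
  \<comment> \<open>Measurability with respect to the past is required of the sections in the second
    copy only, because the weight \<open>J\<close> below depends on the current noise of the first
    copy.\<close>
  have z2: "(\<integral>z. G z * (\<xi> (snd z) \<bullet> v) \<partial>(P \<Otimes>\<^sub>M P)) = 0"
    if "G \<in> borel_measurable (P \<Otimes>\<^sub>M P)" "\<And>w. w \<in> space P \<Longrightarrow> (\<lambda>w'. G (w, w')) \<in> borel_measurable F" "\<And>z. \<bar>G z\<bar> \<le> C" for G :: "_ \<Rightarrow> real" and C v
  proof -
    have "(\<integral>w'. G (w, w') * (\<xi> w' \<bullet> v) \<partial>P) = 0" if "w \<in> space P" for w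
      by (rule z[of _ C]) (use that \<open>\<And>w. w \<in> space P \<Longrightarrow> _\<close> \<open>\<And>z. \<bar>G z\<bar> \<le> C\<close> in auto)
    then show ?thesis unfolding weighted_snd(2)[OF iv that(1,3)]
      by (simp cong: Bochner_Integration.integral_cong)
  qed
  have I2: "integrable (P \<Otimes>\<^sub>M P) (\<lambda>z. 2 * (norm (\<xi> (fst z)))\<^sup>2 + 2 * (norm (\<xi> (snd z)))\<^sup>2)"
    using integrable_comp_fst[OF i2] integrable_comp_snd[OF i2] by simp
  have par: "(norm (a - b))\<^sup>2 \<le> 2 * (norm a)\<^sup>2 + 2 * (norm b)\<^sup>2" for a b :: 'a
  proof -
    have "(norm (a - b))\<^sup>2 + (norm (a + b))\<^sup>2 = 2 * (norm a)\<^sup>2 + 2 * (norm b)\<^sup>2"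
      by (simp add: power2_norm_eq_inner inner_diff inner_add inner_commute)
    then show ?thesis using zero_le_power2[of "norm (a + b)"] by linarith
  qed
  have iG: "(\<integral>z. G z \<partial>(P \<Otimes>\<^sub>M P)) = (\<integral>w'. (\<integral>w. G (w, w') \<partial>P) \<partial>P)"
     "(\<integral>z. G z \<partial>(P \<Otimes>\<^sub>M P)) = (\<integral>w. (\<integral>w'. G (w, w') \<partial>P) \<partial>P)"
     if "G \<in> borel_measurable (F \<Otimes>\<^sub>M F)" "\<And>z. \<bar>G z\<bar> \<le> C" for G :: "_ \<Rightarrow> real" and C
    using weighted_fst(2)[OF _ toP[OF that(1)] that(2), of "\<lambda>_. 1"]
      weighted_snd(2)[OF _ toP[OF that(1)] that(2), of "\<lambda>_. 1"] by auto
  have int1: "integrable P (\<lambda>w'. (\<integral>w. G (w, w') * f w \<partial>P))"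
    if "G \<in> borel_measurable (P \<Otimes>\<^sub>M P)" "\<And>z. \<bar>G z\<bar> \<le> C" "integrable P f" for G :: "_ \<Rightarrow> real" and C and f :: "_ \<Rightarrow> real"
    using pp.integrable_snd[of "\<lambda>w w'. G (w, w') * f w"] weighted_fst(1)[OF that(3,1,2)]
    by (simp add: case_prod_beta')
  have int2: "integrable P (\<lambda>w. (\<integral>w'. G (w, w') * f w' \<partial>P))"
    if "G \<in> borel_measurable (P \<Otimes>\<^sub>M P)" "\<And>z. \<bar>G z\<bar> \<le> C" "integrable P f" for G :: "_ \<Rightarrow> real" and C and f :: "_ \<Rightarrow> real"
    using pp.integrable_fst[of "\<lambda>w w'. G (w, w') * f w'"] weighted_snd(1)[OF that(3,1,2)]
    by (simp add: case_prod_beta')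
  show ?thesis unfolding cond_noise_def
  proof (intro conjI allI impI)
    show "(\<lambda>z. \<xi> (fst z) - \<xi> (snd z)) \<in> borel_measurable (P \<Otimes>\<^sub>M P)" by measurable
    show iN: "integrable (P \<Otimes>\<^sub>M P) (\<lambda>z. (norm (\<xi> (fst z) - \<xi> (snd z)))\<^sup>2)"
      by (rule Bochner_Integration.integrable_bound[OF I2]) (use par in auto)
    fix G :: "_ \<Rightarrow> real" and C assume G: "G \<in> borel_measurable (F \<Otimes>\<^sub>M F)"
    { fix v assume b: "\<forall>w. \<bar>G w\<bar> \<le> C"
      then have bG: "\<And>w. \<bar>G w\<bar> \<le> C" by blast
      have "(\<integral>w. G w * ((\<xi> (fst w) - \<xi> (snd w)) \<bullet> v) \<partial>(P \<Otimes>\<^sub>M P))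
        = (\<integral>w. G w * (\<xi> (fst w) \<bullet> v) - G w * (\<xi> (snd w) \<bullet> v) \<partial>(P \<Otimes>\<^sub>M P))"
        by (simp add: inner_diff_left right_diff_distrib)
      also have "\<dots> = 0"
        using z1[OF G bG] z2[OF toP[OF G] sec(2)[OF G] bG] weighted_fst(1)[OF iv toP[OF G] bG] weighted_snd(1)[OF iv toP[OF G] bG]
        by (subst Bochner_Integration.integral_diff) auto
      finally show "(\<integral>w. G w * ((\<xi> (fst w) - \<xi> (snd w)) \<bullet> v) \<partial>(P \<Otimes>\<^sub>M P)) = 0" . }
    assume b: "\<forall>w. 0 \<le> G w \<and> G w \<le> C"
    then have b': "\<And>z. \<bar>G z\<bar> \<le> C" "\<And>z. 0 \<le> G z" "\<And>z. G z \<le> C" by auto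
    have s1: "(\<integral>z. G z * (norm (\<xi> (fst z)))\<^sup>2 \<partial>(P \<Otimes>\<^sub>M P)) \<le> B * (\<integral>z. G z \<partial>(P \<Otimes>\<^sub>M P))"
    proof -
      have "(\<integral>z. G z * (norm (\<xi> (fst z)))\<^sup>2 \<partial>(P \<Otimes>\<^sub>M P)) \<le> (\<integral>w'. B * (\<integral>w. G (w, w') \<partial>P) \<partial>P)"
        unfolding weighted_fst(2)[OF i2 toP[OF G] b'(1)]
        using int1[OF toP[OF G] b'(1) i2] int1[OF toP[OF G] b'(1), of "\<lambda>_. 1"] b' sec[OF G]
        by (intro integral_mono s[of _ C]) auto
      also have "\<dots> = B * (\<integral>z. G z \<partial>(P \<Otimes>\<^sub>M P))" using iG(1)[OF G b'(1)] by simp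
      finally show ?thesis .
    qed
    have s2: "(\<integral>z. G z * (norm (\<xi> (snd z)))\<^sup>2 \<partial>(P \<Otimes>\<^sub>M P)) \<le> B * (\<integral>z. G z \<partial>(P \<Otimes>\<^sub>M P))"
    proof -
      have "(\<integral>z. G z * (norm (\<xi> (snd z)))\<^sup>2 \<partial>(P \<Otimes>\<^sub>M P)) \<le> (\<integral>w. B * (\<integral>w'. G (w, w') \<partial>P) \<partial>P)"
        unfolding weighted_snd(2)[OF i2 toP[OF G] b'(1)]
        using int2[OF toP[OF G] b'(1) i2] int2[OF toP[OF G] b'(1), of "\<lambda>_. 1"] b' sec[OF G]
        by (intro integral_mono s[of _ C]) auto
      also have "\<dots> = B * (\<integral>z. G z \<partial>(P \<Otimes>\<^sub>M P))" using iG(2)[OF G b'(1)] by simp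
      finally show ?thesis .
    qed
    note w1 = weighted_fst(1)[OF i2 toP[OF G] b'(1)] and w2 = weighted_snd(1)[OF i2 toP[OF G] b'(1)]
    have iGN: "integrable (P \<Otimes>\<^sub>M P) (\<lambda>z. 2 * (G z * (norm (\<xi> (fst z)))\<^sup>2) + 2 * (G z * (norm (\<xi> (snd z)))\<^sup>2))"
      using w1 w2 by simp
    have gp: "G z * (norm (\<xi> (fst z) - \<xi> (snd z)))\<^sup>2 \<le> 2 * (G z * (norm (\<xi> (fst z)))\<^sup>2) + 2 * (G z * (norm (\<xi> (snd z)))\<^sup>2)" for z
      using mult_left_mono[OF par[of "\<xi> (fst z)" "\<xi> (snd z)"] b'(2)[of z]] by (simp add: algebra_simps)
    have GP [measurable]: "G \<in> borel_measurable (P \<Otimes>\<^sub>M P)" by (rule toP[OF G])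
    have "(\<integral>z. G z * (norm (\<xi> (fst z) - \<xi> (snd z)))\<^sup>2 \<partial>(P \<Otimes>\<^sub>M P))
       \<le> (\<integral>z. 2 * (G z * (norm (\<xi> (fst z)))\<^sup>2) + 2 * (G z * (norm (\<xi> (snd z)))\<^sup>2) \<partial>(P \<Otimes>\<^sub>M P))"
    proof (intro integral_mono iGN gp)
      show "integrable (P \<Otimes>\<^sub>M P) (\<lambda>z. G z * (norm (\<xi> (fst z) - \<xi> (snd z)))\<^sup>2)"
        by (rule Bochner_Integration.integrable_bound[OF iGN]) (use gp b' in \<open>auto intro!: order_trans[OF gp]\<close>)
    qed
    also have "\<dots> \<le> 4 * B * (\<integral>z. G z \<partial>(P \<Otimes>\<^sub>M P))" using w1 w2 s1 s2 by simp
    finally show "(\<integral>w. G w * (norm (\<xi> (fst w) - \<xi> (snd w)))\<^sup>2 \<partial>(P \<Otimes>\<^sub>M P)) \<le> 4 * B * integral\<^sup>L (P \<Otimes>\<^sub>M P) G" .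
    define J where "J z = (if 0 < \<xi> (fst z) \<bullet> \<theta> then G z else 0)" for z
    have J: "J \<in> borel_measurable (P \<Otimes>\<^sub>M P)" unfolding J_def by measurable
    have Jb: "\<bar>J z\<bar> \<le> C" for z using b'(2,3)[of z] by (auto simp: J_def)
    have Js: "(\<lambda>w'. J (w, w')) \<in> borel_measurable F" if "w \<in> space P" for w
      using sec(2)[OF G that] by (simp add: J_def)
    have e1: "J z * (\<xi> (fst z) \<bullet> \<theta>) = G z * max 0 (\<xi> (fst z) \<bullet> \<theta>)" for z
      by (auto simp: J_def max_def)
    have l1: "c * (\<integral>z. G z \<partial>(P \<Otimes>\<^sub>M P)) \<le> (\<integral>z. G z * max 0 (\<xi> (fst z) \<bullet> \<theta>) \<partial>(P \<Otimes>\<^sub>M P))"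
    proof -
      have "c * (\<integral>z. G z \<partial>(P \<Otimes>\<^sub>M P)) = (\<integral>w'. c * (\<integral>w. G (w, w') \<partial>P) \<partial>P)" using iG(1)[OF G b'(1)] by simp
      also have "\<dots> \<le> (\<integral>w'. (\<integral>w. G (w, w') * max 0 (\<xi> w \<bullet> \<theta>) \<partial>P) \<partial>P)"
        using int1[OF toP[OF G] b'(1) im] int1[OF toP[OF G] b'(1), of "\<lambda>_. 1"] b' sec[OF G]
        by (intro integral_mono l[of _ C]) auto
      finally show ?thesis unfolding weighted_fst(2)[OF im toP[OF G] b'(1)] .
    qed
    have "(\<integral>z. G z * max 0 (\<xi> (fst z) \<bullet> \<theta>) \<partial>(P \<Otimes>\<^sub>M P))
      = (\<integral>z. J z * (\<xi> (fst z) \<bullet> \<theta>) - J z * (\<xi> (snd z) \<bullet> \<theta>) \<partial>(P \<Otimes>\<^sub>M P))"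
      using z2[OF J Js Jb, of \<theta>] weighted_fst(1)[OF iv J Jb, of \<theta>] weighted_snd(1)[OF iv J Jb, of \<theta>]
      by (simp add: e1)
    also have "\<dots> \<le> (\<integral>z. G z * max 0 ((\<xi> (fst z) - \<xi> (snd z)) \<bullet> \<theta>) \<partial>(P \<Otimes>\<^sub>M P))"
    proof (rule integral_mono)
      show "integrable (P \<Otimes>\<^sub>M P) (\<lambda>z. J z * (\<xi> (fst z) \<bullet> \<theta>) - J z * (\<xi> (snd z) \<bullet> \<theta>))"
        using weighted_fst(1)[OF iv J Jb] weighted_snd(1)[OF iv J Jb] by simp
      show "integrable (P \<Otimes>\<^sub>M P) (\<lambda>z. G z * max 0 ((\<xi> (fst z) - \<xi> (snd z)) \<bullet> \<theta>))"
      proof (rule Bochner_Integration.integrable_bound[of _ "\<lambda>z. G z * (\<xi> (fst z) \<bullet> \<theta>) - G z * (\<xi> (snd z) \<bullet> \<theta>)"])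
        show "integrable (P \<Otimes>\<^sub>M P) (\<lambda>z. G z * (\<xi> (fst z) \<bullet> \<theta>) - G z * (\<xi> (snd z) \<bullet> \<theta>))"
          using weighted_fst(1)[OF iv GP b'(1)] weighted_snd(1)[OF iv GP b'(1)] by simp
        show "AE z in P \<Otimes>\<^sub>M P. norm (G z * max 0 ((\<xi> (fst z) - \<xi> (snd z)) \<bullet> \<theta>))
            \<le> norm (G z * (\<xi> (fst z) \<bullet> \<theta>) - G z * (\<xi> (snd z) \<bullet> \<theta>))"
          unfolding right_diff_distrib[symmetric] inner_diff_left[symmetric] norm_mult
          by (intro AE_I2 mult_left_mono) auto
      qed measurable
      show "J z * (\<xi> (fst z) \<bullet> \<theta>) - J z * (\<xi> (snd z) \<bullet> \<theta>) \<le> G z * max 0 ((\<xi> (fst z) - \<xi> (snd z)) \<bullet> \<theta>)" for z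
        unfolding right_diff_distrib[symmetric] inner_diff_left[symmetric]
        using b'(2)[of z] by (auto simp: J_def intro!: mult_left_mono)
    qed
    finally show "c * integral\<^sup>L (P \<Otimes>\<^sub>M P) G \<le> (\<integral>w. G w * max 0 ((\<xi> (fst w) - \<xi> (snd w)) \<bullet> \<theta>) \<partial>(P \<Otimes>\<^sub>M P))"
      using l1 by simp
  qed
qed

section \<open>Localization at a late time\<close>

context prob_space begin

text \<open>The sets that can be approximated form a \<sigma>-algebra: complements leave the
  symmetric difference unchanged, and for a countable union finitely many members suffice up to
  \<open>e / 2\<close>, each of them approximated within a geometric share of the rest.\<close>

lemma approx_by_filtration:
  fixes F :: "nat \<Rightarrow> 'a measure"
  assumes sub: "\<And>n. subalgebra M (F n)" and mono: "\<And>m n. m \<le> n \<Longrightarrow> sets (F m) \<subseteq> sets (F n)"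
    and E: "E \<in> sigma_sets (space M) (\<Union>n. sets (F n))" and e: "0 < e"
  shows "\<exists>n. \<exists>A\<in>sets (F n). measure M ((E - A) \<union> (A - E)) < e"
  using E e
proof (induction arbitrary: e rule: sigma_sets.induct)
  case (Basic a)
  then obtain n where "a \<in> sets (F n)" by blast
  then show ?case using Basic(2) by (intro exI[of _ n] bexI[of _ a]) auto
next
  case Empty
  then show ?case by (intro exI[of _ 0] bexI[of _ "{}"]) auto
next
  case (Compl a)
  then obtain n A where A: "A \<in> sets (F n)" "measure M ((a - A) \<union> (A - a)) < e" by blast
  have sp: "space (F n) = space M" using sub[of n] by (simp add: subalgebra_def)
  have aM: "a \<subseteq> space M"
    using sigma_sets_into_sp[OF _ Compl.hyps] sets.sets_into_space sub by (force simp: subalgebra_def)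
  have AM: "A \<subseteq> space M" using sets.sets_into_space[OF A(1)] sp by simp
  have "((space M - a) - (space M - A)) \<union> ((space M - A) - (space M - a)) = (a - A) \<union> (A - a)"
    using aM AM by blast
  moreover have "space M - A \<in> sets (F n)" using sets.compl_sets[OF A(1)] sp by simp
  ultimately show ?case using A(2) by (intro exI[of _ n] bexI[of _ "space M - A"]) auto
next
  case (Union a)
  have sM: "X \<in> sets M" if "X \<in> sigma_sets (space M) (\<Union>n. sets (F n))" for X
  proof -
    have "(\<Union>n. sets (F n)) \<subseteq> sets M" using sub by (auto simp: subalgebra_def)
    from sets.sigma_sets_subset[OF this] that show ?thesis by blast
  qed
  have FM: "X \<in> sets M" if "X \<in> sets (F n)" for X n using that sub[of n] by (auto simp: subalgebra_def)
  have aM: "a i \<in> sets M" for i using sM Union by blast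
  have "\<exists>n. \<exists>A\<in>sets (F n). measure M ((a i - A) \<union> (A - a i)) < e / 2 * (1/2) ^ Suc i" for i
    using Union.IH[of "e / 2 * (1/2) ^ Suc i" i] Union.prems by simp
  then obtain N A where A: "\<And>i. A i \<in> sets (F (N i))"
    "\<And>i. measure M ((a i - A i) \<union> (A i - a i)) < e / 2 * (1/2) ^ Suc i" by metis
  have "(\<lambda>n. measure M (\<Union>i\<in>{..<n}. a i)) \<longlonglongrightarrow> measure M (\<Union>n. \<Union>i\<in>{..<n}. a i)"
  proof (intro finite_Lim_measure_incseq)
    show "incseq (\<lambda>n. \<Union>i\<in>{..<n}. a i)" unfolding incseq_def
      by (intro allI impI UN_mono) auto
  qed (use aM in auto)
  moreover have "(\<Union>n. \<Union>i\<in>{..<n}. a i) = (\<Union>i. a i)" by (auto intro: lessThan_iff[THEN iffD2, OF lessI])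
  ultimately have "(\<lambda>n. measure M (\<Union>i\<in>{..<n}. a i)) \<longlonglongrightarrow> measure M (\<Union>i. a i)" by simp
  then have "\<forall>\<^sub>F n in sequentially. measure M (\<Union>i. a i) - e / 2 < measure M (\<Union>i\<in>{..<n}. a i)"
    using Union.prems by (intro order_tendstoD(1)) auto
  then obtain n where n: "measure M (\<Union>i. a i) - e / 2 < measure M (\<Union>i\<in>{..<n}. a i)"
    by (auto simp: eventually_sequentially)
  define A' where "A' = (\<Union>i\<in>{..<n}. A i)"
  define m where "m = Max (insert 0 (N ` {..<n}))"
  have "A' \<in> sets (F m)" unfolding A'_def
  proof (intro sets.finite_UN)
    fix i assume "i \<in> {..<n}"
    then have "N i \<le> m" unfolding m_def by (intro Max_ge) auto
    then show "A i \<in> sets (F m)" using mono A(1)[of i] by blast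
  qed simp
  moreover have "measure M (((\<Union>i. a i) - A') \<union> (A' - (\<Union>i. a i))) < e"
  proof -
    define L where "L = (\<Union>i. a i) - (\<Union>i\<in>{..<n}. a i)"
    define S where "S i = (a i - A i) \<union> (A i - a i)" for i
    have SM: "S i \<in> sets M" for i using aM[of i] FM[OF A(1)[of i]] by (auto simp: S_def)
    have "((\<Union>i. a i) - A') \<union> (A' - (\<Union>i. a i)) \<subseteq> L \<union> (\<Union>i\<in>{..<n}. S i)"
      by (auto simp: L_def A'_def S_def)
    then have "measure M (((\<Union>i. a i) - A') \<union> (A' - (\<Union>i. a i))) \<le> measure M (L \<union> (\<Union>i\<in>{..<n}. S i))"
      using aM SM by (intro finite_measure_mono) (auto simp: L_def)
    also have "\<dots> \<le> measure M L + measure M (\<Union>i\<in>{..<n}. S i)"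
      using aM SM by (intro measure_Un_le) (auto simp: L_def)
    also have "measure M L = measure M (\<Union>i. a i) - measure M (\<Union>i\<in>{..<n}. a i)"
      unfolding L_def using aM by (intro finite_measure_Diff) auto
    also have "measure M (\<Union>i\<in>{..<n}. S i) \<le> (\<Sum>i\<in>{..<n}. measure M (S i))"
      using SM by (intro measure_UNION_le) auto
    also have "\<dots> \<le> (\<Sum>i\<in>{..<n}. e / 2 * (1/2) ^ Suc i)"
      using A(2) by (intro sum_mono) (auto simp: S_def less_imp_le)
    also have "\<dots> = e / 2 * (1 - (1/2) ^ n)"
      by (induction n) (auto simp: field_simps)
    also have "\<dots> \<le> e / 2" using Union.prems by simp
    finally show ?thesis using n by simp
  qed
  ultimately show ?case by blast
qed

text \<open>The time may be raised after \<open>A\<close> has been found, since both the filtration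
  and \<open>En\<close> increase. The symmetric difference of \<open>E\<close> and \<open>A\<close>
  and the set \<open>E - En n\<close> each contribute less than \<open>e\<close>, and
  \<open>e \<le> p / 2\<close> keeps the measure of \<open>A\<close> above
  \<open>p / 2\<close>.\<close>

lemma approx_large:
  fixes F :: "nat \<Rightarrow> 'a measure"
  assumes sub: "\<And>n. subalgebra M (F n)" and mono: "\<And>m n. m \<le> n \<Longrightarrow> sets (F m) \<subseteq> sets (F n)"
    and E: "E \<in> sigma_sets (space M) (\<Union>n. sets (F n))"
    and En: "\<And>n. En n \<in> sets M" "incseq En" "(\<Union>n. En n) = E" and pos: "0 < measure M E"
    and d: "0 < d"
  shows "\<exists>n\<ge>n0. \<exists>A\<in>sets (F n). 0 < measure M A \<and> measure M (A - En n) \<le> d * measure M A"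
proof -
  define p where "p = measure M E"
  define e where "e = min (p / 2) (d * p / 4)"
  have e: "0 < e" using pos d by (simp add: e_def p_def)
  have EM: "E \<in> sets M" using En by auto
  have "(\<lambda>n. measure M (En n)) \<longlonglongrightarrow> measure M E"
    using finite_Lim_measure_incseq[of En] En by auto
  then have "\<forall>\<^sub>F n in sequentially. measure M E - e < measure M (En n)"
    using e by (intro order_tendstoD(1)) auto
  then obtain n1 where n1: "\<And>n. n \<ge> n1 \<Longrightarrow> measure M E - e < measure M (En n)"
    by (auto simp: eventually_sequentially)
  obtain n2 A where A: "A \<in> sets (F n2)" "measure M ((E - A) \<union> (A - E)) < e"
    using approx_by_filtration[OF sub mono E e] by blast
  define n where "n = max n0 (max n1 n2)"
  have An: "A \<in> sets (F n)" using mono[of n2 n] A(1) unfolding n_def by (meson max.cobounded2 order_trans subsetD)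
  then have AM: "A \<in> sets M" using sub[of n] by (auto simp: subalgebra_def)
  have "p = measure M E" by (simp add: p_def)
  also have "\<dots> \<le> measure M (A \<union> ((E - A) \<union> (A - E)))" using AM EM by (intro finite_measure_mono) auto
  also have "\<dots> \<le> measure M A + measure M ((E - A) \<union> (A - E))" using AM EM by (intro measure_Un_le) auto
  finally have pA: "p - e < measure M A" using A(2) by simp
  have "measure M (A - En n) \<le> measure M (((E - A) \<union> (A - E)) \<union> (E - En n))"
    using AM EM En(1) by (intro finite_measure_mono) auto
  also have "\<dots> \<le> measure M ((E - A) \<union> (A - E)) + measure M (E - En n)"
    using AM EM En(1) by (intro measure_Un_le) auto
  also have "measure M (E - En n) = measure M E - measure M (En n)"
    using EM En by (intro finite_measure_Diff) auto
  also have "\<dots> < e"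
  proof -
    have "n1 \<le> n" by (simp add: n_def)
    then show ?thesis using n1[of n] by simp
  qed
  finally have "measure M (A - En n) \<le> 2 * e" using A(2) by simp
  also have "\<dots> \<le> d * (p / 2)" by (simp add: e_def)
  also have "\<dots> \<le> d * measure M A" using pA d by (intro mult_left_mono) (auto simp: e_def)
  finally have "measure M (A - En n) \<le> d * measure M A" .
  moreover have "0 < measure M A" using pA pos by (simp add: e_def p_def)
  ultimately show ?thesis using An by (intro exI[of _ n]) (auto simp: n_def)
qed

text \<open>\<open>A\<close> is cut into countably many cells on which \<open>x\<close> stays within
  a ball of radius \<open>r / 2\<close>. If the exceptional proportion were above \<open>d\<close>
  in every cell of positive measure, summation would give the same for \<open>A\<close>.\<close>

lemma localize_cell:
  fixes x :: "'a \<Rightarrow> 'b::euclidean_space"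
  assumes x: "x \<in> borel_measurable N" and sub: "subalgebra M N" and A: "A \<in> sets N" and E: "E \<in> sets M"
    and pos: "0 < measure M A" and d: "measure M (A - E) \<le> d * measure M A" and r: "0 < r"
  shows "\<exists>A'\<in>sets N. A' \<subseteq> A \<and> 0 < measure M A' \<and> measure M (A' - E) \<le> d * measure M A'
    \<and> (\<forall>w\<in>A'. \<forall>w'\<in>A'. norm (x w - x w') \<le> r)"
proof (rule ccontr)
  assume neg: "\<not> ?thesis"
  have AM: "A \<in> sets M" and NM: "sets N \<subseteq> sets M" and sp: "space N = space M"
    using A sub by (auto simp: subalgebra_def)
  obtain D :: "nat \<Rightarrow> 'b" where D: "\<And>y e. 0 < e \<Longrightarrow> \<exists>k. dist (D k) y < e"
  proof -
    obtain D :: "'b set" where D: "countable D" "\<And>X. open X \<Longrightarrow> X \<noteq> {} \<Longrightarrow> \<exists>d\<in>D. d \<in> X"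
      using countable_dense_exists by blast
    have "D \<noteq> {}" using D(2)[of UNIV] by auto
    then have "range (from_nat_into D) = D" using D(1) by (rule range_from_nat_into)
    moreover have "\<exists>d\<in>D. dist d y < e" if "0 < e" for y e
      using D(2)[of "ball y e"] that by (auto simp: dist_commute)
    ultimately show ?thesis using that[of "from_nat_into D"] by (metis rangeE)
  qed
  define c where "c k = A \<inter> (x -` ball (D k) (r/2) \<inter> space N)" for k
  define C where "C = disjointed c"
  have cN: "c k \<in> sets N" for k unfolding c_def using A x by (intro sets.Int measurable_sets) auto
  have CN: "C k \<in> sets N" for k using cN by (auto simp: C_def disjointed_def)
  have CM: "C k \<in> sets M" for k using CN NM by blast
  have un: "(\<Union>k. C k) = A"
  proof -
    have "(\<Union>k. c k) = A"
    proof -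
      have "w \<in> (\<Union>k. c k)" if w: "w \<in> A" for w
      proof -
        obtain k where "dist (D k) (x w) < r/2" using D[of "r/2" "x w"] r by auto
        then show ?thesis using w sets.sets_into_space[OF A] by (auto simp: c_def)
      qed
      then show ?thesis by (auto simp: c_def)
    qed
    then show ?thesis by (simp add: C_def UN_disjointed_eq)
  qed
  have dj: "disjoint_family C" by (simp add: C_def disjoint_family_disjointed)
  have cell: "norm (x w - x w') \<le> r" if "w \<in> C k" "w' \<in> C k" for w w' k
  proof -
    have "C k \<subseteq> c k" by (simp add: C_def disjointed_subset)
    then have "dist (D k) (x w) < r/2" "dist (D k) (x w') < r/2" using that by (auto simp: c_def)
    then show ?thesis using dist_triangle3[of "x w" "x w'" "D k"] by (simp add: dist_norm)
  qed
  have key: "d * measure M (C k) < measure M (C k - E) \<or> measure M (C k) = 0" for k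
    using neg CN[of k] un cell[of _ k] by (metis UN_upper UNIV_I measure_nonneg not_less order_le_imp_less_or_eq)
  have s1: "(\<lambda>k. measure M (C k)) sums measure M A"
    using finite_measure_UNION[of C] CM dj un by auto
  have "(\<lambda>k. measure M (C k - E)) sums measure M (\<Union>k. C k - E)"
    using CM E dj by (intro finite_measure_UNION) (auto simp: disjoint_family_on_def)
  moreover have "(\<Union>k. C k - E) = A - E" using un by auto
  ultimately have s2: "(\<lambda>k. measure M (C k - E)) sums measure M (A - E)" by simp
  have le: "d * measure M (C k) \<le> measure M (C k - E)" for k using key[of k] by auto
  obtain k where "measure M (C k) \<noteq> 0"
  proof (rule ccontr)
    assume "\<not> thesis"
    then have "\<And>k. measure M (C k) = 0" using that by blast
    then show False using s1 pos sums_unique2[OF s1, of 0] by simp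
  qed
  then have lt: "d * measure M (C k) < measure M (C k - E)" using key by blast
  have "(\<lambda>k. measure M (C k - E) - d * measure M (C k)) sums (measure M (A - E) - d * measure M A)"
    using s1 s2 by (intro sums_diff sums_mult)
  then have "0 < measure M (A - E) - d * measure M A"
    using suminf_pos2[of "\<lambda>k. measure M (C k - E) - d * measure M (C k)" k] le lt by (simp add: sums_iff)
  then show False using d by simp
qed

end

section \<open>Spectral splitting of a self-adjoint map\<close>

text \<open>At a maximizer \<open>e\<close> of the quadratic form on the unit sphere of
  \<open>S\<close> the first variation vanishes in all directions of \<open>S\<close>, and
  invariance puts the residual \<open>T e - m *\<^sub>R e\<close> into \<open>S\<close>, so it is
  orthogonal to itself.\<close>

lemma rayleigh_eigenvector:
  fixes T :: "'a::euclidean_space \<Rightarrow> 'a"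
  assumes lin: "linear T" and adj: "\<And>x y. T x \<bullet> y = x \<bullet> T y"
    and S: "subspace S" "\<And>x. x \<in> S \<Longrightarrow> T x \<in> S" "S \<noteq> {0}"
  shows "\<exists>e\<in>S. norm e = 1 \<and> (\<exists>m. T e = m *\<^sub>R e)"
proof -
  define K where "K = S \<inter> sphere 0 1"
  have "compact K" unfolding K_def
    using closed_subspace[OF S(1)] by (intro closed_Int_compact) auto
  moreover have "K \<noteq> {}"
  proof -
    obtain y where "y \<in> S" "y \<noteq> 0" using S subspace_0[OF S(1)] by auto
    then have "y /\<^sub>R norm y \<in> K" using S(1) by (simp add: K_def subspace_scale)
    then show ?thesis by auto
  qed
  moreover have "continuous_on K (\<lambda>x. x \<bullet> T x)"
    using lin by (intro continuous_intros linear_continuous_on) (simp add: linear_conv_bounded_linear)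
  ultimately obtain e where e: "e \<in> K" "\<And>y. y \<in> K \<Longrightarrow> y \<bullet> T y \<le> e \<bullet> T e"
    using continuous_attains_sup by metis
  define m where "m = e \<bullet> T e"
  have eS: "e \<in> S" "norm e = 1" using e(1) by (auto simp: K_def)
  have le: "y \<bullet> T y \<le> m * (norm y)\<^sup>2" if "y \<in> S" for y
  proof (cases "y = 0")
    case False
    have "y /\<^sub>R norm y \<in> K" using S(1) that False by (simp add: K_def subspace_scale)
    from e(2)[OF this] have "(y \<bullet> T y) / (norm y)\<^sup>2 \<le> m"
      using lin by (simp add: m_def linear_scale power2_eq_square divide_inverse mult_ac)
    then show ?thesis using False by (simp add: pos_divide_le_eq)
  qed (simp add: linear_0[OF lin])
  have orth: "(T e - m *\<^sub>R e) \<bullet> y = 0" if y: "y \<in> S" for y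
  proof (rule ccontr)
    define c where "c = (T e - m *\<^sub>R e) \<bullet> y"
    define k where "k = m * (norm y)\<^sup>2 - y \<bullet> T y"
    assume "(T e - m *\<^sub>R e) \<bullet> y \<noteq> 0"
    then have c: "c \<noteq> 0" by (simp add: c_def)
    \<comment> \<open>With \<open>t = c\<close> this forces \<open>k > 0\<close>, and then
      \<open>t = c / k\<close> contradicts \<open>c \<noteq> 0\<close>.\<close>
    have q: "2 * t * c \<le> t\<^sup>2 * k" for t
    proof -
      have "e + t *\<^sub>R y \<in> S" using eS y S(1) by (simp add: subspace_add subspace_scale)
      from le[OF this] have *: "(e + t *\<^sub>R y) \<bullet> T (e + t *\<^sub>R y) \<le> m * (norm (e + t *\<^sub>R y))\<^sup>2" .
      have 1: "(norm (e + t *\<^sub>R y))\<^sup>2 = 1 + 2 * t * (e \<bullet> y) + t\<^sup>2 * (norm y)\<^sup>2"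
        unfolding power2_norm_eq_inner using eS
        by (simp add: inner_add inner_commute norm_eq_1 power2_eq_square algebra_simps)
      have "e \<bullet> T y = T e \<bullet> y" "y \<bullet> T e = T e \<bullet> y" by (rule adj[symmetric], rule inner_commute)
      then have 2: "(e + t *\<^sub>R y) \<bullet> T (e + t *\<^sub>R y) = m + 2 * t * (T e \<bullet> y) + t\<^sup>2 * (y \<bullet> T y)"
        by (simp add: linear_add[OF lin] linear_scale[OF lin] inner_add m_def power2_eq_square algebra_simps)
      have c': "c = T e \<bullet> y - m * (e \<bullet> y)" by (simp add: c_def inner_diff_left)
      show ?thesis using * unfolding 1 2 c' k_def by (simp add: algebra_simps)
    qed
    have "k > 0"
    proof (rule ccontr)
      assume "\<not> 0 < k"
      then have "c\<^sup>2 * k \<le> 0" by (simp add: mult_nonneg_nonpos)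
      moreover have "0 < c * c" using c by (cases "0 < c") (auto simp: mult_neg_neg)
      ultimately show False using q[of c] by simp
    qed
    have "2 * (c / k) * c \<le> (c / k)\<^sup>2 * k" by (rule q)
    then have "c\<^sup>2 \<le> 0" using \<open>k > 0\<close> by (simp add: power2_eq_square field_simps)
    then show False using c by simp
  qed
  have "T e - m *\<^sub>R e \<in> S" using S eS by (simp add: subspace_diff subspace_scale)
  from orth[OF this] have "T e = m *\<^sub>R e" by simp
  then show ?thesis using eS by blast
qed

lemma eigenbasis:
  fixes T :: "'a::euclidean_space \<Rightarrow> 'a"
  assumes lin: "linear T" and adj: "\<And>x y. T x \<bullet> y = x \<bullet> T y"
    and S: "subspace S" "\<And>x. x \<in> S \<Longrightarrow> T x \<in> S"
  shows "\<exists>E. finite E \<and> E \<subseteq> S \<and> span E = S \<and> pairwise orthogonal E \<and> (\<forall>e\<in>E. norm e = 1 \<and> (\<exists>m. T e = m *\<^sub>R e))"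
  using S
proof (induction "dim S" arbitrary: S rule: less_induct)
  case less
  show ?case
  proof (cases "S = {0}")
    case True
    then show ?thesis by (intro exI[of _ "{}"]) auto
  next
    case False
    obtain e m where e: "e \<in> S" "norm e = 1" "T e = m *\<^sub>R e"
      using rayleigh_eigenvector[OF lin adj less.prems False] by auto
    define S' where "S' = {x \<in> S. x \<bullet> e = 0}"
    have S': "subspace S'" using less.prems(1)
      by (auto simp: S'_def subspace_def inner_add_left)
    have inv: "T x \<in> S'" if "x \<in> S'" for x
      using that less.prems(2) by (auto simp: S'_def adj e)
    have "dim S' < dim S"
    proof -
      have "S' \<subseteq> S" "e \<in> S" "e \<notin> S'" using e by (auto simp: S'_def norm_eq_1)
      then have "S' \<subset> S" by blast
      then show ?thesis using S' less.prems(1) by (metis dim_psubset span_eq_iff)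
    qed
    from less.hyps[OF this S' inv] obtain E where E: "finite E" "E \<subseteq> S'" "span E = S'" "pairwise orthogonal E"
      "\<forall>e\<in>E. norm e = 1 \<and> (\<exists>m. T e = m *\<^sub>R e)" by metis
    have "span (insert e E) = S"
    proof (rule span_subspace)
      show "insert e E \<subseteq> S" using E e by (auto simp: S'_def)
      show "S \<subseteq> span (insert e E)"
      proof
        fix x assume x: "x \<in> S"
        have "x - (x \<bullet> e) *\<^sub>R e \<in> S'"
          using x e less.prems(1) by (simp add: S'_def subspace_diff subspace_scale inner_diff_left norm_eq_1)
        then have "x - (x \<bullet> e) *\<^sub>R e \<in> span E" using E by simp
        then show "x \<in> span (insert e E)" using span_breakdown_eq by blast
      qed
    qed (use less.prems in auto)
    moreover have "pairwise orthogonal (insert e E)"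
      using E by (auto simp: pairwise_insert orthogonal_def S'_def inner_commute)
    ultimately show ?thesis using E e
      by (intro exI[of _ "insert e E"]) (auto simp: S'_def)
  qed
qed

text \<open>For orthonormal \<open>E\<close> this is the orthogonal projection onto
  \<open>span E\<close>; in this explicit form linearity and self-adjointness hold for any
  \<open>E\<close>.\<close>

definition proj_on :: "'a::euclidean_space set \<Rightarrow> 'a \<Rightarrow> 'a" where
  "proj_on E x = (\<Sum>e\<in>E. (x \<bullet> e) *\<^sub>R e)"

lemma linear_proj_on: "linear (proj_on E)"
  by (auto simp: proj_on_def linear_iff inner_add_left scaleR_add_left sum.distrib scaleR_sum_right)

lemma proj_on_adjoint: "proj_on E x \<bullet> y = x \<bullet> proj_on E y"
  by (simp add: proj_on_def inner_sum_left inner_sum_right mult.commute inner_commute)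

lemma orthonormal_expansion:
  fixes x :: "'a::euclidean_space"
  assumes E: "finite E" "pairwise orthogonal E" "\<forall>e\<in>E. norm e = 1" and x: "x \<in> span E"
  shows "(\<Sum>e\<in>E. (x \<bullet> e) *\<^sub>R e) = x"
proof -
  have ne: "e \<bullet> f = (if e = f then 1 else 0)" if "e \<in> E" "f \<in> E" for e f
    using E that by (auto simp: pairwise_def orthogonal_def norm_eq_1)
  have "linear (proj_on E)" by (rule linear_proj_on)
  moreover have "proj_on E e = e" if "e \<in> E" for e
  proof -
    have "proj_on E e = (\<Sum>f\<in>E. (if e = f then 1 else 0) *\<^sub>R f)"
      unfolding proj_on_def by (intro sum.cong refl) (simp add: ne that)
    also have "\<dots> = (\<Sum>f\<in>E. if e = f then f else 0)" by (intro sum.cong) auto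
    also have "\<dots> = e" using E that by simp
    finally show ?thesis .
  qed
  ultimately have "proj_on E x = x"
    using linear_eq_on_span[of "proj_on E" id E x] x by (auto simp: linear_id)
  then show ?thesis by (simp add: proj_on_def)
qed

text \<open>\<open>Pm\<close> is the orthogonal projection onto the sum of the eigenspaces with
  negative eigenvalue, and \<open>lam\<close> is a spectral gap at 0, positive because
  \<open>T\<close> is injective. The last conclusion allows the range of \<open>Pm\<close> to be
  located without mentioning the eigenbasis.\<close>

lemma spectral_splitting:
  fixes T :: "'a::euclidean_space \<Rightarrow> 'a"
  assumes lin: "linear T" and adj: "\<And>x y. T x \<bullet> y = x \<bullet> T y" and inj: "\<And>x. T x = 0 \<Longrightarrow> x = 0"
  obtains Pm lam where "linear Pm" "\<And>x y. Pm x \<bullet> y = x \<bullet> Pm y" "\<And>x. Pm (Pm x) = Pm x"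
    "\<And>x. T (Pm x) = Pm (T x)" "0 < lam"
    "\<And>x. Pm x \<bullet> T (Pm x) \<le> - lam * (norm (Pm x))\<^sup>2"
    "\<And>x. lam * (norm (x - Pm x))\<^sup>2 \<le> (x - Pm x) \<bullet> T (x - Pm x)"
    "(\<exists>x. x \<bullet> T x < 0) \<Longrightarrow> \<exists>e m. norm e = 1 \<and> Pm e = e \<and> T e = m *\<^sub>R e \<and> m < 0"
    "\<And>N x. subspace N \<Longrightarrow> (\<And>e m. T e = m *\<^sub>R e \<Longrightarrow> m < 0 \<Longrightarrow> e \<in> N) \<Longrightarrow> Pm x \<in> N"
proof -
  obtain E where E: "finite E" "span E = UNIV" "pairwise orthogonal E"
      "\<forall>e\<in>E. norm e = 1 \<and> (\<exists>m. T e = m *\<^sub>R e)"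
    using eigenbasis[OF lin adj subspace_UNIV] by auto
  define mu where "mu e = e \<bullet> T e" for e
  have mu: "T e = mu e *\<^sub>R e" if "e \<in> E" for e
    using E(4) that by (auto simp: mu_def norm_eq_1)
  have ne: "e \<bullet> f = (if e = f then 1 else 0)" if "e \<in> E" "f \<in> E" for e f
    using E that by (auto simp: pairwise_def orthogonal_def norm_eq_1)
  have mu0: "mu e \<noteq> 0" if "e \<in> E" for e
  proof
    assume "mu e = 0"
    then have "T e = 0" using mu[OF that] by simp
    then show False using inj[of e] E(4) that by auto
  qed
  define En where "En = {e \<in> E. mu e < 0}"
  define Ep where "Ep = {e \<in> E. 0 < mu e}"
  have EE: "E = En \<union> Ep" "En \<inter> Ep = {}" "finite En" "finite Ep" "En \<subseteq> E" "Ep \<subseteq> E"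
    using E mu0 by (auto simp: En_def Ep_def less_le)
  define lam where "lam = Min (insert 1 ((\<lambda>e. \<bar>mu e\<bar>) ` E))"
  have lam: "0 < lam" "\<And>e. e \<in> E \<Longrightarrow> lam \<le> \<bar>mu e\<bar>"
    using E mu0 by (auto simp: lam_def)
  have exp: "(\<Sum>e\<in>E. (x \<bullet> e) *\<^sub>R e) = x" for x
    using orthonormal_expansion[of E x] E by auto
  have comp: "x - proj_on En x = proj_on Ep x" for x
  proof -
    have "proj_on En x + proj_on Ep x = x"
      using exp[of x] sum.union_disjoint[of En Ep "\<lambda>e. (x \<bullet> e) *\<^sub>R e"] EE by (simp add: proj_on_def)
    then show ?thesis by (simp add: algebra_simps)
  qed
  have pi: "proj_on A x \<bullet> e = (if e \<in> A then x \<bullet> e else 0)" if "A \<subseteq> E" "e \<in> E" for A x e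
  proof -
    have fA: "finite A" using that E finite_subset by blast
    have "proj_on A x \<bullet> e = (\<Sum>f\<in>A. (x \<bullet> f) * (if f = e then 1 else 0))"
      unfolding proj_on_def inner_sum_left using that by (intro sum.cong refl) (auto simp: ne)
    also have "\<dots> = (if e \<in> A then x \<bullet> e else 0)" using fA by (simp add: if_distrib cong: if_cong)
    finally show ?thesis .
  qed
  have ip: "x \<bullet> y = (\<Sum>e\<in>E. (x \<bullet> e) * (y \<bullet> e))" for x y
    by (subst exp[of y, symmetric]) (simp add: inner_sum_right mult.commute)
  have Te: "T x \<bullet> e = mu e * (x \<bullet> e)" if "e \<in> E" for x e
    using mu[OF that] by (simp add: adj)
  have qf: "proj_on A x \<bullet> T (proj_on A x) = (\<Sum>e\<in>A. mu e * (x \<bullet> e)\<^sup>2)"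
    "(norm (proj_on A x))\<^sup>2 = (\<Sum>e\<in>A. (x \<bullet> e)\<^sup>2)" if A: "A \<subseteq> E" for A x
  proof -
    have r: "(\<Sum>e\<in>E. if e \<in> A then g e else 0) = (\<Sum>e\<in>A. g e)" for g :: "'a \<Rightarrow> real"
      using sum.inter_restrict[of E g A] E A by (simp add: Int_absorb1)
    have "proj_on A x \<bullet> T (proj_on A x) = (\<Sum>e\<in>E. if e \<in> A then mu e * (x \<bullet> e)\<^sup>2 else 0)"
      by (subst ip) (intro sum.cong refl, auto simp: pi[OF A] Te power2_eq_square)
    then show "proj_on A x \<bullet> T (proj_on A x) = (\<Sum>e\<in>A. mu e * (x \<bullet> e)\<^sup>2)" by (simp add: r)
    have "(norm (proj_on A x))\<^sup>2 = (\<Sum>e\<in>E. if e \<in> A then (x \<bullet> e)\<^sup>2 else 0)"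
      unfolding power2_norm_eq_inner by (subst ip) (intro sum.cong refl, auto simp: pi[OF A] power2_eq_square)
    then show "(norm (proj_on A x))\<^sup>2 = (\<Sum>e\<in>A. (x \<bullet> e)\<^sup>2)" by (simp add: r)
  qed
  have ext: "x = y" if "\<And>e. e \<in> E \<Longrightarrow> x \<bullet> e = y \<bullet> e" for x y
  proof -
    have "(\<Sum>e\<in>E. (x \<bullet> e) *\<^sub>R e) = (\<Sum>e\<in>E. (y \<bullet> e) *\<^sub>R e)" using that by (intro sum.cong) auto
    then show ?thesis by (simp only: exp)
  qed
  show ?thesis
  proof (rule that[of "proj_on En" lam])
    show "linear (proj_on En)" by (rule linear_proj_on)
    show "proj_on En x \<bullet> y = x \<bullet> proj_on En y" for x y by (rule proj_on_adjoint)
    show "proj_on En (proj_on En x) = proj_on En x" for x by (rule ext) (simp add: pi EE)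
    show "T (proj_on En x) = proj_on En (T x)" for x by (rule ext) (simp add: pi EE Te)
    show "0 < lam" by fact
    show "proj_on En x \<bullet> T (proj_on En x) \<le> - lam * (norm (proj_on En x))\<^sup>2" for x
    proof -
      have "mu e * (x \<bullet> e)\<^sup>2 \<le> - lam * (x \<bullet> e)\<^sup>2" if "e \<in> En" for e
        using that lam(2)[of e] by (intro mult_right_mono) (auto simp: En_def)
      then show ?thesis unfolding qf[OF EE(5)] sum_distrib_left by (intro sum_mono) auto
    qed
    show "lam * (norm (x - proj_on En x))\<^sup>2 \<le> (x - proj_on En x) \<bullet> T (x - proj_on En x)" for x
    proof -
      have "lam * (x \<bullet> e)\<^sup>2 \<le> mu e * (x \<bullet> e)\<^sup>2" if "e \<in> Ep" for e
        using that lam(2)[of e] by (intro mult_right_mono) (auto simp: Ep_def)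
      then show ?thesis unfolding comp qf[OF EE(6)] sum_distrib_left by (intro sum_mono) auto
    qed
    show "\<exists>e m. norm e = 1 \<and> proj_on En e = e \<and> T e = m *\<^sub>R e \<and> m < 0" if neg: "\<exists>x. x \<bullet> T x < 0"
    proof -
      have "En \<noteq> {}"
      proof
        assume "En = {}"
        then have "proj_on Ep x = x" for x using comp[of x] by (simp add: proj_on_def)
        moreover have "0 \<le> (\<Sum>e\<in>Ep. mu e * (x \<bullet> e)\<^sup>2)" for x
          by (intro sum_nonneg) (auto simp: Ep_def)
        ultimately have "0 \<le> x \<bullet> T x" for x
          using qf(1)[OF EE(6), of x] by simp
        then show False using neg by (meson not_le)
      qed
      then obtain e where e: "e \<in> En" by blast
      then have "e \<in> E" using EE by blast
      have "proj_on En e = e" using e by (intro ext) (auto simp: pi EE ne \<open>e \<in> E\<close>)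
      moreover have "norm e = 1" "mu e < 0" using e E(4) by (auto simp: En_def)
      ultimately show ?thesis using mu[OF \<open>e \<in> E\<close>] by blast
    qed
    show "proj_on En x \<in> N" if "subspace N" "\<And>e m. T e = m *\<^sub>R e \<Longrightarrow> m < 0 \<Longrightarrow> e \<in> N" for N x
    proof -
      have "e \<in> N" if "e \<in> En" for e
        using \<open>\<And>e m. T e = m *\<^sub>R e \<Longrightarrow> m < 0 \<Longrightarrow> e \<in> N\<close>[OF mu[of e]] that by (simp add: En_def)
      then show ?thesis unfolding proj_on_def
        by (intro subspace_sum[OF that(1)] subspace_scale[OF that(1)])
    qed
  qed
qed

lemma psd_coercive:
  fixes T :: "'a::euclidean_space \<Rightarrow> 'a"
  assumes lin: "linear T" and S: "subspace S" and pos: "\<And>x. x \<in> S \<Longrightarrow> x \<noteq> 0 \<Longrightarrow> 0 < x \<bullet> T x"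
  shows "\<exists>q>0. \<forall>x\<in>S. q * (norm x)\<^sup>2 \<le> x \<bullet> T x"
proof (cases "S = {0}")
  case True
  then show ?thesis by (intro exI[of _ 1]) auto
next
  case False
  define K where "K = S \<inter> sphere 0 1"
  have "compact K" unfolding K_def
    using closed_subspace[OF S(1)] by (intro closed_Int_compact) auto
  moreover have "K \<noteq> {}"
  proof -
    obtain y where "y \<in> S" "y \<noteq> 0" using False subspace_0[OF S(1)] by auto
    then have "y /\<^sub>R norm y \<in> K" using S(1) by (simp add: K_def subspace_scale)
    then show ?thesis by auto
  qed
  moreover have "continuous_on K (\<lambda>x. x \<bullet> T x)"
    using lin by (intro continuous_intros linear_continuous_on) (simp add: linear_conv_bounded_linear)
  ultimately obtain e where e: "e \<in> K" "\<And>y. y \<in> K \<Longrightarrow> e \<bullet> T e \<le> y \<bullet> T y"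
    using continuous_attains_inf by metis
  have "0 < e \<bullet> T e" using e(1) by (intro pos) (auto simp: K_def)
  moreover have "(e \<bullet> T e) * (norm y)\<^sup>2 \<le> y \<bullet> T y" if "y \<in> S" for y
  proof (cases "y = 0")
    case False
    have "y /\<^sub>R norm y \<in> K" using S(1) that False by (simp add: K_def subspace_scale)
    from e(2)[OF this] have "e \<bullet> T e \<le> (y \<bullet> T y) / (norm y)\<^sup>2"
      using lin by (simp add: linear_scale power2_eq_square divide_inverse mult_ac)
    then show ?thesis using False by (simp add: pos_le_divide_eq)
  qed (simp add: linear_0[OF lin])
  ultimately show ?thesis by blast
qed

section \<open>Verification of the drift conditions\<close>

lemma weighted_sum_squares_bound: "0 < c \<Longrightarrow> 2 * x * y \<le> c * x\<^sup>2 + y\<^sup>2 / (c::real)"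
  using sum_squares_bound[of "sqrt c * x" "y / sqrt c"]
  by (simp add: power_mult_distrib power_divide mult_ac)

text \<open>\<open>T\<close> is the Hessian compressed to the null space of \<open>Q\<close>,
  extended by the identity on the complement. The unstable part lies in the null space, so the
  penalty does not act on it; on the rest the penalty dissipates at least \<open>gam * q\<close>
  times the square of \<open>norm (d - PC d)\<close>, enough for every coupling through that
  component.\<close>

lemma (in rates) drift_verification:
  fixes Pm PC H Q :: "'a::euclidean_space \<Rightarrow> 'a"
  assumes linPm: "linear Pm" and adjPm: "\<And>x y. Pm x \<bullet> y = x \<bullet> Pm y" and idPm: "\<And>x. Pm (Pm x) = Pm x"
    and linPC: "linear PC" and adjPC: "\<And>x y. PC x \<bullet> y = x \<bullet> PC y" and idPC: "\<And>x. PC (PC x) = PC x"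
    and PCm: "\<And>x. PC (Pm x) = Pm x"
    and linH: "linear H" and h0: "\<And>x. norm (H x) \<le> h0 * norm x" "0 \<le> h0"
    and linQ: "linear Q" and QC: "\<And>x. Q (PC x) = 0" "\<And>x. PC (Q x) = 0"
    and q: "0 < q" "\<And>x. q * (norm (x - PC x))\<^sup>2 \<le> x \<bullet> Q x"
    and q1: "\<And>x. norm (Q x) \<le> q1 * norm (x - PC x)" "0 \<le> q1"
    and T: "\<And>x. T x = PC (H (PC x)) + (x - PC x)" and comm: "\<And>x. T (Pm x) = Pm (T x)"
    and neg: "\<And>x. Pm x \<bullet> T (Pm x) \<le> - lam0 * (norm (Pm x))\<^sup>2"
    and pos: "\<And>x. lam0 * (norm (x - Pm x))\<^sup>2 \<le> (x - Pm x) \<bullet> T (x - Pm x)"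
    and lam0: "0 < lam0" "lam = lam0 / 2" and L0: "L = 3 * (h0 + 1)"
    and err: "norm er \<le> del' * norm d" and del': "0 \<le> del'" "del' \<le> del / 4" "12 * del' \<le> lam0" "del' \<le> 1"
    and f: "f = H d + er + gam *\<^sub>R Q d"
    and a: "0 < a" "a * lam \<le> 1" "a * c2 \<le> 1" "a * (h0 + 1) \<le> 1" "a * (4 * (h0 + 1)\<^sup>2) \<le> del / 4" "a * (4 * (h0 + 1)\<^sup>2) \<le> lam0 / 4"
    and gam: "0 \<le> gam" "2 * (a * gam) * q1\<^sup>2 \<le> q" "Gam + 2 + 4 * h0\<^sup>2 / del + 16 * h0\<^sup>2 / lam0 \<le> gam * q"
  shows "drift_step a (Pm d) (d - Pm d) (norm (d - PC d)) (Pm (d - a *\<^sub>R f)) ((d - a *\<^sub>R f) - Pm (d - a *\<^sub>R f))"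
proof -
  define u s z where "u = Pm d" and "s = d - Pm d" and "z = d - PC d"
  define U S Z where "U = norm u" and "S = norm s" and "Z = norm z"
  have nn: "0 \<le> U" "0 \<le> S" "0 \<le> Z" by (auto simp: U_def S_def Z_def)
  have d: "d = u + s" by (simp add: u_def s_def)
  have Pu: "Pm u = u" "PC u = u" by (simp_all add: u_def idPm PCm)
  have Ps: "Pm s = 0" by (simp add: s_def linear_diff[OF linPm] idPm)
  have us: "u \<bullet> s = 0" using adjPm[of u s] Pu Ps by simp
  have uz: "u \<bullet> z = 0" using adjPC[of u z] Pu by (simp add: z_def linear_diff[OF linPC] idPC)
  have zs: "z = s - PC s" by (simp add: z_def d linear_add[OF linPC] Pu)
  have szz: "s \<bullet> z = Z\<^sup>2"
  proof -
    have "PC s \<bullet> z = 0" by (simp add: adjPC zs linear_diff[OF linPC] idPC)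
    then have "s \<bullet> z = z \<bullet> z" by (simp add: zs inner_diff_left)
    then show ?thesis by (simp add: Z_def power2_norm_eq_inner)
  qed
  have d2: "(norm d)\<^sup>2 = U\<^sup>2 + S\<^sup>2"
    by (simp add: d U_def S_def power2_norm_eq_inner inner_add us inner_commute[of s u])
  have dle: "norm d \<le> U + S" using norm_triangle_ineq[of u s] by (simp add: d U_def S_def)
  have PCn: "norm (PC x) \<le> norm x" for x
  proof -
    have "(norm (PC x))\<^sup>2 = x \<bullet> PC x" by (simp add: power2_norm_eq_inner adjPC idPC)
    also have "\<dots> \<le> norm x * norm (PC x)" by (rule norm_cauchy_schwarz)
    finally show ?thesis by (cases "norm (PC x) = 0") (auto simp: power2_eq_square)
  qed
  have Pmn: "norm (Pm x) \<le> norm x" for x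
  proof -
    have "(norm (Pm x))\<^sup>2 = x \<bullet> Pm x" by (simp add: power2_norm_eq_inner adjPm idPm)
    also have "\<dots> \<le> norm x * norm (Pm x)" by (rule norm_cauchy_schwarz)
    finally show ?thesis by (cases "norm (Pm x) = 0") (auto simp: power2_eq_square)
  qed
  have Hd: "H d = H (PC d) + H z" by (simp add: z_def linear_diff[OF linH])
  have HPC: "PC (H (PC d)) = T d - z" by (simp add: T z_def)
  have Td: "T d = T u + T s"
    unfolding d T by (simp add: linear_add[OF linPC] linear_add[OF linH])
  have T0: "T 0 = 0" by (simp add: T linear_0[OF linPC] linear_0[OF linH])
  have bnd: "\<bar>x \<bullet> H y\<bar> \<le> h0 * norm x * norm y" for x y
    using order_trans[OF Cauchy_Schwarz_ineq2[of x "H y"] mult_left_mono[OF h0(1)[of y], of "norm x"]] by (simp add: mult_ac)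
  have bne: "\<bar>x \<bullet> er\<bar> \<le> del' * norm x * (U + S)" for x
  proof -
    have "\<bar>x \<bullet> er\<bar> \<le> norm x * norm er" by (rule Cauchy_Schwarz_ineq2)
    also have "\<dots> \<le> norm x * (del' * (U + S))"
      using err dle del' by (intro mult_left_mono) (auto intro: order_trans mult_left_mono)
    finally show ?thesis by (simp add: mult_ac)
  qed
  have uQ: "u \<bullet> Q d = 0" using adjPC[of u "Q d"] Pu QC by simp
  have A: "a * U * (lam * U - del * S - L * Z) \<le> u \<bullet> (Pm (d - a *\<^sub>R f) - u)"
  proof -
    have "u \<bullet> H (PC d) = u \<bullet> T d"
      using adjPC[of u "H (PC d)"] Pu HPC uz by (simp add: inner_diff_right)
    moreover have "u \<bullet> T s = 0"
      using adjPm[of u "T s"] comm[of s] unfolding Pu(1) Ps T0 by simp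
    ultimately have "u \<bullet> f = u \<bullet> T u + u \<bullet> H z + u \<bullet> er"
      unfolding f Hd by (simp add: inner_add_right Td uQ)
    also have "\<dots> \<le> - lam0 * U\<^sup>2 + h0 * U * Z + del' * U * (U + S)"
      using neg[of d] bnd[of u z] bne[of u] by (simp add: u_def U_def Z_def)
    finally have uf: "u \<bullet> f \<le> - lam0 * U\<^sup>2 + h0 * U * Z + del' * U * (U + S)" .
    have "u \<bullet> (Pm (d - a *\<^sub>R f) - u) = - a * (u \<bullet> f)"
    proof -
      have "u \<bullet> Pm f = u \<bullet> f" using adjPm[of u f] Pu by simp
      then show ?thesis by (simp add: linear_diff[OF linPm] linear_scale[OF linPm] u_def[symmetric])
    qed
    moreover have "a * (u \<bullet> f) \<le> a * (- (U * (lam * U - del * S - L * Z)))"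
    proof (rule mult_left_mono)
      have "U * (lam * U - del * S - L * Z) = lam * U\<^sup>2 - del * (U * S) - L * (U * Z)" by (simp add: power2_eq_square algebra_simps)
      moreover have "(lam + del') * U\<^sup>2 \<le> lam0 * U\<^sup>2" using del' lam0 by (intro mult_right_mono) auto
      moreover have "del' * (U * S) \<le> del * (U * S)" using del' nn by (intro mult_right_mono) auto
      moreover have "h0 * (U * Z) \<le> L * (U * Z)" using h0 nn unfolding L0 by (intro mult_right_mono) auto
      ultimately show "u \<bullet> f \<le> - (U * (lam * U - del * S - L * Z))"
        using uf by (simp add: power2_eq_square algebra_simps)
    qed (use a in simp)
    ultimately show ?thesis by (simp add: algebra_simps)
  qed
  have fn: "norm f \<le> (h0 + 1) * norm d + gam * q1 * Z"
  proof -
    have "norm f \<le> norm (H d) + norm er + norm (gam *\<^sub>R Q d)"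
      unfolding f by (intro order_trans[OF norm_triangle_ineq] add_mono norm_triangle_ineq order_refl)
    also have "\<dots> \<le> h0 * norm d + 1 * norm d + gam * (q1 * Z)"
    proof (intro add_mono h0)
      show "norm er \<le> 1 * norm d" using err del' mult_right_mono[of del' 1 "norm d"] by simp
      show "norm (gam *\<^sub>R Q d) \<le> gam * (q1 * Z)" using gam q1(1)[of d] by (simp add: Z_def z_def mult_left_mono)
    qed
    finally show ?thesis by (simp add: algebra_simps)
  qed
  have f2: "(norm f)\<^sup>2 \<le> 2 * (h0 + 1)\<^sup>2 * (U\<^sup>2 + S\<^sup>2) + 2 * (gam * q1)\<^sup>2 * Z\<^sup>2"
  proof -
    have "(norm f)\<^sup>2 \<le> ((h0 + 1) * norm d + gam * q1 * Z)\<^sup>2" using fn by (intro power_mono) auto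
    also have "\<dots> \<le> 2 * ((h0 + 1) * norm d)\<^sup>2 + 2 * (gam * q1 * Z)\<^sup>2"
      using sum_squares_bound[of "(h0 + 1) * norm d" "gam * q1 * Z"] by (simp add: power2_sum)
    finally show ?thesis by (simp add: power_mult_distrib d2[symmetric])
  qed
  have Bst: "(norm ((d - a *\<^sub>R f) - Pm (d - a *\<^sub>R f)))\<^sup>2 \<le> (1 - a * lam) * S\<^sup>2 - a * Gam * Z\<^sup>2 + a * del * U\<^sup>2"
  proof -
    have e: "(d - a *\<^sub>R f) - Pm (d - a *\<^sub>R f) = s - a *\<^sub>R (f - Pm f)"
      by (simp add: s_def linear_diff[OF linPm] linear_scale[OF linPm] algebra_simps)
    have fp: "(norm (f - Pm f))\<^sup>2 \<le> (norm f)\<^sup>2"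
    proof -
      have "f \<bullet> Pm f = (norm (Pm f))\<^sup>2" by (simp add: power2_norm_eq_inner adjPm idPm)
      then have "(norm (f - Pm f))\<^sup>2 = (norm f)\<^sup>2 - (norm (Pm f))\<^sup>2"
        by (simp add: power2_norm_eq_inner inner_diff inner_commute)
      then show ?thesis by simp
    qed
    have sf: "s \<bullet> (f - Pm f) = s \<bullet> f" using adjPm[of s f] Ps by (simp add: inner_diff_right)
    \<comment> \<open>Apart from the error \<open>er\<close>, every term that spoils the coercivity
      of \<open>T\<close> contains a factor \<open>Z\<close>; this is what makes the penalty
      sufficient.\<close>
    have lower: "lam0 * S\<^sup>2 - Z\<^sup>2 - h0 * Z * (U + S) - h0 * S * Z - del' * S * (U + S) + gam * (q * Z\<^sup>2) \<le> s \<bullet> f"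
    proof -
      have sQ: "s \<bullet> Q d = s \<bullet> Q s"
      proof -
        have "Q u = 0" using QC(1)[of u] Pu by simp
        then show ?thesis by (simp add: d linear_add[OF linQ])
      qed
      have "q * Z\<^sup>2 \<le> s \<bullet> Q s" using q(2)[of s] by (simp add: Z_def zs)
      then have g: "gam * (q * Z\<^sup>2) \<le> gam * (s \<bullet> Q d)" unfolding sQ using gam by (intro mult_left_mono) auto
      have "s \<bullet> H (PC d) = PC s \<bullet> H (PC d) + z \<bullet> H (PC d)" by (simp add: zs inner_diff_left)
      also have "PC s \<bullet> H (PC d) = s \<bullet> T d - Z\<^sup>2"
        unfolding adjPC HPC by (simp add: inner_diff_right szz)
      also have "s \<bullet> T d = s \<bullet> T s"
      proof -
        have "s \<bullet> T u = 0" using adjPm[of s "T d"] comm[of d] unfolding Ps u_def by simp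
        then show ?thesis unfolding Td inner_add_right by simp
      qed
      finally have "s \<bullet> H d = s \<bullet> T s - Z\<^sup>2 + z \<bullet> H (PC d) + s \<bullet> H z" by (simp add: Hd inner_add_right)
      moreover have "lam0 * S\<^sup>2 \<le> s \<bullet> T s" using pos[of d] by (simp add: s_def S_def)
      moreover have "- (h0 * Z * (U + S)) \<le> z \<bullet> H (PC d)"
      proof -
        have "\<bar>z \<bullet> H (PC d)\<bar> \<le> h0 * Z * norm (PC d)" using bnd by (simp add: Z_def)
        also have "\<dots> \<le> h0 * Z * (U + S)" using PCn[of d] dle h0 nn by (intro mult_left_mono) auto
        finally show ?thesis by linarith
      qed
      moreover have "- (h0 * S * Z) \<le> s \<bullet> H z" using bnd[of s z] by (simp add: S_def Z_def)
      moreover have "- (del' * S * (U + S)) \<le> s \<bullet> er" using bne[of s] by (simp add: S_def)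
      ultimately show ?thesis using g by (simp add: f inner_add_right)
    qed
    have y1: "2 * Z * (h0 * U) \<le> (4 * h0\<^sup>2 / del) * Z\<^sup>2 + del / 4 * U\<^sup>2"
      using weighted_sum_squares_bound[of "del / 4" U "h0 * Z"] del by (simp add: power_mult_distrib mult_ac)
    have y2: "2 * S * (2 * h0 * Z) \<le> lam0 / 4 * S\<^sup>2 + (16 * h0\<^sup>2 / lam0) * Z\<^sup>2"
      using weighted_sum_squares_bound[of "lam0 / 4" S "2 * h0 * Z"] lam0 by (simp add: power_mult_distrib mult_ac)
    have y3: "2 * S * U \<le> S\<^sup>2 + U\<^sup>2" by (rule sum_squares_bound)
    have y3': "del' * (2 * S * U) \<le> del' * (S\<^sup>2 + U\<^sup>2)" using y3 del' by (intro mult_left_mono)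
    \<comment> \<open>Half of the dissipation \<open>2 * gam * q * Z\<^sup>2\<close> pays for the
      second-order term, which contains \<open>a * gam\<^sup>2 * Z\<^sup>2\<close>; here the
      smallness of \<open>a * gam\<close> enters. The other half pays for \<open>Gam\<close> and for
      the couplings in \<open>y1\<close> and \<open>y2\<close>.\<close>
    have y4: "a * (norm f)\<^sup>2 \<le> del / 4 * U\<^sup>2 + lam0 / 4 * S\<^sup>2 + gam * q * Z\<^sup>2"
    proof -
      have "a * (norm f)\<^sup>2 \<le> a * (2 * (h0 + 1)\<^sup>2 * (U\<^sup>2 + S\<^sup>2) + 2 * (gam * q1)\<^sup>2 * Z\<^sup>2)"
        using f2 a by (intro mult_left_mono) auto
      also have "\<dots> = (a * (4 * (h0 + 1)\<^sup>2)) / 2 * U\<^sup>2 + (a * (4 * (h0 + 1)\<^sup>2)) / 2 * S\<^sup>2 + gam * (2 * (a * gam) * q1\<^sup>2) * Z\<^sup>2"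
        by (simp add: power_mult_distrib power2_eq_square field_simps)
      also have "\<dots> \<le> del / 4 * U\<^sup>2 + lam0 / 4 * S\<^sup>2 + gam * q * Z\<^sup>2"
      proof (intro add_mono mult_right_mono mult_left_mono)
        show "a * (4 * (h0 + 1)\<^sup>2) / 2 \<le> del / 4" using a del by simp
        show "a * (4 * (h0 + 1)\<^sup>2) / 2 \<le> lam0 / 4" using a lam0 by simp
      qed (use gam in auto)
      finally show ?thesis .
    qed
    have z: "(Gam + 2 + 4 * h0\<^sup>2 / del + 16 * h0\<^sup>2 / lam0) * Z\<^sup>2 \<le> gam * q * Z\<^sup>2"
      using gam by (intro mult_right_mono) auto
    have dU: "del' * U\<^sup>2 \<le> del / 4 * U\<^sup>2" using del' by (intro mult_right_mono) auto
    have dS: "3 * del' * S\<^sup>2 \<le> lam0 / 4 * S\<^sup>2" using del' by (intro mult_right_mono) auto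
    have comb: "- 2 * (s \<bullet> f) + a * (norm f)\<^sup>2 \<le> - (lam * S\<^sup>2) - Gam * Z\<^sup>2 + del * U\<^sup>2"
    proof -
      have l2: "2 * lam0 * S\<^sup>2 - 2 * Z\<^sup>2 - 2 * Z * (h0 * U) - 2 * S * (2 * h0 * Z) - del' * (2 * S * U) - 2 * del' * S\<^sup>2 + 2 * (gam * q * Z\<^sup>2) \<le> 2 * (s \<bullet> f)"
        using lower by (simp add: algebra_simps power2_eq_square)
      have dsp: "del' * (S\<^sup>2 + U\<^sup>2) = del' * S\<^sup>2 + del' * U\<^sup>2" by (simp add: algebra_simps)
      have zsp: "(Gam + 2 + 4 * h0\<^sup>2 / del + 16 * h0\<^sup>2 / lam0) * Z\<^sup>2 = Gam * Z\<^sup>2 + 2 * Z\<^sup>2 + (4 * h0\<^sup>2 / del) * Z\<^sup>2 + (16 * h0\<^sup>2 / lam0) * Z\<^sup>2"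
        by (simp add: algebra_simps)
      have lS: "lam * S\<^sup>2 = lam0 * S\<^sup>2 / 2" "lam0 / 4 * S\<^sup>2 = lam0 * S\<^sup>2 / 4" by (simp_all add: lam0)
      have S0: "0 \<le> lam0 * S\<^sup>2" "0 \<le> del * U\<^sup>2" using lam0 del by auto
      have dq: "del / 4 * U\<^sup>2 = del * U\<^sup>2 / 4" by simp
      show ?thesis using l2 y1 y2 y3' y4 z dU dS S0 unfolding dsp zsp lS dq by linarith
    qed
    have "(norm (s - a *\<^sub>R (f - Pm f)))\<^sup>2 = S\<^sup>2 - 2 * a * (s \<bullet> f) + a\<^sup>2 * (norm (f - Pm f))\<^sup>2"
    proof -
      have "(norm (s - a *\<^sub>R w))\<^sup>2 = (norm s)\<^sup>2 - 2 * a * (s \<bullet> w) + a\<^sup>2 * (norm w)\<^sup>2" for w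
        unfolding power2_norm_eq_inner by (simp add: inner_diff inner_commute power2_eq_square algebra_simps)
      then show ?thesis by (simp add: sf S_def)
    qed
    also have "\<dots> \<le> S\<^sup>2 - 2 * a * (s \<bullet> f) + a\<^sup>2 * (norm f)\<^sup>2"
      using fp by (intro add_left_mono mult_left_mono) auto
    also have "\<dots> = S\<^sup>2 + a * (- 2 * (s \<bullet> f) + a * (norm f)\<^sup>2)" by (simp add: power2_eq_square algebra_simps)
    also have "\<dots> \<le> S\<^sup>2 + a * (- (lam * S\<^sup>2) - Gam * Z\<^sup>2 + del * U\<^sup>2)"
      using comb a by (intro add_left_mono mult_left_mono) auto
    finally show ?thesis unfolding e by (simp add: algebra_simps)
  qed
  have Cst: "(norm (Pm (d - a *\<^sub>R f)))\<^sup>2 \<le> U\<^sup>2 + a * L * (U\<^sup>2 + S\<^sup>2)"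
  proof -
    have PQ: "Pm (Q d) = 0"
    proof -
      have "Pm (Q d) \<bullet> y = 0" for y
        using adjPC[of "Pm y" "Q d"] QC(2)[of d] PCm[of y] by (simp add: adjPm inner_commute)
      then show ?thesis by (metis inner_eq_zero_iff)
    qed
    define n where "n = norm d"
    have n: "0 \<le> n" "U \<le> n" using Pmn[of d] by (auto simp: n_def U_def u_def)
    have "norm (H d + er) \<le> (h0 + 1) * n"
      using norm_triangle_ineq[of "H d" er] h0(1)[of d] err mult_right_mono[of del' 1 "norm d"] del'
      by (simp add: n_def algebra_simps)
    then have pf: "norm (Pm (H d + er)) \<le> (h0 + 1) * n" using Pmn[of "H d + er"] by simp
    have "Pm (d - a *\<^sub>R f) = u - a *\<^sub>R Pm (H d + er)"
      by (simp add: f u_def linear_diff[OF linPm] linear_add[OF linPm] linear_scale[OF linPm] PQ)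
    then have "norm (Pm (d - a *\<^sub>R f)) \<le> U + a * ((h0 + 1) * n)"
    proof -
      have "norm (a *\<^sub>R Pm (H d + er)) \<le> a * ((h0 + 1) * n)"
        unfolding norm_scaleR using pf a by (auto intro: mult_left_mono)
      then show ?thesis using norm_triangle_ineq4[of u "a *\<^sub>R Pm (H d + er)"] \<open>Pm (d - a *\<^sub>R f) = _\<close>
        unfolding U_def by simp
    qed
    then have "(norm (Pm (d - a *\<^sub>R f)))\<^sup>2 \<le> (U + a * ((h0 + 1) * n))\<^sup>2" by (intro power_mono) auto
    \<comment> \<open>Since \<open>a * (h0 + 1) \<le> 1\<close>, the squared increment is at most
      linear in \<open>a\<close>; two copies of \<open>h0 + 1\<close> from the cross term and one
      from the square make up \<open>L\<close>.\<close>
    also have "\<dots> = U\<^sup>2 + 2 * (a * (h0 + 1)) * (U * n) + (a * (h0 + 1)) * (a * (h0 + 1)) * n\<^sup>2"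
      by (simp add: power2_eq_square algebra_simps)
    also have "\<dots> \<le> U\<^sup>2 + 2 * (a * (h0 + 1)) * n\<^sup>2 + (a * (h0 + 1)) * 1 * n\<^sup>2"
    proof (intro add_mono mult_left_mono mult_right_mono order_refl)
      show "U * n \<le> n\<^sup>2" using n by (simp add: power2_eq_square mult_right_mono)
    qed (use a h0 in auto)
    also have "\<dots> = U\<^sup>2 + a * L * n\<^sup>2" by (simp add: L0 algebra_simps)
    finally show ?thesis by (simp add: n_def d2)
  qed
  show ?thesis unfolding drift_step_def
    using a A Bst Cst by (simp add: u_def s_def z_def U_def S_def Z_def)
qed

section \<open>Gradients and Hessians\<close>

text \<open>A derivative within a subspace is determined only on that subspace. Along a line inside
  it the ordinary uniqueness of derivatives on the real line becomes applicable.\<close>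

lemma has_derivative_along_line:
  fixes f :: "'a::euclidean_space \<Rightarrow> 'b::real_normed_vector"
  assumes f: "(f has_derivative f') (at x within S)" and S: "subspace S" "x \<in> S" "c \<in> S"
  shows "((\<lambda>t. f (x + t *\<^sub>R c)) has_derivative (\<lambda>t. f' (t *\<^sub>R c))) (at 0)"
proof -
  have "((\<lambda>t. x + t *\<^sub>R c) has_derivative (\<lambda>t. t *\<^sub>R c)) (at 0)"
    by (auto intro!: derivative_eq_intros)
  moreover have "(f has_derivative f') (at (x + 0 *\<^sub>R c) within range (\<lambda>t. x + t *\<^sub>R c))"
  proof (rule has_derivative_subset)
    show "(f has_derivative f') (at (x + 0 *\<^sub>R c) within S)" using f by simp
    show "range (\<lambda>t. x + t *\<^sub>R c) \<subseteq> S" using S by (auto intro: subspace_add subspace_scale)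
  qed
  ultimately show ?thesis by (rule has_derivative_in_compose)
qed

lemma derivative_unique_on_subspace:
  fixes f :: "'a::euclidean_space \<Rightarrow> 'b::real_normed_vector"
  assumes "(f has_derivative f') (at x within S)" "(f has_derivative f'') (at x within S)"
    and S: "subspace S" "x \<in> S" "c \<in> S"
  shows "f' c = f'' c"
  using has_derivative_unique[OF has_derivative_along_line[OF assms(1) S] has_derivative_along_line[OF assms(2) S]]
  by (metis scaleR_one)

lemma gradient_on_subspace:
  assumes G: "has_gradient_on h G y S" and g: "GDERIV h y :> g" and S: "subspace S" "y \<in> S" "c \<in> S"
  shows "G \<bullet> c = g \<bullet> c"
proof -
  have "(h has_derivative (\<lambda>d. g \<bullet> d)) (at y within S)"
    using g by (simp add: gderiv_def inner_commute has_derivative_at_withinI)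
  then show ?thesis
    using derivative_unique_on_subspace[of h "\<lambda>d. G \<bullet> d" y S "\<lambda>d. g \<bullet> d" c] G S by (simp add: has_gradient_on_def)
qed

definition grad :: "('a::euclidean_space \<Rightarrow> real) \<Rightarrow> 'a \<Rightarrow> 'a" where
  "grad h y = (\<Sum>i\<in>Basis. frechet_derivative h (at y) i *\<^sub>R i)"

lemma GDERIV_grad:
  assumes "h differentiable (at y)" shows "GDERIV h y :> grad h y"
proof -
  have d: "(h has_derivative frechet_derivative h (at y)) (at y)" using assms by (simp add: frechet_derivative_works)
  have "frechet_derivative h (at y) v = v \<bullet> grad h y" for v
  proof -
    have "frechet_derivative h (at y) v = frechet_derivative h (at y) (\<Sum>i\<in>Basis. (v \<bullet> i) *\<^sub>R i)"
      by (simp add: euclidean_representation)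
    also have "\<dots> = (\<Sum>i\<in>Basis. (v \<bullet> i) * frechet_derivative h (at y) i)"
      using has_derivative_linear[OF d] by (simp add: linear_sum linear_scale)
    finally show ?thesis by (simp add: grad_def inner_sum_right mult.commute)
  qed
  then have "frechet_derivative h (at y) = (\<lambda>v. v \<bullet> grad h y)" by auto
  then show ?thesis using d by (simp add: gderiv_def)
qed

lemma grad_component: "i \<in> Basis \<Longrightarrow> grad h y \<bullet> i = frechet_derivative h (at y) i"
  unfolding grad_def by (simp add: inner_sum_left inner_Basis if_distrib cong: if_cong)

lemma GDERIV_grad_unique: "GDERIV h y :> g \<Longrightarrow> grad h y = g"
proof -
  assume g: "GDERIV h y :> g"
  then have "h differentiable (at y)" by (auto simp: gderiv_def differentiable_def)
  then have "(\<lambda>v. v \<bullet> grad h y) = (\<lambda>v. v \<bullet> g)"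
    using GDERIV_grad[of h y] g has_derivative_unique unfolding gderiv_def by blast
  then have "v \<bullet> grad h y = v \<bullet> g" for v by (rule fun_cong)
  then show "grad h y = g" by (rule vector_eq_rdot[THEN iffD1, OF allI, simplified inner_commute])
qed

text \<open>Two trajectories are compared, so the linearization error must be small relative to the
  distance of two arbitrary points near \<open>xs\<close>, not only relative to the distance from
  \<open>xs\<close>. This is the mean value inequality for \<open>grad h - H\<close>, whose
  derivative is small near \<open>xs\<close> because the second derivatives are continuous.\<close>

lemma grad_strictly_differentiable:
  fixes h :: "'a::euclidean_space \<Rightarrow> real"
  assumes S: "open S" "xs \<in> S" "higher_differentiable_on S h 3"
    and H: "(grad h has_derivative H) (at xs)" and d: "0 < d"
  shows "\<exists>r>0. \<forall>y\<in>ball xs r. \<forall>y'\<in>ball xs r. norm (grad h y - grad h y' - H (y - y')) \<le> d * norm (y - y')"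
proof -
  define gi where "gi i y = frechet_derivative h (at y) i" for i y
  have h2: "higher_differentiable_on S (gi i) 2" for i
    using S(3) by (simp add: numeral_3_eq_3 numeral_2_eq_2 gi_def[abs_def])
  have gd: "gi i differentiable (at y)" if "y \<in> S" for i y
    using h2[of i] that by (simp add: numeral_2_eq_2)
  have dd: "(\<lambda>y. frechet_derivative (gi i) (at y) v) differentiable (at y)" if "y \<in> S" for i y v
    using h2[of i] that by (simp add: numeral_2_eq_2)
  have lH: "linear H" using has_derivative_linear[OF H] .
  have gH: "frechet_derivative (gi i) (at xs) = (\<lambda>v. H v \<bullet> i)" if i: "i \<in> Basis" for i
  proof -
    have "((\<lambda>y. grad h y \<bullet> i) has_derivative (\<lambda>v. H v \<bullet> i)) (at xs)"
      using H by (auto intro!: derivative_eq_intros)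
    then have "(gi i has_derivative (\<lambda>v. H v \<bullet> i)) (at xs)" by (simp add: grad_component i gi_def[abs_def])
    then show ?thesis by (metis frechet_derivative_at)
  qed
  define N where "N = real (DIM('a))"
  have N: "0 < N" by (simp add: N_def)
  \<comment> \<open>One factor \<open>N\<close> is lost in the operator norm of a single component,
    the other in bounding the norm by the sum of the components.\<close>
  define e where "e = d / (N * N)"
  have e: "0 < e" using d N by (simp add: e_def)
  have "\<forall>\<^sub>F y in nhds xs. \<bar>frechet_derivative (gi i) (at y) j - H j \<bullet> i\<bar> < e" if "i \<in> Basis" "j \<in> Basis" for i j
  proof -
    have "isCont (\<lambda>y. frechet_derivative (gi i) (at y) j) xs"
      using dd[OF S(2)] differentiable_imp_continuous_within by blast
    then have "((\<lambda>y. frechet_derivative (gi i) (at y) j) \<longlongrightarrow> frechet_derivative (gi i) (at xs) j) (nhds xs)"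
      unfolding isCont_def tendsto_at_iff_tendsto_nhds[of "\<lambda>y. frechet_derivative (gi i) (at y) j" xs] .
    then have "((\<lambda>y. frechet_derivative (gi i) (at y) j) \<longlongrightarrow> H j \<bullet> i) (nhds xs)"
      unfolding gH[OF that(1)] .
    then show ?thesis using e by (auto dest: tendstoD simp: dist_real_def)
  qed
  then have "\<forall>\<^sub>F y in nhds xs. \<forall>i\<in>Basis. \<forall>j\<in>Basis. \<bar>frechet_derivative (gi i) (at y) j - H j \<bullet> i\<bar> < e"
    by (intro eventually_ball_finite ballI) auto
  moreover have "\<forall>\<^sub>F y in nhds xs. y \<in> S" using S by (intro eventually_nhds_in_open)
  ultimately have "\<forall>\<^sub>F y in nhds xs. y \<in> S \<and> (\<forall>i\<in>Basis. \<forall>j\<in>Basis. \<bar>frechet_derivative (gi i) (at y) j - H j \<bullet> i\<bar> < e)"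
    by eventually_elim blast
  then obtain r where r: "0 < r" "\<And>y. dist y xs < r \<Longrightarrow> y \<in> S \<and> (\<forall>i\<in>Basis. \<forall>j\<in>Basis. \<bar>frechet_derivative (gi i) (at y) j - H j \<bullet> i\<bar> < e)"
    unfolding eventually_nhds_metric by blast
  have comp: "\<bar>(gi i y - H y \<bullet> i) - (gi i y' - H y' \<bullet> i)\<bar> \<le> (d / N) * norm (y - y')"
    if i: "i \<in> Basis" and yb: "y \<in> ball xs r" "y' \<in> ball xs r" for i y y'
  proof -
    have "norm ((gi i y - H y \<bullet> i) - (gi i y' - H y' \<bullet> i)) \<le> (d / N) * norm (y - y')"
    proof (rule differentiable_bound[of "ball xs r" "\<lambda>y. gi i y - H y \<bullet> i" "\<lambda>y v. frechet_derivative (gi i) (at y) v - H v \<bullet> i"])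
      fix w assume w: "w \<in> ball xs r"
      then have wS: "w \<in> S" "\<And>j. j \<in> Basis \<Longrightarrow> \<bar>frechet_derivative (gi i) (at w) j - H j \<bullet> i\<bar> < e"
        using r(2)[of w] i by (auto simp: dist_commute)
      have D: "(gi i has_derivative frechet_derivative (gi i) (at w)) (at w)"
        using gd[OF wS(1)] by (simp add: frechet_derivative_works)
      have "(H has_derivative H) (at w)" by (rule linear_imp_has_derivative[OF lH])
      then show "((\<lambda>y. gi i y - H y \<bullet> i) has_derivative (\<lambda>v. frechet_derivative (gi i) (at w) v - H v \<bullet> i)) (at w within ball xs r)"
        by (intro has_derivative_at_withinI[OF has_derivative_diff] has_derivative_inner_left D)
      show "onorm (\<lambda>v. frechet_derivative (gi i) (at w) v - H v \<bullet> i) \<le> d / N"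
      proof (rule onorm_le)
        fix v :: 'a
        define L where "L = (\<lambda>v. frechet_derivative (gi i) (at w) v - H v \<bullet> i)"
        have lL: "linear L" unfolding L_def
          using has_derivative_linear[OF D] lH
          by (auto simp: linear_iff inner_add_left algebra_simps)
        have "L v = L (\<Sum>j\<in>Basis. (v \<bullet> j) *\<^sub>R j)" by (simp add: euclidean_representation)
        also have "\<dots> = (\<Sum>j\<in>Basis. (v \<bullet> j) * L j)" using lL by (simp add: linear_sum linear_scale)
        finally have "\<bar>L v\<bar> \<le> (\<Sum>j\<in>Basis. \<bar>(v \<bullet> j) * L j\<bar>)" by (simp add: sum_abs)
        also have "\<dots> \<le> (\<Sum>j\<in>(Basis::'a set). norm v * e)"
        proof (rule sum_mono)
          fix j :: 'a assume j: "j \<in> Basis"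
          have "\<bar>v \<bullet> j\<bar> * \<bar>L j\<bar> \<le> norm v * e"
            using wS(2)[OF j] Basis_le_norm[OF j, of v] by (intro mult_mono) (auto simp: L_def)
          then show "\<bar>(v \<bullet> j) * L j\<bar> \<le> norm v * e" by (simp add: abs_mult)
        qed
        also have "\<dots> = d / N * norm v" using N by (simp add: N_def e_def)
        finally show "norm (frechet_derivative (gi i) (at w) v - H v \<bullet> i) \<le> d / N * norm v" by (simp add: L_def)
      qed
    qed (use yb in auto)
    then show ?thesis by simp
  qed
  show ?thesis
  proof (intro exI[of _ r] conjI ballI r)
    fix y y' assume yb: "y \<in> ball xs r" "y' \<in> ball xs r"
    have "norm (grad h y - grad h y' - H (y - y')) \<le> (\<Sum>i\<in>Basis. \<bar>(grad h y - grad h y' - H (y - y')) \<bullet> i\<bar>)"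
      by (rule norm_le_l1)
    also have "\<dots> \<le> (\<Sum>i\<in>(Basis::'a set). (d / N) * norm (y - y'))"
    proof (rule sum_mono)
      fix i :: 'a assume i: "i \<in> Basis"
      have "(grad h y - grad h y' - H (y - y')) \<bullet> i = (gi i y - H y \<bullet> i) - (gi i y' - H y' \<bullet> i)"
        by (simp add: inner_diff_left grad_component i gi_def linear_diff[OF lH])
      then show "\<bar>(grad h y - grad h y' - H (y - y')) \<bullet> i\<bar> \<le> (d / N) * norm (y - y')"
        using comp[OF i yb] by simp
    qed
    also have "\<dots> = d * norm (y - y')" using N by (simp add: N_def)
    finally show "norm (grad h y - grad h y' - H (y - y')) \<le> d * norm (y - y')" .
  qed
qed

text \<open>Continuity of the gradient forces all limits in the definition to agree. Near the saddle
  point the selection \<open>v\<close> is therefore a function of the current iterate.\<close>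

lemma generalized_gradient_C1:
  fixes h :: "'a::euclidean_space \<Rightarrow> real"
  assumes S: "open S" "y \<in> S" and diff: "\<And>z. z \<in> S \<Longrightarrow> h differentiable (at z)" and cont: "continuous_on S (grad h)"
  shows "generalized_gradient h y = {grad h y}"
proof -
  have lim: "(\<lambda>i. grad h (X i)) \<longlonglongrightarrow> grad h y" if "X \<longlonglongrightarrow> y" for X :: "nat \<Rightarrow> 'a"
    using S cont that by (metis continuous_on_eq_continuous_at isCont_tendsto_compose)
  have "{g. \<exists>X G. X \<longlonglongrightarrow> y \<and> (\<forall>i::nat. GDERIV h (X i) :> G i) \<and> G \<longlonglongrightarrow> g} = {grad h y}"
  proof (intro equalityI subsetI)
    fix g assume "g \<in> {g. \<exists>X G. X \<longlonglongrightarrow> y \<and> (\<forall>i::nat. GDERIV h (X i) :> G i) \<and> G \<longlonglongrightarrow> g}"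
    then obtain X G where XG: "X \<longlonglongrightarrow> y" "\<And>i::nat. GDERIV h (X i) :> G i" "G \<longlonglongrightarrow> g" by blast
    have "G = (\<lambda>i. grad h (X i))" using GDERIV_grad_unique[OF XG(2)] by auto
    then show "g \<in> {grad h y}" using lim[OF XG(1)] XG(3) LIMSEQ_unique by blast
  next
    fix g assume "g \<in> {grad h y}"
    then show "g \<in> {g. \<exists>X G. X \<longlonglongrightarrow> y \<and> (\<forall>i::nat. GDERIV h (X i) :> G i) \<and> G \<longlonglongrightarrow> g}"
      using GDERIV_grad[OF diff[OF S(2)]] by (intro CollectI exI[of _ "\<lambda>_. y"] exI[of _ "\<lambda>_. grad h y"]) auto
  qed
  then show ?thesis by (simp add: generalized_gradient_def)
qed

lemma C3_imp_C1:
  fixes h :: "'a::euclidean_space \<Rightarrow> real"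
  assumes "higher_differentiable_on S h 3" "open S"
  shows "\<And>z. z \<in> S \<Longrightarrow> h differentiable (at z)" "continuous_on S (grad h)"
proof -
  show "\<And>z. z \<in> S \<Longrightarrow> h differentiable (at z)" using assms by (simp add: numeral_3_eq_3)
  have "continuous_on S (\<lambda>y. frechet_derivative h (at y) v)" for v
  proof -
    have "(\<lambda>y. frechet_derivative h (at y) v) differentiable (at z)" if "z \<in> S" for z
      using assms that by (simp add: numeral_3_eq_3)
    then show ?thesis using differentiable_imp_continuous_within assms(2)
      by (metis continuous_on_eq_continuous_at)
  qed
  then show "continuous_on S (grad h)" unfolding grad_def[abs_def] by (intro continuous_intros)
qed

text \<open>A matrix orthogonally similar to a diagonal one is symmetric, so self-adjointness of the
  Hessian is read off from the diagonalization at the point \<open>xs\<close> itself.\<close>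

lemma hessian_from_diagonalization:
  fixes h :: "real^'m \<Rightarrow> real"
  assumes U: "\<forall>\<^sub>F y in nhds xs. orthogonal_matrix (U y) \<and>
           (\<exists>H. has_hessian_on h (\<lambda>d. H *v d) y UNIV \<and> diagonal_matrix (transpose (U y) ** H ** U y))"
  obtains H where "linear H" "\<And>x y. H x \<bullet> y = x \<bullet> H y" "(grad h has_derivative H) (at xs)"
proof -
  obtain H where o: "orthogonal_matrix (U xs)" and H: "has_hessian_on h (\<lambda>d. H *v d) xs UNIV"
    and dg: "diagonal_matrix (transpose (U xs) ** H ** U xs)"
    using eventually_nhds_x_imp_x[OF U] by blast
  define V where "V = U xs"
  have V: "transpose V ** V = mat 1" "V ** transpose V = mat 1"
    using o by (auto simp: V_def orthogonal_matrix_def)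
  have "transpose (transpose V ** H ** V) = transpose V ** H ** V"
    using dg unfolding diagonal_matrix_def V_def[symmetric] transpose_def by (simp add: vec_eq_iff) metis
  then have "transpose V ** transpose H ** V = transpose V ** H ** V"
    by (simp add: matrix_transpose_mul matrix_mul_assoc)
  then have "V ** (transpose V ** transpose H ** V) ** transpose V = V ** (transpose V ** H ** V) ** transpose V" by simp
  moreover have "V ** (transpose V ** K ** V) ** transpose V = K" for K
  proof -
    have "V ** (transpose V ** K ** V) ** transpose V = (V ** transpose V) ** K ** (V ** transpose V)"
      by (simp only: matrix_mul_assoc)
    then show ?thesis by (simp add: V)
  qed
  ultimately have sym: "transpose H = H" by simp
  obtain G where G: "\<forall>\<^sub>F y in nhds xs. has_gradient_on h (G y) y UNIV" "(G has_derivative (\<lambda>d. H *v d)) (at xs)"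
    using H by (auto simp: has_hessian_on_def)
  have ev: "\<forall>\<^sub>F y in nhds xs. G y = grad h y"
    using G(1)
  proof eventually_elim
    case (elim y)
    then have "GDERIV h y :> G y" by (simp add: has_gradient_on_def gderiv_def inner_commute)
    then show ?case using GDERIV_grad_unique by metis
  qed
  have "(grad h has_derivative (\<lambda>d. H *v d)) (at xs)"
    using has_derivative_transform_eventually[OF G(2), of "grad h"] ev eventually_nhds_x_imp_x[OF ev]
    by (simp add: eventually_at_filter eventually_mono)
  moreover have "(H *v x) \<bullet> y = x \<bullet> (H *v y)" for x y
    using dot_lmul_matrix[of x H y] sym by (metis dot_lmul_matrix transpose_matrix_vector inner_commute)
  ultimately show ?thesis using that[of "\<lambda>d. H *v d"] by auto
qed

text \<open>On \<open>C\<close> the bilinear forms of \<open>H\<close> and of the intrinsic Hessian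
  \<open>H'\<close> agree, so bijectivity of \<open>H'\<close> gives the first claim. For the
  second, a form bounded below by \<open>lam\<close> on \<open>C\<close> would make \<open>h\<close>
  nondecreasing along every short segment in \<open>C\<close> that starts at \<open>xs\<close>,
  hence \<open>xs\<close> a local minimum.\<close>

lemma saddle_hessian:
  fixes h :: "'a::euclidean_space \<Rightarrow> real" and PC :: "'a \<Rightarrow> 'a"
  assumes C: "subspace C" and sp: "regular_saddle_point_on h C xs"
    and linH: "linear H" and adjH: "\<And>x y. H x \<bullet> y = x \<bullet> H y" and H: "(grad h has_derivative H) (at xs)"
    and S: "open S" "xs \<in> S" and diff: "\<And>z. z \<in> S \<Longrightarrow> h differentiable (at z)"
    and strict: "\<And>d. 0 < d \<Longrightarrow> \<exists>r>0. \<forall>y\<in>ball xs r. \<forall>y'\<in>ball xs r. norm (grad h y - grad h y' - H (y - y')) \<le> d * norm (y - y')"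
  shows "c \<in> C \<Longrightarrow> (\<And>c'. c' \<in> C \<Longrightarrow> H c \<bullet> c' = 0) \<Longrightarrow> c = 0"
    and "0 < lam \<Longrightarrow> \<exists>c\<in>C. c \<bullet> H c < lam * (norm c)\<^sup>2"
proof -
  have xC: "xs \<in> C" and g0: "has_gradient_on h 0 xs C" and nmin: "\<not> (\<forall>\<^sub>F y in at xs within C. h xs \<le> h y)"
    using sp by (auto simp: regular_saddle_point_on_def)
  obtain H' where H': "has_hessian_on h H' xs C" "bij_betw H' C C" using sp by (auto simp: regular_saddle_point_on_def)
  obtain G where G: "\<forall>\<^sub>F y in nhds xs. y \<in> C \<longrightarrow> has_gradient_on h (G y) y C" "(G has_derivative H') (at xs within C)"
    using H'(1) by (auto simp: has_hessian_on_def)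
  have HH: "H' c \<bullet> c' = H c \<bullet> c'" if c: "c \<in> C" "c' \<in> C" for c c'
  proof -
    have 1: "((\<lambda>y. G y \<bullet> c') has_derivative (\<lambda>v. H' v \<bullet> c')) (at xs within C)"
      using G(2) by (auto intro!: derivative_eq_intros)
    have "((\<lambda>y. grad h y \<bullet> c') has_derivative (\<lambda>v. H v \<bullet> c')) (at xs within C)"
      using has_derivative_at_withinI[OF H] by (auto intro!: derivative_eq_intros)
    moreover have ev: "\<forall>\<^sub>F y in nhds xs. y \<in> C \<longrightarrow> grad h y \<bullet> c' = G y \<bullet> c'"
      using G(1) eventually_nhds_in_open[OF S]
      by eventually_elim (use gradient_on_subspace[OF _ GDERIV_grad[OF diff] C _ c(2)] in auto)
    have "\<forall>\<^sub>F y in at xs within C. grad h y \<bullet> c' = G y \<bullet> c'"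
      using ev unfolding eventually_at_filter by eventually_elim simp
    ultimately have 2: "((\<lambda>y. G y \<bullet> c') has_derivative (\<lambda>v. H v \<bullet> c')) (at xs within C)"
      using has_derivative_transform_eventually[of "\<lambda>y. grad h y \<bullet> c'" _ xs C "\<lambda>y. G y \<bullet> c'"]
        eventually_nhds_x_imp_x[OF ev] xC by blast
    show ?thesis using derivative_unique_on_subspace[OF 1 2 C xC c(1)] .
  qed
  show "c = 0" if c: "c \<in> C" "\<And>c'. c' \<in> C \<Longrightarrow> H c \<bullet> c' = 0"
  proof -
    have hc: "H' c \<in> C" using H'(2) c by (auto simp: bij_betw_def)
    have "H' c \<bullet> H' c = 0" using HH[OF c(1) hc] c(2)[OF hc] by simp
    then have "H' c = H' 0" using has_derivative_linear[OF G(2)] by (simp add: linear_0)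
    then show ?thesis using H'(2) c(1) subspace_0[OF C] by (auto simp: bij_betw_def inj_on_def)
  qed
  show "\<exists>c\<in>C. c \<bullet> H c < lam * (norm c)\<^sup>2" if lam: "0 < lam"
  proof (rule ccontr)
    assume "\<not> ?thesis"
    then have coer: "lam * (norm c)\<^sup>2 \<le> c \<bullet> H c" if "c \<in> C" for c using that by (meson not_le)
    \<comment> \<open>The linearization error is taken no larger than the supposed coercivity
      constant, so it cannot reverse the sign of the derivative.\<close>
    obtain r where r: "0 < r" "\<And>y y'. y \<in> ball xs r \<Longrightarrow> y' \<in> ball xs r \<Longrightarrow> norm (grad h y - grad h y' - H (y - y')) \<le> lam * norm (y - y')"
      using strict[OF lam] by blast
    obtain r' where r': "0 < r'" "ball xs r' \<subseteq> S" using S openE by blast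
    have "h xs \<le> h y" if y: "y \<in> C" "dist y xs < min r r'" for y
    proof -
      define c where "c = y - xs"
      have c: "c \<in> C" using y xC C by (simp add: c_def subspace_diff)
      have inb: "xs + t *\<^sub>R c \<in> ball xs (min r r')" if "0 \<le> t" "t \<le> 1" for t
      proof -
        have "norm (t *\<^sub>R c) \<le> norm c" using that by (simp add: mult_left_le_one_le)
        also have "norm c < min r r'" using y by (simp add: c_def dist_norm)
        finally show ?thesis by (simp add: dist_norm)
      qed
      have der: "((\<lambda>t. h (xs + t *\<^sub>R c)) has_real_derivative (c \<bullet> grad h (xs + t *\<^sub>R c))) (at t)" if "0 \<le> t" "t \<le> 1" for t
      proof -
        have "GDERIV h (xs + t *\<^sub>R c) :> grad h (xs + t *\<^sub>R c)"
          using inb[OF that] r' by (intro GDERIV_grad diff) auto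
        then have hd: "(h has_derivative (\<lambda>v. v \<bullet> grad h (xs + t *\<^sub>R c))) (at (xs + t *\<^sub>R c))" by (simp add: gderiv_def)
        have "((\<lambda>t. xs + t *\<^sub>R c) has_derivative (\<lambda>s. s *\<^sub>R c)) (at t)" by (auto intro!: derivative_eq_intros)
        from has_derivative_compose[OF this hd] show ?thesis
          by (simp add: has_field_derivative_def mult_commute_abs)
      qed
      have nonneg: "0 \<le> c \<bullet> grad h (xs + t *\<^sub>R c)" if t: "0 \<le> t" "t \<le> 1" for t
      proof -
        have "c \<bullet> grad h xs = 0"
          using gradient_on_subspace[OF g0 GDERIV_grad[OF diff[OF S(2)]] C xC c] by (simp add: inner_commute)
        moreover have "norm (grad h (xs + t *\<^sub>R c) - grad h xs - H (t *\<^sub>R c)) \<le> lam * norm (t *\<^sub>R c)"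
          using r(2)[of "xs + t *\<^sub>R c" xs] inb[OF t] r(1) by simp
        then have "\<bar>c \<bullet> (grad h (xs + t *\<^sub>R c) - grad h xs - H (t *\<^sub>R c))\<bar> \<le> norm c * (lam * norm (t *\<^sub>R c))"
          using order_trans[OF Cauchy_Schwarz_ineq2 mult_left_mono[OF _ norm_ge_zero]] by blast
        moreover have "norm c * (lam * norm (t *\<^sub>R c)) \<le> c \<bullet> H (t *\<^sub>R c)"
          using mult_left_mono[OF coer[OF c] t(1)] t by (simp add: linear_scale[OF linH] power2_eq_square mult_ac)
        ultimately show ?thesis by (simp add: inner_diff_right)
      qed
      have "h (xs + 0 *\<^sub>R c) \<le> h (xs + 1 *\<^sub>R c)"
        by (rule DERIV_nonneg_imp_nondecreasing[of 0 1 "\<lambda>t. h (xs + t *\<^sub>R c)"]) (use der nonneg in auto)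
      then show ?thesis by (simp add: c_def)
    qed
    then have "\<forall>\<^sub>F y in at xs within C. h xs \<le> h y"
      unfolding eventually_at using r(1) r'(1) by (intro exI[of _ "min r r'"]) auto
    then show False using nmin by blast
  qed
qed

section \<open>Decay of the Lyapunov function\<close>

text \<open>The two copies are the coordinates of the product space. The recursion is available only
  while both stay in \<open>al\<close>; as \<open>al\<close> shrinks and the Lyapunov function is
  positive, pairs that leave are simply dropped. A single copy has moment constant
  \<open>B / 4\<close> so that the difference has \<open>B\<close>.\<close>

lemma (in rates) product_decay:
  fixes P :: "'w measure" and x N :: "nat \<Rightarrow> 'w \<Rightarrow> 'a::euclidean_space" and f :: "nat \<Rightarrow> 'a \<Rightarrow> 'a" and Pm :: "'a \<Rightarrow> 'a"
  assumes P: "prob_space P" and sub: "subalgebra P (F k)" and xm: "x k \<in> borel_measurable (F k)"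
    and al: "al k \<in> sets (F k)" "al (Suc k) \<in> sets P" "al (Suc k) \<subseteq> al k"
    and dyn: "\<And>w. w \<in> al k \<Longrightarrow> x (Suc k) w = x k w - \<alpha> k *\<^sub>R (f k (x k w) + N (Suc k) w)"
    and mf: "f k \<in> borel_measurable borel" and xm': "x (Suc k) \<in> borel_measurable P"
    and noise: "cond_noise P (F k) (N (Suc k)) e (B / 4) c1"
    and Pm: "linear Pm" "\<And>x y. Pm x \<bullet> y = x \<bullet> Pm y" "\<And>x. Pm (Pm x) = Pm x"
    and e: "Pm e = e" "norm e = 1"
    and sg: "0 < \<sigma>" and ak: "0 < \<alpha> k"
    and drift: "\<And>w w'. w \<in> al k \<Longrightarrow> w' \<in> al k \<Longrightarrow> \<exists>z. drift_step (\<alpha> k)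
        (Pm ((x k w - x k w') /\<^sub>R \<sigma>)) ((x k w - x k w') /\<^sub>R \<sigma> - Pm ((x k w - x k w') /\<^sub>R \<sigma>)) z
        (Pm ((x k w - x k w') /\<^sub>R \<sigma> - (\<alpha> k / \<sigma>) *\<^sub>R (f k (x k w) - f k (x k w'))))
        (((x k w - x k w') /\<^sub>R \<sigma> - (\<alpha> k / \<sigma>) *\<^sub>R (f k (x k w) - f k (x k w')))
          - Pm ((x k w - x k w') /\<^sub>R \<sigma> - (\<alpha> k / \<sigma>) *\<^sub>R (f k (x k w) - f k (x k w'))))"
    and bd: "\<And>w w'. w \<in> al k \<Longrightarrow> w' \<in> al k \<Longrightarrow> norm (x k w - x k w') \<le> \<rho>"
    and b: "(\<alpha> k / \<sigma>)\<^sup>2 \<le> eps1 * \<alpha> k" "\<alpha> k / \<sigma> * M \<le> 1" "(\<alpha> k / \<sigma>)\<^sup>2 \<le> 1"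
  defines "d \<equiv> \<lambda>j z. (x j (fst z) - x j (snd z)) /\<^sub>R \<sigma>"
  defines "V \<equiv> \<lambda>j. \<integral>z. indicator (al j \<times> al j) z * lyapunov (Pm (d j z)) (d j z - Pm (d j z)) \<partial>(P \<Otimes>\<^sub>M P)"
  shows "integrable (P \<Otimes>\<^sub>M P) (\<lambda>z. indicator (al (Suc k) \<times> al (Suc k)) z * lyapunov (Pm (d (Suc k) z)) (d (Suc k) z - Pm (d (Suc k) z)))"
    and "V (Suc k) \<le> (1 - g * (\<alpha> k / \<sigma>)\<^sup>2) * V k"
proof -
  interpret P: prob_space P by fact
  interpret PP: pair_prob_space P P by standard
  define n where "n z = N (Suc k) (fst z) - N (Suc k) (snd z)" for z
  have cn: "cond_noise (P \<Otimes>\<^sub>M P) (F k \<Otimes>\<^sub>M F k) n e B c1"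
    using cond_noise_pair[OF P sub noise] by (simp add: n_def[abs_def])
  have mPm [measurable]: "Pm \<in> borel_measurable borel"
    using Pm(1) by (auto intro!: borel_measurable_continuous_onI linear_continuous_on linear_conv_bounded_linear[THEN iffD1])
  note [measurable] = xm mf
  define d1 where "d1 z = d k z - (\<alpha> k / \<sigma>) *\<^sub>R (f k (x k (fst z)) - f k (x k (snd z)))" for z
  have md [measurable]: "d k \<in> borel_measurable (F k \<Otimes>\<^sub>M F k)" unfolding d_def by measurable
  have md1 [measurable]: "d1 \<in> borel_measurable (F k \<Otimes>\<^sub>M F k)" unfolding d1_def by measurable
  define A where "A = al k \<times> al k"
  have A: "A \<in> sets (F k \<Otimes>\<^sub>M F k)" using al by (simp add: A_def)
  have "\<forall>w. \<exists>z. w \<in> A \<longrightarrow> drift_step (\<alpha> k) (Pm (d k w)) (d k w - Pm (d k w)) z (Pm (d1 w)) (d1 w - Pm (d1 w))"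
    using drift by (auto simp: A_def d_def d1_def)
  then obtain z where z: "\<And>w. w \<in> A \<Longrightarrow> drift_step (\<alpha> k) (Pm (d k w)) (d k w - Pm (d k w)) (z w) (Pm (d1 w)) (d1 w - Pm (d1 w))"
    by metis
  have Pn: "(norm (Pm v))\<^sup>2 + (norm (v - Pm v))\<^sup>2 = (norm v)\<^sup>2" for v
  proof -
    have "v \<bullet> Pm v = Pm v \<bullet> Pm v" "Pm v \<bullet> v = Pm v \<bullet> Pm v" by (simp_all add: Pm(2,3))
    then show ?thesis unfolding power2_norm_eq_inner by (simp add: inner_diff)
  qed
  have Pn1: "norm (Pm v) \<le> norm v" "norm (v - Pm v) \<le> norm v" for v
  proof -
    have "(norm (Pm v))\<^sup>2 \<le> (norm v)\<^sup>2" "(norm (v - Pm v))\<^sup>2 \<le> (norm v)\<^sup>2"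
      using Pn[of v] zero_le_power2[of "norm (Pm v)"] zero_le_power2[of "norm (v - Pm v)"] by linarith+
    then show "norm (Pm v) \<le> norm v" "norm (v - Pm v) \<le> norm v" by auto
  qed
  define D where "D = \<bar>\<rho>\<bar> / \<sigma>"
  \<comment> \<open>Any finite bound for the state after the noise-free step will do; this one is
    read off from the growth estimates in \<open>drift_step\<close>.\<close>
  define X where "X = 2 * (\<alpha> k * L) + \<alpha> k * del"
  define K where "K = D * (1 + X)"
  have D: "0 \<le> D" and X: "0 \<le> X" using sg ak L del by (auto simp: D_def X_def)
  have K: "D \<le> K" "0 \<le> K" "D\<^sup>2 * (1 + X) \<le> K\<^sup>2"
  proof -
    show "D \<le> K" "0 \<le> K" using D X by (auto simp: K_def mult_le_cancel_left1)
    have "(1 + X) * 1 \<le> (1 + X) * (1 + X)" using X by (intro mult_left_mono) auto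
    then show "D\<^sup>2 * (1 + X) \<le> K\<^sup>2" unfolding K_def power_mult_distrib
      by (intro mult_left_mono) (auto simp: power2_eq_square)
  qed
  have dD: "norm (d k w) \<le> D" if w: "w \<in> A" for w
  proof -
    have "norm (d k w) = norm (x k (fst w) - x k (snd w)) / \<sigma>" using sg by (simp add: d_def divide_inverse mult.commute)
    also have "\<dots> \<le> \<bar>\<rho>\<bar> / \<sigma>" using w bd[of "fst w" "snd w"] sg by (intro divide_right_mono) (auto simp: A_def)
    finally show ?thesis by (simp add: D_def)
  qed
  have bnds: "norm (Pm (d1 w)) \<le> K" "norm (d1 w - Pm (d1 w)) \<le> K" "norm (d k w - Pm (d k w)) \<le> K" if w: "w \<in> A" for w
  proof -
    define U S where "U = (norm (Pm (d k w)))\<^sup>2" and "S = (norm (d k w - Pm (d k w)))\<^sup>2"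
    have US: "U \<le> D\<^sup>2" "S \<le> D\<^sup>2" "0 \<le> U" "0 \<le> S"
      using dD[OF w] Pn1[of "d k w"] by (auto simp: U_def S_def intro!: power_mono)
    have st: "(norm (d1 w - Pm (d1 w)))\<^sup>2 \<le> (1 - \<alpha> k * lam) * S - \<alpha> k * Gam * (z w)\<^sup>2 + \<alpha> k * del * U"
      "(norm (Pm (d1 w)))\<^sup>2 \<le> U + \<alpha> k * L * (U + S)"
      using z[OF w] by (auto simp: drift_step_def U_def S_def)
    have aL: "\<alpha> k * L * (U + S) \<le> \<alpha> k * L * (D\<^sup>2 + D\<^sup>2)" using US ak L by (intro mult_left_mono) auto
    have ad: "\<alpha> k * del * U \<le> \<alpha> k * del * D\<^sup>2" using US ak del by (intro mult_left_mono) auto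
    have "0 \<le> \<alpha> k * del * D\<^sup>2" "0 \<le> \<alpha> k * L * D\<^sup>2" using ak del L by auto
    have "(norm (Pm (d1 w)))\<^sup>2 \<le> D\<^sup>2 * (1 + X)"
      using st(2) aL US \<open>0 \<le> \<alpha> k * del * D\<^sup>2\<close> by (simp add: X_def algebra_simps)
    then have "(norm (Pm (d1 w)))\<^sup>2 \<le> K\<^sup>2" using K by linarith
    then show "norm (Pm (d1 w)) \<le> K" using K by (auto intro: power2_le_imp_le)
    have "0 \<le> \<alpha> k * lam * S" "0 \<le> \<alpha> k * Gam * (z w)\<^sup>2" using ak lam Gam US by auto
    then have "(norm (d1 w - Pm (d1 w)))\<^sup>2 \<le> D\<^sup>2 * (1 + X)"
      using st(1) ad US \<open>0 \<le> \<alpha> k * L * D\<^sup>2\<close> by (simp add: X_def algebra_simps)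
    then have "(norm (d1 w - Pm (d1 w)))\<^sup>2 \<le> K\<^sup>2" using K by linarith
    then show "norm (d1 w - Pm (d1 w)) \<le> K" using K by (auto intro: power2_le_imp_le)
    show "norm (d k w - Pm (d k w)) \<le> K" using dD[OF w] Pn1(2)[of "d k w"] K by linarith
  qed
  define t where "t = - (\<alpha> k / \<sigma>)"
  have t2: "t\<^sup>2 = (\<alpha> k / \<sigma>)\<^sup>2" by (simp add: t_def)
  have tM: "\<bar>t\<bar> * M \<le> 1" using b ak sg by (simp add: t_def)
  \<comment> \<open>Only the component along the unstable unit vector \<open>e\<close> is bounded
    below; since \<open>Pm e = e\<close>, it is a lower bound for the norm of the unstable part of
    the noise.\<close>
  define y where "y w = max 0 (n w \<bullet> e)" for w
  have yb: "0 \<le> y w" "y w \<le> norm (Pm (n w))" for w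
  proof -
    have "n w \<bullet> e = Pm (n w) \<bullet> e" by (simp add: Pm(2) e)
    also have "\<dots> \<le> norm (Pm (n w)) * norm e" by (rule norm_cauchy_schwarz)
    finally show "y w \<le> norm (Pm (n w))" by (simp add: y_def e)
  qed (simp add: y_def)
  have mn [measurable]: "n \<in> borel_measurable (P \<Otimes>\<^sub>M P)" using cn by (simp add: cond_noise_def)
  have my: "y \<in> borel_measurable (P \<Otimes>\<^sub>M P)" unfolding y_def by measurable
  have lPs: "linear (\<lambda>v. v - Pm v)" using Pm(1) by (auto simp: linear_iff algebra_simps)
  have aPs: "(v - Pm v) \<bullet> w = v \<bullet> (w - Pm w)" for v w by (simp add: inner_diff Pm(2))
  have mG: "(\<lambda>w. Pm (d k w)) \<in> borel_measurable (F k \<Otimes>\<^sub>M F k)" "(\<lambda>w. d k w - Pm (d k w)) \<in> borel_measurable (F k \<Otimes>\<^sub>M F k)"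
    "(\<lambda>w. Pm (d1 w)) \<in> borel_measurable (F k \<Otimes>\<^sub>M F k)" "(\<lambda>w. d1 w - Pm (d1 w)) \<in> borel_measurable (F k \<Otimes>\<^sub>M F k)"
    by measurable
  note step = expected_step[where Mm = "P \<Otimes>\<^sub>M P" and Gs = "F k \<Otimes>\<^sub>M F k" and u = "\<lambda>w. Pm (d k w)"
      and s = "\<lambda>w. d k w - Pm (d k w)" and ?u1.0 = "\<lambda>w. Pm (d1 w)" and ?s1.0 = "\<lambda>w. d1 w - Pm (d1 w)" and n = n and y = y and z = z
      and Pu = Pm and Ps = "\<lambda>v. v - Pm v" and al = A and t = t and b = "(\<alpha> k / \<sigma>)\<^sup>2" and a = "\<alpha> k" and K = K,
      OF PP.finite_measure_axioms subalgebra_pair[OF sub sub] mG mn my A z bnds Pm(1) lPs Pm(2) aPs eq_refl[OF Pn] t2 tM b(1,3) yb]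
  have N0: "integrable (P \<Otimes>\<^sub>M P) (\<lambda>w. (norm (n w))\<^sup>2)" using cn by (simp add: cond_noise_def)
  have N1: "(\<integral>w. G w * (n w \<bullet> i) \<partial>(P \<Otimes>\<^sub>M P)) = 0"
    if "G \<in> borel_measurable (F k \<Otimes>\<^sub>M F k)" "\<And>w. \<bar>G w\<bar> \<le> C" for G C i
    using cn that unfolding cond_noise_def by blast
  have N2: "(\<integral>w. G w * (norm (n w))\<^sup>2 \<partial>(P \<Otimes>\<^sub>M P)) \<le> B * (\<integral>w. G w \<partial>(P \<Otimes>\<^sub>M P))"
     "c1 * (\<integral>w. G w \<partial>(P \<Otimes>\<^sub>M P)) \<le> (\<integral>w. G w * y w \<partial>(P \<Otimes>\<^sub>M P))"
    if "G \<in> borel_measurable (F k \<Otimes>\<^sub>M F k)" "\<And>w. 0 \<le> G w" "\<And>w. G w \<le> C" for G C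
    using cn that unfolding cond_noise_def y_def by blast+
  define R where "R w = indicator A w * lyapunov (Pm (d1 w) + t *\<^sub>R Pm (n w)) ((d1 w - Pm (d1 w)) + t *\<^sub>R (n w - Pm (n w)))" for w
  have iR: "integrable (P \<Otimes>\<^sub>M P) R" unfolding R_def
    by (rule step(1), assumption, assumption, assumption, assumption, rule N0, rule N1, assumption, assumption,
        rule N2(1), assumption, assumption, assumption, rule N2(2), assumption, assumption, assumption)
  have VR: "(\<integral>w. R w \<partial>(P \<Otimes>\<^sub>M P)) \<le> (1 - g * (\<alpha> k / \<sigma>)\<^sup>2) * V k"
    unfolding R_def V_def A_def[symmetric]
    by (rule step(2), assumption, assumption, assumption, assumption, rule N0, rule N1, assumption, assumption,
        rule N2(1), assumption, assumption, assumption, rule N2(2), assumption, assumption, assumption)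
  have upd: "d (Suc k) w = d1 w + t *\<^sub>R n w" if w: "w \<in> A" for w
  proof -
    have "fst w \<in> al k" "snd w \<in> al k" using w by (auto simp: A_def)
    then show ?thesis using sg
      by (simp add: d_def d1_def n_def t_def dyn algebra_simps scaleR_add_right divide_inverse)
  qed
  define l :: "'w \<times> 'w \<Rightarrow> real" where "l w = indicator (al (Suc k) \<times> al (Suc k)) w * lyapunov (Pm (d (Suc k) w)) (d (Suc k) w - Pm (d (Suc k) w))" for w
  have le: "l w \<le> R w" and nn: "0 \<le> l w" for w
  proof -
    note Dp = less_imp_le[OF lyapunov_pos]
    show "0 \<le> l w" by (simp add: l_def indicator_def Dp)
    show "l w \<le> R w"
    proof (cases "w \<in> A")
      case True
      have "R w = lyapunov (Pm (d (Suc k) w)) (d (Suc k) w - Pm (d (Suc k) w))"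
        using True unfolding R_def upd[OF True]
        by (simp add: linear_add[OF Pm(1)] linear_scale[OF Pm(1)] algebra_simps)
      then show ?thesis by (simp add: l_def indicator_def Dp)
    next
      case False
      then have "w \<notin> al (Suc k) \<times> al (Suc k)" using al(3) by (auto simp: A_def)
      then show ?thesis using False by (simp add: R_def l_def)
    qed
  qed
  have il: "integrable (P \<Otimes>\<^sub>M P) l"
  proof (rule Bochner_Integration.integrable_bound[OF iR])
    note [measurable] = xm' al(2)
    have [measurable]: "d (Suc k) \<in> borel_measurable (P \<Otimes>\<^sub>M P)" unfolding d_def by measurable
    show "l \<in> borel_measurable (P \<Otimes>\<^sub>M P)" unfolding l_def lyapunov_def by measurable
    show "AE w in P \<Otimes>\<^sub>M P. norm (l w) \<le> norm (R w)" using le nn by (intro AE_I2) (smt (verit) real_norm_def)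
  qed
  show "integrable (P \<Otimes>\<^sub>M P) (\<lambda>z. indicator (al (Suc k) \<times> al (Suc k)) z * lyapunov (Pm (d (Suc k) z)) (d (Suc k) z - Pm (d (Suc k) z)))"
    using il by (simp add: l_def[abs_def])
  have "V (Suc k) \<le> (\<integral>w. R w \<partial>(P \<Otimes>\<^sub>M P))"
    unfolding V_def l_def[symmetric] by (rule integral_mono[OF il iR le])
  then show "V (Suc k) \<le> (1 - g * (\<alpha> k / \<sigma>)\<^sup>2) * V k" using VR by linarith
qed

text \<open>The last claim rests on \<open>ta \<le> 1\<close>: the terms with indices from
  \<open>n\<close> to \<open>2 * n - 1\<close> alone sum to order
  \<open>n powr (1 - 2 * ta)\<close>, which dominates \<open>n powr (- ta)\<close>. Summability of
  the squares uses \<open>2 * ta > 1\<close>, and the product \<open>\<alpha> k * \<gamma> k\<close>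
  vanishes in the limit because \<open>tg < ta\<close>.\<close>

lemma theta_growth_rates:
  fixes \<alpha> \<gamma> :: "nat \<Rightarrow> real"
  assumes ta: "theta_growth \<alpha> (\<lambda>k. real k powr (- ta))" and tg: "theta_growth \<gamma> (\<lambda>k. real k powr tg)"
    and t: "1 / 2 < tg" "tg < ta" "ta \<le> 1"
  shows "\<forall>\<^sub>F k in sequentially. 0 < \<alpha> k" "\<alpha> \<longlonglongrightarrow> 0" "\<forall>\<^sub>F k in sequentially. 0 < \<gamma> k"
    "(\<lambda>k. \<alpha> k * \<gamma> k) \<longlonglongrightarrow> 0" "filterlim \<gamma> at_top sequentially" "summable (\<lambda>k. (\<alpha> k)\<^sup>2)"
    "\<exists>C>0. \<forall>\<^sub>F n in sequentially. \<forall>k\<ge>n. \<alpha> k \<le> C * (\<Sum>j. (\<alpha> (j + n))\<^sup>2)"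
proof -
  obtain a b where ab: "0 < a" "0 < b" "\<forall>\<^sub>F k in sequentially. a * real k powr (- ta) \<le> \<alpha> k \<and> \<alpha> k \<le> b * real k powr (- ta)"
    using ta by (auto simp: theta_growth_def)
  obtain a' b' where ab': "0 < a'" "0 < b'" "\<forall>\<^sub>F k in sequentially. a' * real k powr tg \<le> \<gamma> k \<and> \<gamma> k \<le> b' * real k powr tg"
    using tg by (auto simp: theta_growth_def)
  have k1: "\<forall>\<^sub>F k::nat in sequentially. 1 \<le> k" by (rule eventually_ge_at_top)
  show pos: "\<forall>\<^sub>F k in sequentially. 0 < \<alpha> k"
    using ab(3) k1
  proof eventually_elim
    case (elim k)
    have "0 < a * real k powr (- ta)" using ab elim by simp
    then show ?case using elim by linarith
  qed
  show pos': "\<forall>\<^sub>F k in sequentially. 0 < \<gamma> k"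
    using ab'(3) k1
  proof eventually_elim
    case (elim k)
    have "0 < a' * real k powr tg" using ab' elim by simp
    then show ?case using elim by linarith
  qed
  have null: "(\<lambda>k. c * real k powr (- s)) \<longlonglongrightarrow> 0" if "0 < s" for c s
    using tendsto_mult_right_zero[OF tendsto_neg_powr[of "- s" real sequentially]] that filterlim_real_sequentially by simp
  show "\<alpha> \<longlonglongrightarrow> 0"
  proof (rule real_tendsto_sandwich[of "\<lambda>_. 0" \<alpha> sequentially "\<lambda>k. b * real k powr (- ta)"])
    show "\<forall>\<^sub>F k in sequentially. 0 \<le> \<alpha> k" using pos by eventually_elim simp
    show "\<forall>\<^sub>F k in sequentially. \<alpha> k \<le> b * real k powr (- ta)" using ab(3) by eventually_elim simp
    show "(\<lambda>k. b * real k powr (- ta)) \<longlonglongrightarrow> 0" by (rule null) (use t in linarith)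
  qed simp
  have up: "\<forall>\<^sub>F k in sequentially. \<alpha> k * \<gamma> k \<le> (b * b') * real k powr (- (ta - tg))"
    using ab(3) ab'(3) pos pos'
  proof eventually_elim
    case (elim k)
    then have "\<alpha> k * \<gamma> k \<le> (b * real k powr (- ta)) * (b' * real k powr tg)" using ab by (intro mult_mono) auto
    also have "\<dots> = (b * b') * (real k powr (- ta) * real k powr tg)" by simp
    also have "real k powr (- ta) * real k powr tg = real k powr (- (ta - tg))" by (simp add: powr_add[symmetric])
    finally show ?case .
  qed
  show "(\<lambda>k. \<alpha> k * \<gamma> k) \<longlonglongrightarrow> 0"
  proof (rule real_tendsto_sandwich[OF _ up])
    show "\<forall>\<^sub>F k in sequentially. 0 \<le> \<alpha> k * \<gamma> k" using pos pos' by eventually_elim simp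
    show "(\<lambda>k. (b * b') * real k powr (- (ta - tg))) \<longlonglongrightarrow> 0" by (rule null) (use t in linarith)
  qed simp
  have "filterlim (\<lambda>k. real k powr tg) at_top sequentially"
  proof -
    have "(\<lambda>k. real k powr (- tg)) \<longlonglongrightarrow> 0" using null[of tg 1] t by simp
    moreover have "\<forall>\<^sub>F k in sequentially. 0 < real k powr (- tg)" using k1 by eventually_elim simp
    ultimately have "filterlim (\<lambda>k. inverse (real k powr (- tg))) at_top sequentially" by (rule filterlim_inverse_at_top)
    then show ?thesis by (simp add: powr_minus)
  qed
  then have "filterlim (\<lambda>k. a' * real k powr tg) at_top sequentially"
    by (rule filterlim_tendsto_pos_mult_at_top[OF tendsto_const ab'(1)])
  then show "filterlim \<gamma> at_top sequentially"
  proof (rule filterlim_at_top_mono)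
    show "\<forall>\<^sub>F k in sequentially. a' * real k powr tg \<le> \<gamma> k" using ab'(3) by eventually_elim simp
  qed
  have sq: "(y powr (- ta))\<^sup>2 = y powr (- 2 * ta)" for y :: real
    by (simp add: power2_eq_square powr_add[symmetric])
  have "summable (\<lambda>k. b\<^sup>2 * real k powr (- 2 * ta))"
    using t by (intro summable_mult) (simp add: summable_real_powr_iff)
  moreover have "\<forall>\<^sub>F k in sequentially. norm ((\<alpha> k)\<^sup>2) \<le> b\<^sup>2 * real k powr (- 2 * ta)"
    using ab(3) pos
  proof eventually_elim
    case (elim k)
    then have "(\<alpha> k)\<^sup>2 \<le> (b * real k powr (- ta))\<^sup>2" by (intro power_mono) auto
    then show ?case by (simp add: power_mult_distrib sq)
  qed
  ultimately show summ: "summable (\<lambda>k. (\<alpha> k)\<^sup>2)" by (rule summable_comparison_test_ev[rotated])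
  \<comment> \<open>The base 2 stems from estimating the indices \<open>j + n\<close> with
    \<open>j < n\<close> by \<open>2 * n\<close>.\<close>
  define C where "C = b / (a\<^sup>2 * 2 powr (- 2 * ta))"
  have C: "0 < C" using ab by (simp add: C_def)
  obtain n0 where n0: "\<And>k. n0 \<le> k \<Longrightarrow> a * real k powr (- ta) \<le> \<alpha> k \<and> \<alpha> k \<le> b * real k powr (- ta)"
    using ab(3) by (auto simp: eventually_sequentially)
  have "\<alpha> k \<le> C * (\<Sum>j. (\<alpha> (j + n))\<^sup>2)" if n: "max 1 n0 \<le> n" "n \<le> k" for n k
  proof -
    have npos: "1 \<le> real n" using n by simp
    have "\<alpha> k \<le> b * real k powr (- ta)" using n0[of k] n by auto
    also have "\<dots> \<le> b * real n powr (- ta)" using ab t n npos by (intro mult_left_mono powr_mono2') auto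
    also have "\<dots> \<le> b * real n powr (1 - 2 * ta)" using ab t npos by (intro mult_left_mono powr_mono) auto
    also have "\<dots> = C * (real n * (a\<^sup>2 * (2 * real n) powr (- 2 * ta)))"
    proof -
      have "real n powr (1 - 2 * ta) = real n * real n powr (- 2 * ta)"
        using npos powr_add[of "real n" 1 "- 2 * ta"] by simp
      moreover have "(2 * real n) powr (- 2 * ta) = 2 powr (- 2 * ta) * real n powr (- 2 * ta)"
        using npos by (simp add: powr_mult)
      ultimately show ?thesis using ab by (simp add: C_def)
    qed
    also have "real n * (a\<^sup>2 * (2 * real n) powr (- 2 * ta)) = (\<Sum>j<n. a\<^sup>2 * (2 * real n) powr (- 2 * ta))" by simp
    also have "\<dots> \<le> (\<Sum>j<n. (\<alpha> (j + n))\<^sup>2)"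
    proof (rule sum_mono)
      fix j assume j: "j \<in> {..<n}"
      have "a * (2 * real n) powr (- ta) \<le> a * real (j + n) powr (- ta)"
        using j ab t npos by (intro mult_left_mono powr_mono2') auto
      also have "\<dots> \<le> \<alpha> (j + n)" using n0[of "j + n"] n by auto
      finally have "(a * (2 * real n) powr (- ta))\<^sup>2 \<le> (\<alpha> (j + n))\<^sup>2" using ab by (intro power_mono) auto
      then show "a\<^sup>2 * (2 * real n) powr (- 2 * ta) \<le> (\<alpha> (j + n))\<^sup>2"
        by (simp only: power_mult_distrib sq)
    qed
    also have "\<dots> \<le> (\<Sum>j. (\<alpha> (j + n))\<^sup>2)"
      using summable_ignore_initial_segment[OF summ, of n] by (intro sum_le_suminf) auto
    finally show ?thesis using C by (simp add: mult_left_mono)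
  qed
  then show "\<exists>C>0. \<forall>\<^sub>F n in sequentially. \<forall>k\<ge>n. \<alpha> k \<le> C * (\<Sum>j. (\<alpha> (j + n))\<^sup>2)"
    using C by (intro exI[of _ C] conjI eventually_sequentiallyI[of "max 1 n0"]) auto
qed

text \<open>Apart from the defining equations, every constraint bounds a constant from above by
  quantities fixed before it, except that \<open>Gam\<close> is bounded from below; so minima and
  one maximum suffice.\<close>

lemma rates_exist:
  assumes pos: "0 < lam" "0 < L" "0 < B" "0 < c1"
  shows "\<exists>M r0 kap nu eta c2 eps1 g del Gam. rates lam L B c1 M r0 kap nu eta c2 eps1 g del Gam"
proof -
  define r0 where "r0 = min (1/2) (c1\<^sup>2 / (128 * 15 * B))"
  define kap where "kap = min 1 (c1\<^sup>2 / (256 * B))"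
  define nu where "nu = min (1/4) (min (kap * lam / (2 * L)) ((lam / (4 * L))\<^sup>2))"
  define eta where "eta = lam * r0\<^sup>2 / (34 * (1 + r0\<^sup>2))"
  define c2 where "c2 = lam * sqrt kap / 128"
  define g where "g = c1\<^sup>2 / 128"
  have p1: "0 < r0" "0 < kap" using pos by (auto simp: r0_def kap_def)
  have p2: "0 < nu" "0 < c2" "0 < g" using pos p1 by (auto simp: nu_def c2_def g_def)
  have p3: "0 < eta" using pos p1 by (auto simp: eta_def intro!: divide_pos_pos mult_pos_pos add_pos_nonneg)
  define eps1 where "eps1 = min (min (lam / 2 / g) (eta / 4 / (3 * B + g))) (min (c2 / 4 / (B * 9)) (c2 / 4 / g))"
  have p4: "0 < eps1" using pos p2 p3 by (auto simp: eps1_def)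
  define del where "del = min (min (lam / 2400 / kap) (lam * sqrt (kap / 2))) (min (sqrt nu * lam / 4 / kap) c2)"
  have p5: "0 < del" using pos p1 p2 by (auto simp: del_def)
  define Gam where "Gam = max 1 (max (L\<^sup>2 / (lam * kap)) (L\<^sup>2 / (2 * kap * del)))"
  have mv: "x * y \<le> z" if "x \<le> z / y" "0 < y" for x y z :: real using that by (simp add: pos_le_divide_eq)
  have mv': "z \<le> y * x" if "z / y \<le> x" "0 < y" for x y z :: real using that by (simp add: pos_divide_le_eq mult.commute)
  have q: "r0 \<le> 1/2" "kap \<le> 1" "nu \<le> 1/4" "del \<le> c2" "0 < Gam"
    unfolding r0_def kap_def nu_def del_def Gam_def by (auto intro: min.coboundedI2 simp only: min.cobounded1 max.strict_coboundedI1 zero_less_one)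
  have "rates lam L B c1 (B / c1) r0 kap nu eta c2 eps1 g del Gam"
  proof
    have "r0 * (15 * B) \<le> c1\<^sup>2 / 128" using pos by (intro mv) (auto simp: r0_def)
    then show "15 * r0 * B \<le> c1\<^sup>2 / 128" by (simp add: mult_ac)
    show "kap * B \<le> c1\<^sup>2 / 256" using pos by (intro mv) (auto simp: kap_def)
    have "nu * (2 * L) \<le> kap * lam" using pos by (intro mv) (auto simp: nu_def)
    then show "2 * nu * L \<le> kap * lam" by (simp add: mult_ac)
    have "sqrt nu \<le> sqrt ((lam / (4 * L))\<^sup>2)" by (intro real_sqrt_le_mono) (simp add: nu_def)
    also have "\<dots> = lam / (4 * L)" using pos by simp
    finally have "sqrt nu * L \<le> lam / (4 * L) * L" using pos by (intro mult_right_mono) auto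
    then show "sqrt nu * L \<le> lam / 4" using pos by simp
    show "eps1 * g \<le> lam / 2" "eps1 * g \<le> c2 / 4" using p2 by (auto intro!: mv simp: eps1_def)
    show "eps1 * (3 * B + g) \<le> eta / 4" using pos p2 by (intro mv) (auto simp: eps1_def)
    have "eps1 * (B * 9) \<le> c2 / 4" using pos p2 by (intro mv) (auto simp: eps1_def)
    then show "eps1 * B * 9 \<le> c2 / 4" by (simp add: mult_ac)
    have "del * kap \<le> lam / 2400" "del * kap \<le> sqrt nu * lam / 4" using p1 by (auto intro!: mv simp: del_def)
    then show "kap * del \<le> lam / 2400" "kap * del \<le> sqrt nu * lam / 4" by (simp_all add: mult_ac)
    have "del\<^sup>2 \<le> (lam * sqrt (kap / 2))\<^sup>2" using p5 by (intro power_mono) (auto simp: del_def)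
    then show "2 * del\<^sup>2 \<le> kap * lam\<^sup>2" using p1 by (simp add: power_mult_distrib mult_ac)
    have "L\<^sup>2 \<le> (lam * kap) * Gam" "L\<^sup>2 \<le> (2 * kap * del) * Gam" using p1 p5 pos by (auto intro!: mv' simp: Gam_def)
    then show "L\<^sup>2 \<le> lam * kap * Gam" "L\<^sup>2 \<le> 2 * kap * Gam * del" by (simp_all add: mult_ac)
  qed (fact pos p1 p2 p3 p4 p5 q eta_def c2_def g_def | rule refl)+
  then show ?thesis by blast
qed

text \<open>At time \<open>n\<close> the copies are within \<open>r\<close> of each other, so the
  Lyapunov function is at most \<open>1 + p\<close>. On \<open>E\<close> both copies converge and it
  tends to 1. In between its integral has lost the factor \<open>exp (- g * s)\<close>, which limits
  the mass of \<open>E \<times> E\<close>.\<close>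

lemma (in rates) probability_bound:
  fixes P :: "'w measure" and x :: "nat \<Rightarrow> 'w \<Rightarrow> 'a::euclidean_space" and Pm :: "'a \<Rightarrow> 'a"
  defines "d \<equiv> \<lambda>\<sigma> j z. (x j (fst z) - x j (snd z)) /\<^sub>R \<sigma>"
  defines "I \<equiv> \<lambda>\<sigma> al j z. indicator (al j \<times> al j) z * lyapunov (Pm (d \<sigma> j z)) (d \<sigma> j z - Pm (d \<sigma> j z))"
  assumes P: "prob_space P" and al: "al n \<in> sets P" and E: "E \<in> sets P" "\<And>k. n \<le> k \<Longrightarrow> E \<subseteq> al k"
    and xm: "\<And>k. n \<le> k \<Longrightarrow> x k \<in> borel_measurable P"
    and conv: "\<And>w. w \<in> E \<Longrightarrow> (\<lambda>k. x k w) \<longlonglongrightarrow> xs"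
    and Pm: "linear Pm" "\<And>v. norm (v - Pm v) \<le> norm v"
    and sg: "0 < \<sigma>" and r: "\<And>w w'. w \<in> al n \<Longrightarrow> w' \<in> al n \<Longrightarrow> norm (x n w - x n w') \<le> r" "kap * (r / \<sigma>)\<^sup>2 \<le> p"
    and step: "\<And>k. n \<le> k \<Longrightarrow> integrable (P \<Otimes>\<^sub>M P) (I \<sigma> al (Suc k))"
      "\<And>k. n \<le> k \<Longrightarrow> (\<integral>z. I \<sigma> al (Suc k) z \<partial>(P \<Otimes>\<^sub>M P)) \<le> (1 - g * (\<alpha> k / \<sigma>)\<^sup>2) * (\<integral>z. I \<sigma> al k z \<partial>(P \<Otimes>\<^sub>M P))"
    and s: "(\<lambda>j. (\<alpha> (j + n) / \<sigma>)\<^sup>2) sums s"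
  shows "(measure P E)\<^sup>2 \<le> exp (- g * s) * ((1 + p) * (measure P (al n))\<^sup>2)"
proof -
  interpret P: prob_space P by fact
  interpret PP: pair_prob_space P P by standard
  have mt: "measure (P \<Otimes>\<^sub>M P) (A \<times> A) = (measure P A)\<^sup>2" if "A \<in> sets P" for A
    using P.emeasure_pair_measure_Times[OF that that] by (simp add: measure_def enn2real_mult power2_eq_square)
  define V where "V k = (\<integral>z. I \<sigma> al k z \<partial>(P \<Otimes>\<^sub>M P))" for k
  have I0: "0 \<le> I \<sigma> al k z" for k z by (simp add: I_def less_imp_le[OF lyapunov_pos])
  have V0: "0 \<le> V k" for k unfolding V_def by (intro integral_nonneg_AE AE_I2 I0)
  have p0: "0 \<le> p" using r(2) kap by (smt (verit) mult_nonneg_nonneg zero_le_power2)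
  have Vn: "V n \<le> (1 + p) * (measure P (al n))\<^sup>2"
  proof -
    have "V n \<le> (\<integral>z. (1 + p) * indicator (al n \<times> al n) z \<partial>(P \<Otimes>\<^sub>M P))"
      unfolding V_def
    proof (rule integral_mono')
      show "integrable (P \<Otimes>\<^sub>M P) (\<lambda>z. (1 + p) * indicator (al n \<times> al n) z)"
        using al by (intro integrable_mult_right integrable_real_indicator) (auto simp: PP.emeasure_finite less_top[symmetric])
      fix z
      show "I \<sigma> al n z \<le> (1 + p) * indicator (al n \<times> al n) z"
      proof (cases "z \<in> al n \<times> al n")
        case True
        have "norm (d \<sigma> n z) \<le> r / \<sigma>"
          using r(1)[of "fst z" "snd z"] True sg by (auto simp: d_def divide_inverse mult.commute)
        then have "norm (d \<sigma> n z - Pm (d \<sigma> n z)) \<le> r / \<sigma>" using Pm(2) order_trans by blast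
        then have "kap * (norm (d \<sigma> n z - Pm (d \<sigma> n z)))\<^sup>2 \<le> kap * (r / \<sigma>)\<^sup>2"
          using kap by (intro mult_left_mono power_mono) auto
        then show ?thesis using D1_le[of "Pm (d \<sigma> n z)" "d \<sigma> n z - Pm (d \<sigma> n z)"] r(2) True
          by (simp add: I_def lyapunov_def)
      qed (simp add: I_def)
      show "0 \<le> (1 + p) * indicator (al n \<times> al n) z" using p0 by simp
    qed
    also have "\<dots> = (1 + p) * (measure P (al n))\<^sup>2"
      using al mt[OF al] by simp
    finally show ?thesis .
  qed
  have Vm: "V (m + n) \<le> exp (- g * (\<Sum>j<m. (\<alpha> (j + n) / \<sigma>)\<^sup>2)) * V n" for m
  proof (induction m)
    case (Suc m)
    have "V (Suc m + n) \<le> (1 - g * (\<alpha> (m + n) / \<sigma>)\<^sup>2) * V (m + n)"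
      using step(2)[of "m + n"] by (simp add: V_def)
    also have "\<dots> \<le> exp (- g * (\<alpha> (m + n) / \<sigma>)\<^sup>2) * V (m + n)"
      using exp_ge_add_one_self[of "- g * (\<alpha> (m + n) / \<sigma>)\<^sup>2"] V0 by (intro mult_right_mono) auto
    also have "\<dots> \<le> exp (- g * (\<alpha> (m + n) / \<sigma>)\<^sup>2) * (exp (- g * (\<Sum>j<m. (\<alpha> (j + n) / \<sigma>)\<^sup>2)) * V n)"
      by (intro mult_left_mono Suc) auto
    also have "\<dots> = exp (- g * (\<Sum>j<Suc m. (\<alpha> (j + n) / \<sigma>)\<^sup>2)) * V n"
      by (simp add: exp_add[symmetric] mult.assoc[symmetric] algebra_simps)
    finally show ?case .
  qed simp
  \<comment> \<open>Truncation at 1 supplies a dominating function, and nothing is lost in the limit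
    because the Lyapunov function tends to 1 on \<open>E \<times> E\<close>.\<close>
  define c where "c m = (\<integral>z. indicator (E \<times> E) z * min 1 (lyapunov (Pm (d \<sigma> (m + n) z)) (d \<sigma> (m + n) z - Pm (d \<sigma> (m + n) z))) \<partial>(P \<Otimes>\<^sub>M P))" for m
  have [measurable]: "Pm \<in> borel_measurable borel"
    using Pm(1) by (auto intro!: borel_measurable_continuous_onI linear_continuous_on linear_conv_bounded_linear[THEN iffD1])
  have meas: "(\<lambda>z. indicator (E \<times> E) z * min 1 (lyapunov (Pm (d \<sigma> (m + n) z)) (d \<sigma> (m + n) z - Pm (d \<sigma> (m + n) z)))) \<in> borel_measurable (P \<Otimes>\<^sub>M P)" for m
  proof -
    note [measurable] = xm[of "m + n", simplified] E(1)
    have [measurable]: "d \<sigma> (m + n) \<in> borel_measurable (P \<Otimes>\<^sub>M P)" unfolding d_def by measurable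
    show ?thesis unfolding lyapunov_def by measurable
  qed
  have cl: "c \<longlonglongrightarrow> (\<integral>z. indicator (E \<times> E) z \<partial>(P \<Otimes>\<^sub>M P))"
    unfolding c_def
  proof (rule integral_dominated_convergence[where w = "\<lambda>_. 1"])
    show "AE z in P \<Otimes>\<^sub>M P. (\<lambda>m. indicator (E \<times> E) z * min 1 (lyapunov (Pm (d \<sigma> (m + n) z)) (d \<sigma> (m + n) z - Pm (d \<sigma> (m + n) z)))) \<longlonglongrightarrow> indicator (E \<times> E) z"
    proof (rule AE_I2)
      fix z
      show "(\<lambda>m. indicator (E \<times> E) z * min 1 (lyapunov (Pm (d \<sigma> (m + n) z)) (d \<sigma> (m + n) z - Pm (d \<sigma> (m + n) z)))) \<longlonglongrightarrow> (indicator (E \<times> E) z :: real)"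
      proof (cases "z \<in> E \<times> E")
        case True
        have "(\<lambda>k. d \<sigma> k z) \<longlonglongrightarrow> (xs - xs) /\<^sub>R \<sigma>"
          unfolding d_def using True by (intro tendsto_intros conv) auto
        then have "(\<lambda>k. d \<sigma> k z) \<longlonglongrightarrow> 0" by simp
        then have d0: "(\<lambda>m. d \<sigma> (m + n) z) \<longlonglongrightarrow> 0" by (rule LIMSEQ_ignore_initial_segment)
        define u where "u m = Pm (d \<sigma> (m + n) z)" for m
        define v where "v m = d \<sigma> (m + n) z - Pm (d \<sigma> (m + n) z)" for m
        have u0: "u \<longlonglongrightarrow> 0"
          using bounded_linear.tendsto[OF linear_conv_bounded_linear[THEN iffD1, OF Pm(1)] d0] linear_0[OF Pm(1)]
          by (simp add: u_def[abs_def])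
        have v0: "v \<longlonglongrightarrow> 0" using tendsto_diff[OF d0 u0] by (simp add: u_def v_def[abs_def])
        have D1l: "(\<lambda>m. D1 (u m) (v m)) \<longlonglongrightarrow> 1"
        proof -
          have "(\<lambda>m. D1 (u m) (v m)) \<longlonglongrightarrow> 1/2 + 1 / (1 + (norm (0::'a))\<^sup>2) / 2 + kap * (norm (0::'a))\<^sup>2"
            unfolding D1_def bump_def by (intro tendsto_intros u0 v0) auto
          then show ?thesis by simp
        qed
        have "(\<lambda>m. norm (u m)) \<longlonglongrightarrow> 0" using u0 by (simp add: tendsto_norm_zero_iff)
        then have "\<forall>\<^sub>F m in sequentially. norm (u m) < 1" by (rule order_tendstoD) simp
        \<comment> \<open>As \<open>rad\<close> is at least 1, \<open>norm (u m) < 1\<close> makes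
          the cone coordinate negative and \<open>D2\<close> at least 1; after truncation only the
          continuous profile \<open>D1\<close> remains.\<close>
        then have "\<forall>\<^sub>F m in sequentially. min 1 (D1 (u m) (v m)) = min 1 (lyapunov (u m) (v m))"
        proof eventually_elim
          case (elim m)
          have "norm (u m) - rad (u m) (v m) < 0" using elim rad_ge_1[of "u m" "v m"] by linarith
          then have "1 \<le> D2 (u m) (v m)" by (simp add: D2_def decay_def)
          then show ?case by (simp add: lyapunov_def)
        qed
        moreover have "(\<lambda>m. min 1 (D1 (u m) (v m))) \<longlonglongrightarrow> min 1 1" by (intro tendsto_min tendsto_const D1l)
        ultimately have "(\<lambda>m. min 1 (lyapunov (u m) (v m))) \<longlonglongrightarrow> 1" using Lim_transform_eventually by fastforce
        then show ?thesis using True by (simp add: u_def v_def)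
      qed simp
    qed
    show "AE z in P \<Otimes>\<^sub>M P. norm (indicator (E \<times> E) z * min 1 (lyapunov (Pm (d \<sigma> (m + n) z)) (d \<sigma> (m + n) z - Pm (d \<sigma> (m + n) z)))) \<le> 1" for m
      by (intro AE_I2) (auto simp: indicator_def min_def abs_of_pos lyapunov_pos)
  qed (use meas E in auto)
  have le: "c (Suc m) \<le> exp (- g * (\<Sum>j<Suc m. (\<alpha> (j + n) / \<sigma>)\<^sup>2)) * V n" for m
  proof -
    have "c (Suc m) \<le> V (Suc m + n)"
      unfolding c_def V_def
    proof (rule integral_mono')
      show "integrable (P \<Otimes>\<^sub>M P) (I \<sigma> al (Suc m + n))" using step(1)[of "m + n"] by simp
      fix z
      show "indicator (E \<times> E) z * min 1 (lyapunov (Pm (d \<sigma> (Suc m + n) z)) (d \<sigma> (Suc m + n) z - Pm (d \<sigma> (Suc m + n) z))) \<le> I \<sigma> al (Suc m + n) z"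
      proof (cases "z \<in> E \<times> E")
        case True
        then have "z \<in> al (Suc m + n) \<times> al (Suc m + n)" using E(2)[of "Suc m + n"] by auto
        then show ?thesis using True by (simp add: I_def)
      next
        case False
        then show ?thesis using I0[of "Suc m + n" z] by simp
      qed
    qed (rule I0)
    then show ?thesis using Vm[of "Suc m"] by simp
  qed
  have "(\<lambda>m. exp (- g * (\<Sum>j<m. (\<alpha> (j + n) / \<sigma>)\<^sup>2)) * V n) \<longlonglongrightarrow> exp (- g * s) * V n"
    using s unfolding sums_def by (intro tendsto_intros)
  then have "(\<integral>z. indicator (E \<times> E) z \<partial>(P \<Otimes>\<^sub>M P)) \<le> exp (- g * s) * V n"
    using LIMSEQ_le[OF LIMSEQ_Suc[OF cl] LIMSEQ_Suc] le by blast
  moreover have "(\<integral>z. indicator (E \<times> E) z \<partial>(P \<Otimes>\<^sub>M P)) = (measure P E)\<^sup>2" using E(1) mt[OF E(1)] by simp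
  moreover have "exp (- g * s) * V n \<le> exp (- g * s) * ((1 + p) * (measure P (al n))\<^sup>2)"
    by (rule mult_left_mono[OF Vn]) simp
  ultimately show ?thesis by linarith
qed

section \<open>From conditional expectations to weighted integrals\<close>

text \<open>Square integrability is a consequence here: the conditional expectation of a nonnegative
  function makes sense without it, and its bound with the constant weight 1 yields a finite second
  moment.\<close>

lemma cond_noise_from_conditional_moments:
  fixes \<xi> :: "'w \<Rightarrow> real^'m"
  assumes P: "prob_space P" and sub: "subalgebra P G" and m: "\<xi> \<in> borel_measurable P" and int: "integrable P \<xi>"
    and mean: "AE w in P. vec_cond_exp P G \<xi> w = 0"
    and second: "AE w in P. nn_cond_exp P G (\<lambda>w. ennreal ((norm (\<xi> w))\<^sup>2)) w < ennreal B" and B: "0 < B"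
    and exc: "AE w in P. c \<le> real_cond_exp P G (\<lambda>w. max 0 (\<xi> w \<bullet> \<theta>)) w"
  shows "cond_noise P G \<xi> \<theta> B c"
proof -
  interpret prob_space P by fact
  interpret finite_measure_subalgebra P G by (unfold_locales) (rule sub)
  note [measurable] = m
  have le: "(\<integral>\<^sup>+ w. ennreal (g w) * ennreal ((norm (\<xi> w))\<^sup>2) \<partial>P) \<le> ennreal B * (\<integral>\<^sup>+ w. ennreal (g w) \<partial>P)"
    if g: "g \<in> borel_measurable G" for g
  proof -
    have gP [measurable]: "g \<in> borel_measurable P" by (rule measurable_from_subalg[OF sub g])
    have gG [measurable]: "(\<lambda>w. ennreal (g w)) \<in> borel_measurable G" using g by measurable
    have "(\<integral>\<^sup>+ w. ennreal (g w) * ennreal ((norm (\<xi> w))\<^sup>2) \<partial>P) = (\<integral>\<^sup>+ w. ennreal (g w) * nn_cond_exp P G (\<lambda>w. ennreal ((norm (\<xi> w))\<^sup>2)) w \<partial>P)"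
      by (rule nn_cond_exp_intg[symmetric]) (use gG in measurable)
    also have "\<dots> \<le> (\<integral>\<^sup>+ w. ennreal B * ennreal (g w) \<partial>P)"
    proof (rule nn_integral_mono_AE)
      show "AE w in P. ennreal (g w) * nn_cond_exp P G (\<lambda>w. ennreal ((norm (\<xi> w))\<^sup>2)) w \<le> ennreal B * ennreal (g w)"
        using second by eventually_elim (metis less_imp_le mult.commute mult_left_mono zero_le)
    qed
    also have "\<dots> = ennreal B * (\<integral>\<^sup>+ w. ennreal (g w) \<partial>P)" by (intro nn_integral_cmult) measurable
    finally show ?thesis .
  qed
  have i2: "integrable P (\<lambda>w. (norm (\<xi> w))\<^sup>2)"
  proof (rule integrableI_nonneg)
    have "(\<integral>\<^sup>+ w. ennreal ((norm (\<xi> w))\<^sup>2) \<partial>P) \<le> ennreal B" using le[of "\<lambda>_. 1"] by (simp add: emeasure_space_1)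
    then show "(\<integral>\<^sup>+ w. ennreal ((norm (\<xi> w))\<^sup>2) \<partial>P) < \<infinity>" by (simp add: le_less_trans ennreal_less_top)
  qed auto
  have bdd: "integrable P (\<lambda>w. g w * f w)" if "g \<in> borel_measurable P" "\<And>w. \<bar>g w\<bar> \<le> K" "integrable P f" for g f :: "'w \<Rightarrow> real" and K
  proof (rule Bochner_Integration.integrable_bound[of _ "\<lambda>w. K * f w"])
    show "integrable P (\<lambda>w. K * f w)" using that by simp
    have "\<bar>g w * f w\<bar> \<le> \<bar>K * f w\<bar>" for w
      unfolding abs_mult using that(2)[of w] by (intro mult_right_mono) auto
    then show "AE w in P. norm (g w * f w) \<le> norm (K * f w)" by simp
    show "(\<lambda>w. g w * f w) \<in> borel_measurable P" using that by measurable
  qed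
  show ?thesis unfolding cond_noise_def
  proof (intro conjI allI impI m i2)
    fix g :: "'w \<Rightarrow> real" and K assume g: "g \<in> borel_measurable G"
    have gP [measurable]: "g \<in> borel_measurable P" by (rule measurable_from_subalg[OF sub g])
    { fix v assume b: "\<forall>w. \<bar>g w\<bar> \<le> K"
      have ci: "integrable P (\<lambda>w. \<xi> w $ i)" for i
        using integrable_bounded_linear[OF bounded_linear_vec_nth int] .
      have gi: "integrable P (\<lambda>w. g w * \<xi> w $ i)" for i using bdd[OF gP _ ci] b by blast
      have z: "(\<integral>w. g w * \<xi> w $ i \<partial>P) = 0" for i
      proof -
        have "(\<integral>w. g w * \<xi> w $ i \<partial>P) = (\<integral>w. g w * real_cond_exp P G (\<lambda>w. \<xi> w $ i) w \<partial>P)"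
          by (rule real_cond_exp_intg(2)[symmetric]) (use gi g ci in auto)
        also have "\<dots> = (\<integral>w. 0 \<partial>P)"
        proof (rule integral_cong_AE)
          show "(\<lambda>w. g w * real_cond_exp P G (\<lambda>w. \<xi> w $ i) w) \<in> borel_measurable P"
            using real_cond_exp_intg(1)[OF gi g] ci by auto
          show "AE w in P. g w * real_cond_exp P G (\<lambda>w. \<xi> w $ i) w = 0"
            using mean by eventually_elim (simp add: vec_cond_exp_def vec_eq_iff)
        qed simp
        finally show ?thesis by simp
      qed
      have "(\<integral>w. g w * (\<xi> w \<bullet> v) \<partial>P) = (\<integral>w. (\<Sum>i\<in>UNIV. v $ i * (g w * \<xi> w $ i)) \<partial>P)"
        by (simp add: inner_vec_def sum_distrib_left mult_ac)
      also have "\<dots> = (\<Sum>i\<in>UNIV. (\<integral>w. v $ i * (g w * \<xi> w $ i) \<partial>P))"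
        using gi by (intro Bochner_Integration.integral_sum) auto
      also have "\<dots> = 0" using z by simp
      finally show "(\<integral>w. g w * (\<xi> w \<bullet> v) \<partial>P) = 0" . }
    assume b: "\<forall>w. 0 \<le> g w \<and> g w \<le> K"
    have b': "\<And>w. \<bar>g w\<bar> \<le> K" "\<And>w. 0 \<le> g w" using b by auto
    have gi: "integrable P g" using bdd[OF gP b'(1), of "\<lambda>_. 1"] by simp
    have gn: "integrable P (\<lambda>w. g w * (norm (\<xi> w))\<^sup>2)" by (rule bdd[OF gP b'(1) i2])
    have "ennreal (\<integral>w. g w * (norm (\<xi> w))\<^sup>2 \<partial>P) = (\<integral>\<^sup>+ w. ennreal (g w) * ennreal ((norm (\<xi> w))\<^sup>2) \<partial>P)"
      using nn_integral_eq_integral[OF gn] b'(2) by (simp add: ennreal_mult)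
    also have "\<dots> \<le> ennreal B * (\<integral>\<^sup>+ w. ennreal (g w) \<partial>P)" by (rule le[OF g])
    also have "\<dots> = ennreal (B * (\<integral>w. g w \<partial>P))"
      using nn_integral_eq_integral[OF gi] b'(2) B by (simp add: ennreal_mult)
    finally show "(\<integral>w. g w * (norm (\<xi> w))\<^sup>2 \<partial>P) \<le> B * integral\<^sup>L P g"
      using B b'(2) by (subst (asm) ennreal_le_iff) (auto intro!: mult_nonneg_nonneg integral_nonneg_AE)
    have im: "integrable P (\<lambda>w. max 0 (\<xi> w \<bullet> \<theta>))"
    proof (rule Bochner_Integration.integrable_bound)
      show "integrable P (\<lambda>w. \<xi> w \<bullet> \<theta>)" using int by simp
    qed auto
    have gm: "integrable P (\<lambda>w. g w * max 0 (\<xi> w \<bullet> \<theta>))" by (rule bdd[OF gP b'(1) im])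
    note ri = real_cond_exp_intg_fpos[OF gm b'(2) g borel_measurable_integrable[OF im]]
    have "c * integral\<^sup>L P g = (\<integral>w. g w * c \<partial>P)" by simp
    also have "\<dots> \<le> (\<integral>w. g w * real_cond_exp P G (\<lambda>w. max 0 (\<xi> w \<bullet> \<theta>)) w \<partial>P)"
      using gi ri(1) exc b'(2) by (intro integral_mono_AE) (auto elim!: eventually_mono intro: mult_left_mono)
    finally show "c * integral\<^sup>L P g \<le> (\<integral>w. g w * max 0 (\<xi> w \<bullet> \<theta>) \<partial>P)" using ri(2) by simp
  qed
qed

section \<open>The filtration, the null space of the penalty and the convergence event\<close>

lemma history_facts:
  fixes x :: "nat \<Rightarrow> 'w \<Rightarrow> 'a::topological_space" and \<xi> :: "nat \<Rightarrow> 'w \<Rightarrow> 'b::topological_space"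
  assumes x: "\<And>k. k \<ge> 1 \<Longrightarrow> x k \<in> borel_measurable P" and \<xi>: "\<And>k. k \<ge> 1 \<Longrightarrow> \<xi> k \<in> borel_measurable P"
  shows "subalgebra P (history P x \<xi> k)" "m \<le> k \<Longrightarrow> sets (history P x \<xi> m) \<subseteq> sets (history P x \<xi> k)"
    "1 \<le> j \<Longrightarrow> j \<le> k \<Longrightarrow> x j \<in> borel_measurable (history P x \<xi> k)"
proof -
  define g where "g k = (\<Union>j\<in>{1..k}. {x j -` A \<inter> space P | A. A \<in> sets borel} \<union> {\<xi> j -` A \<inter> space P | A. A \<in> sets borel})" for k
  have gP: "g k \<subseteq> sets P" for k using x \<xi> by (auto simp: g_def intro: measurable_sets)
  have gpow: "g k \<subseteq> Pow (space P)" for k by (auto simp: g_def)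
  have h: "history P x \<xi> k = sigma (space P) (g k)" for k by (simp add: history_def g_def)
  have s: "sets (history P x \<xi> k) = sigma_sets (space P) (g k)" "space (history P x \<xi> k) = space P" for k
    unfolding h using gpow by (simp_all add: sets_measure_of space_measure_of)
  show "subalgebra P (history P x \<xi> k)"
    unfolding subalgebra_def s using sets.sigma_sets_subset[OF gP] by simp
  show "sets (history P x \<xi> m) \<subseteq> sets (history P x \<xi> k)" if "m \<le> k"
    unfolding s unfolding g_def using that by (intro sigma_sets_mono' UN_mono) auto
  show "x j \<in> borel_measurable (history P x \<xi> k)" if "1 \<le> j" "j \<le> k"
  proof (rule measurableI)
    fix A :: "'a set" assume "A \<in> sets borel"
    then have "x j -` A \<inter> space P \<in> g k" unfolding g_def using that by (intro UN_I[of j] UnI1) auto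
    then show "x j -` A \<inter> space (history P x \<xi> k) \<in> sets (history P x \<xi> k)" unfolding s by (rule sigma_sets.Basic)
  qed simp
qed

lemma psd_null_space:
  fixes Q :: "real^'m^'m"
  assumes psd: "positive_semidefinite Q"
  shows "(Q *v x) \<bullet> y = x \<bullet> (Q *v y)" "{y. y \<bullet> (Q *v y) = 0} = {y. Q *v y = 0}"
proof -
  have adj: "(Q *v x) \<bullet> y = x \<bullet> (Q *v y)" for x y
    using psd unfolding positive_semidefinite_def by (metis dot_lmul_matrix transpose_matrix_vector inner_commute)
  then show "(Q *v x) \<bullet> y = x \<bullet> (Q *v y)" .
  have "Q *v y = 0" if y: "y \<bullet> (Q *v y) = 0" for y
  proof -
    define z where "z = Q *v y"
    define c where "c = z \<bullet> z"
    define k where "k = z \<bullet> (Q *v z)"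
    have k: "0 \<le> k" using psd by (simp add: positive_semidefinite_def k_def)
    \<comment> \<open>For this \<open>t\<close> the quadratic form at
      \<open>y + t *\<^sub>R z\<close> would be negative unless \<open>c = 0\<close>; the summand 1
      avoids division by \<open>k = 0\<close>.\<close>
    define t where "t = - c / (k + 1)"
    have "0 \<le> (y + t *\<^sub>R z) \<bullet> (Q *v (y + t *\<^sub>R z))" using psd by (simp add: positive_semidefinite_def)
    also have "\<dots> = 2 * t * c + t * t * k"
    proof -
      have "y \<bullet> z = 0" using y by (simp add: z_def)
      moreover have "y \<bullet> (Q *v z) = c" by (simp add: adj[symmetric] z_def c_def)
      ultimately show ?thesis
        by (simp add: matrix_vector_right_distrib matrix_vector_mult_scaleR inner_add y z_def[symmetric] c_def[symmetric] k_def[symmetric] algebra_simps)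
    qed
    finally have "0 \<le> (2 * t * c + t * t * k) * (k + 1)\<^sup>2" by simp
    also have "\<dots> = - (c\<^sup>2 * (k + 2))"
    proof -
      have tk: "t * (k + 1) = - c" using k by (simp add: t_def)
      have "(2 * t * c + t * t * k) * (k + 1)\<^sup>2 = 2 * (t * (k + 1)) * c * (k + 1) + (t * (k + 1)) * (t * (k + 1)) * k"
        by (simp add: power2_eq_square algebra_simps)
      also have "\<dots> = - (c\<^sup>2 * (k + 2))" unfolding tk by (simp add: power2_eq_square algebra_simps)
      finally show ?thesis .
    qed
    finally have "c\<^sup>2 * (k + 2) \<le> 0" by simp
    then have "c\<^sup>2 = 0" using k zero_le_power2[of c] by (smt (verit) mult_pos_pos)
    then show ?thesis by (simp add: c_def z_def)
  qed
  then show "{y. y \<bullet> (Q *v y) = 0} = {y. Q *v y = 0}" by auto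
qed

text \<open>Convergence is a countable condition on the iterates from index 1 on. The shift by
  \<open>Suc\<close> leaves out \<open>x 0\<close>, about which nothing is assumed.\<close>

lemma convergence_set_measurable:
  fixes x :: "nat \<Rightarrow> 'w \<Rightarrow> 'a::euclidean_space"
  assumes "\<And>k. k \<ge> 1 \<Longrightarrow> x k \<in> borel_measurable N"
  shows "{w \<in> space N. (\<lambda>k. x k w) \<longlonglongrightarrow> xs} \<in> sets N"
proof -
  have [measurable]: "x (Suc k) \<in> borel_measurable N" for k using assms by simp
  have "((\<lambda>k. x k w) \<longlonglongrightarrow> xs) \<longleftrightarrow> (\<forall>m. \<exists>n. \<forall>k\<ge>n. dist (x (Suc k) w) xs < inverse (real (Suc m)))" for w
  proof
    assume "(\<lambda>k. x k w) \<longlonglongrightarrow> xs"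
    then have "(\<lambda>k. x (Suc k) w) \<longlonglongrightarrow> xs" by (rule LIMSEQ_Suc)
    then show "\<forall>m. \<exists>n. \<forall>k\<ge>n. dist (x (Suc k) w) xs < inverse (real (Suc m))" unfolding lim_sequentially by simp
  next
    assume a: "\<forall>m. \<exists>n. \<forall>k\<ge>n. dist (x (Suc k) w) xs < inverse (real (Suc m))"
    have "(\<lambda>k. x (Suc k) w) \<longlonglongrightarrow> xs" unfolding lim_sequentially
    proof (intro allI impI)
      fix r :: real assume "0 < r"
      then obtain m where "inverse (real (Suc m)) < r" using reals_Archimedean by blast
      then show "\<exists>no. \<forall>n\<ge>no. dist (x (Suc n) w) xs < r" using a[rule_format, of m] by (meson less_trans)
    qed
    then show "(\<lambda>k. x k w) \<longlonglongrightarrow> xs" by (rule LIMSEQ_imp_Suc)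
  qed
  then show ?thesis by simp
qed

section \<open>The linearization at the saddle point\<close>

text \<open>Extending the compressed Hessian by the identity adds only the eigenvalue 1 on the
  complement of \<open>C\<close>. So \<open>T\<close> inherits injectivity from the restricted
  Hessian, and its eigenvectors with negative eigenvalue all lie in \<open>C\<close>, where the
  penalty does not act.\<close>

lemma saddle_geometry:
  fixes h :: "real^'m \<Rightarrow> real" and Q :: "real^'m^'m" and U :: "real^'m \<Rightarrow> real^'m^'m"
  defines "C \<equiv> {y. y \<bullet> (Q *v y) = 0}"
  assumes sp: "regular_saddle_point_on h C xs" and psd: "positive_semidefinite Q"
    and U: "\<forall>\<^sub>F y in nhds xs. orthogonal_matrix (U y) \<and>
           (\<exists>H. has_hessian_on h (\<lambda>d. H *v d) y UNIV \<and> diagonal_matrix (transpose (U y) ** H ** U y))"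
    and S: "open S" "xs \<in> S" "higher_differentiable_on S h 3"
  obtains H PC Pm T lam0 e h0 q q1 where "linear H" "\<And>x. norm (H x) \<le> h0 * norm x" "0 < h0"
    "\<And>d. 0 < d \<Longrightarrow> \<exists>r>0. \<forall>y\<in>ball xs r. \<forall>y'\<in>ball xs r. norm (grad h y - grad h y' - H (y - y')) \<le> d * norm (y - y')"
    "linear PC" "\<And>x y. PC x \<bullet> y = x \<bullet> PC y" "\<And>x. PC (PC x) = PC x" "\<And>x. Q *v (PC x) = 0" "\<And>x. PC (Q *v x) = 0"
    "linear Pm" "\<And>x y. Pm x \<bullet> y = x \<bullet> Pm y" "\<And>x. Pm (Pm x) = Pm x" "\<And>x. PC (Pm x) = Pm x"
    "0 < q" "\<And>x. q * (norm (x - PC x))\<^sup>2 \<le> x \<bullet> (Q *v x)" "\<And>x. norm (Q *v x) \<le> q1 * norm (x - PC x)" "0 < q1"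
    "\<And>x. T x = PC (H (PC x)) + (x - PC x)" "\<And>x. T (Pm x) = Pm (T x)" "0 < lam0"
    "\<And>x. Pm x \<bullet> T (Pm x) \<le> - lam0 * (norm (Pm x))\<^sup>2"
    "\<And>x. lam0 * (norm (x - Pm x))\<^sup>2 \<le> (x - Pm x) \<bullet> T (x - Pm x)"
    "norm e = 1" "Pm e = e" "e \<in> C"
proof -
  note adjQ = psd_null_space(1)[OF psd]
  have Cn: "C = {y. Q *v y = 0}" unfolding C_def by (rule psd_null_space(2)[OF psd])
  have linQ: "linear ((*v) Q)" by simp
  have subC: "subspace C" unfolding Cn
    by (auto simp: subspace_def matrix_vector_right_distrib matrix_vector_mult_scaleR)
  \<comment> \<open>Applied to the identity map, the eigenbasis lemma yields an orthonormal basis of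
    \<open>C\<close>.\<close>
  obtain Eb where Eb: "finite Eb" "Eb \<subseteq> C" "span Eb = C" "pairwise orthogonal Eb" "\<forall>e\<in>Eb. norm e = 1"
    using eigenbasis[of "\<lambda>x. x" C, OF linear_ident _ subC] by auto
  define PC where "PC = proj_on Eb"
  have linPC: "linear PC" unfolding PC_def by (rule linear_proj_on)
  have adjPC: "PC x \<bullet> y = x \<bullet> PC y" for x y unfolding PC_def by (rule proj_on_adjoint)
  have PCin: "PC x \<in> C" for x
    unfolding PC_def proj_on_def using Eb by (intro subspace_sum[OF subC] subspace_scale[OF subC]) auto
  have PCid: "PC x = x" if "x \<in> C" for x
    unfolding PC_def proj_on_def using Eb that by (intro orthonormal_expansion) auto
  have idPC: "PC (PC x) = PC x" for x by (rule PCid[OF PCin])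
  have QPC: "Q *v (PC x) = 0" for x using PCin[of x] by (simp add: Cn)
  have PCQ: "PC (Q *v x) = 0" for x
  proof -
    have "PC (Q *v x) \<bullet> y = 0" for y by (simp add: adjPC adjQ QPC)
    then show ?thesis using inner_eq_zero_iff by blast
  qed
  obtain H where H: "linear H" "\<And>x y. H x \<bullet> y = x \<bullet> H y" "(grad h has_derivative H) (at xs)"
    using hessian_from_diagonalization[OF U] by blast
  have strict: "\<exists>r>0. \<forall>y\<in>ball xs r. \<forall>y'\<in>ball xs r. norm (grad h y - grad h y' - H (y - y')) \<le> d * norm (y - y')"
    if "0 < d" for d by (rule grad_strictly_differentiable[OF S H(3) that])
  note diff = C3_imp_C1(1)[OF S(3,1)]
  have sh1: "c = 0" if "c \<in> C" "\<And>c'. c' \<in> C \<Longrightarrow> H c \<bullet> c' = 0" for c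
    by (rule saddle_hessian(1)[OF subC sp H S(1,2) _ _ that]) (auto intro: diff strict)
  have sh2: "\<exists>c\<in>C. c \<bullet> H c < l * (norm c)\<^sup>2" if "0 < l" for l
    by (rule saddle_hessian(2)[OF subC sp H S(1,2) _ _ that]) (auto intro: diff strict)
  obtain h0 where h0: "0 < h0" "\<And>x. norm (H x) \<le> h0 * norm x" using linear_bounded_pos[OF H(1)] by blast
  obtain q1 where q1: "0 < q1" "\<And>x. norm (Q *v x) \<le> q1 * norm x" using linear_bounded_pos[OF linQ] by blast
  have Qz: "Q *v x = Q *v (x - PC x)" for x by (simp add: matrix_vector_mult_diff_distrib QPC)
  have Qzz: "x \<bullet> (Q *v x) = (x - PC x) \<bullet> (Q *v (x - PC x))" for x
    by (metis Qz adjQ inner_commute)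
  obtain q where q: "0 < q" "\<And>z. PC z = 0 \<Longrightarrow> q * (norm z)\<^sup>2 \<le> z \<bullet> (Q *v z)"
  proof -
    have "\<exists>q>0. \<forall>x\<in>{z. PC z = 0}. q * (norm x)\<^sup>2 \<le> x \<bullet> (Q *v x)"
    proof (rule psd_coercive[OF linQ])
      show "subspace {z. PC z = 0}" by (rule linear_subspace_kernel[OF linPC])
      fix z assume z: "z \<in> {z. PC z = 0}" "z \<noteq> 0"
      have "0 \<le> z \<bullet> (Q *v z)" using psd by (simp add: positive_semidefinite_def)
      moreover have "z \<bullet> (Q *v z) \<noteq> 0"
      proof
        assume "z \<bullet> (Q *v z) = 0"
        then have "PC z = z" by (intro PCid) (simp add: C_def)
        then show False using z by simp
      qed
      ultimately show "0 < z \<bullet> (Q *v z)" by simp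
    qed
    then show ?thesis using that by blast
  qed
  have PCz: "PC (x - PC x) = 0" for x by (simp add: linear_diff[OF linPC] idPC)
  define T where "T x = PC (H (PC x)) + (x - PC x)" for x
  have linT: "linear T"
    by (rule linearI) (simp_all add: T_def linear_add[OF linPC] linear_add[OF H(1)] linear_scale[OF linPC] linear_scale[OF H(1)] algebra_simps)
  have adjT: "T x \<bullet> y = x \<bullet> T y" for x y
    by (simp add: T_def inner_add inner_diff adjPC H(2))
  have PCT: "PC (T x) = PC (H (PC x))" for x by (simp add: T_def linear_add[OF linPC] idPC PCz)
  have injT: "x = 0" if "T x = 0" for x
  proof -
    have 1: "PC (H (PC x)) = 0" using PCT[of x] that linear_0[OF linPC] by simp
    then have "x = PC x" using that by (simp add: T_def)
    then have xC: "x \<in> C" using PCin[of x] by simp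
    have "H x \<bullet> c' = 0" if "c' \<in> C" for c'
    proof -
      have "H x \<bullet> c' = H (PC x) \<bullet> PC c'" using PCid[OF that] PCid[OF xC] by simp
      also have "\<dots> = PC (H (PC x)) \<bullet> c'" by (simp add: adjPC)
      finally show ?thesis using 1 by simp
    qed
    then show ?thesis using sh1[OF xC] by blast
  qed
  obtain Pm lam0 where Pm: "linear Pm" "\<And>x y. Pm x \<bullet> y = x \<bullet> Pm y" "\<And>x. Pm (Pm x) = Pm x"
    "\<And>x. T (Pm x) = Pm (T x)" and lam0: "0 < lam0"
    "\<And>x. Pm x \<bullet> T (Pm x) \<le> - lam0 * (norm (Pm x))\<^sup>2"
    "\<And>x. lam0 * (norm (x - Pm x))\<^sup>2 \<le> (x - Pm x) \<bullet> T (x - Pm x)"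
    and ev: "(\<exists>x. x \<bullet> T x < 0) \<Longrightarrow> \<exists>e m. norm e = 1 \<and> Pm e = e \<and> T e = m *\<^sub>R e \<and> m < 0"
    and inN: "\<And>N x. subspace N \<Longrightarrow> (\<And>e m. T e = m *\<^sub>R e \<Longrightarrow> m < 0 \<Longrightarrow> e \<in> N) \<Longrightarrow> Pm x \<in> N"
    using spectral_splitting[OF linT adjT injT] by blast
  have PmC: "Pm x \<in> C" for x
  proof (rule inN[OF subC])
    fix e m assume e: "T e = m *\<^sub>R e" "m < 0"
    have "e - PC e = T e - PC (T e)" unfolding PCT by (simp add: T_def)
    also have "\<dots> = m *\<^sub>R (e - PC e)" by (simp add: e linear_scale[OF linPC] algebra_simps)
    finally have "(1 - m) *\<^sub>R (e - PC e) = 0" by (simp add: algebra_simps)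
    then have "e = PC e" using e by simp
    then show "e \<in> C" using PCin[of e] by simp
  qed
  \<comment> \<open>Otherwise \<open>Pm\<close> would vanish and the Hessian would be coercive on
    \<open>C\<close>, which the saddle property forbids.\<close>
  have "\<exists>x. x \<bullet> T x < 0"
  proof (rule ccontr)
    assume "\<not> ?thesis"
    then have nn: "0 \<le> x \<bullet> T x" for x by (meson not_le)
    have "lam0 * (norm (Pm x))\<^sup>2 \<le> 0" for x using nn[of "Pm x"] lam0(2)[of x] by simp
    then have "Pm x = 0" for x using lam0(1) by (simp add: mult_le_0_iff)
    then have "lam0 * (norm c)\<^sup>2 \<le> c \<bullet> H c" if "c \<in> C" for c
      using lam0(3)[of c] PCid[OF that] adjPC[of c "H c"] by (simp add: T_def)
    then show False using sh2[OF lam0(1)] by (meson not_le)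
  qed
  from ev[OF this] obtain e m where e: "norm e = 1" "Pm e = e" by blast
  have eC: "e \<in> C" using PmC[of e] e by simp
  show ?thesis
  proof (rule that[where H = H and PC = PC and Pm = Pm and T = T and ?lam0.0 = lam0 and e = e and ?h0.0 = h0 and q = q and ?q1.0 = q1])
    show "q * (norm (x - PC x))\<^sup>2 \<le> x \<bullet> (Q *v x)" for x using q(2)[OF PCz[of x]] Qzz[of x] by simp
    show "norm (Q *v x) \<le> q1 * norm (x - PC x)" for x using q1(2)[of "x - PC x"] Qz[of x] by simp
    show "PC (Pm x) = Pm x" for x by (rule PCid[OF PmC])
  qed (fact H(1) h0(1) h0(2) strict linPC adjPC idPC QPC PCQ Pm(1) Pm(2) Pm(3) Pm(4) lam0(1) lam0(2) lam0(3) q1(1) q(1) T_def e(1) e(2) eC)+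
qed

section \<open>The saddle point is avoided\<close>

theorem theorem19:
  fixes h :: "real^'m \<Rightarrow> real"
    and Q :: "real^'m^'m"
    and P :: "'w measure"
    and x v \<xi> :: "nat \<Rightarrow> 'w \<Rightarrow> real^'m"
    and x1 x_star :: "real^'m"
    and \<alpha> \<gamma> :: "nat \<Rightarrow> real"
    and \<tau>\<^sub>\<alpha> \<tau>\<^sub>\<gamma> R C\<^sub>1 C\<^sub>2 B c\<^sub>1 :: real
    and U :: "real^'m \<Rightarrow> real^'m^'m"
  defines "F \<equiv> history P x \<xi>"
    and "C \<equiv> {y. y \<bullet> (Q *v y) = 0}"
  assumes "prob_space P"
    and "\<And>k. k \<ge> 1 \<Longrightarrow> x k \<in> borel_measurable P"
    and "\<And>k. k \<ge> 1 \<Longrightarrow> \<xi> k \<in> borel_measurable P"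
    and "\<And>w. w \<in> space P \<Longrightarrow> x 1 w = x1"
    and "\<And>k w. k \<ge> 1 \<Longrightarrow> w \<in> space P \<Longrightarrow>
           x (Suc k) w = x k w - \<alpha> k *\<^sub>R (v k w + \<gamma> k *\<^sub>R (Q *v x k w) + \<xi> (Suc k) w)"
    and "\<And>k w. k \<ge> 1 \<Longrightarrow> w \<in> space P \<Longrightarrow> v k w \<in> generalized_gradient h (x k w)"
    and "martingale_difference_sequence P F \<xi>"
    and "regular_saddle_point_on h C x_star"
    and "locally_lipschitz h"
    and "R > 0" "C\<^sub>1 > 0" "C\<^sub>2 > 0"
    and "\<And>y u. norm y \<ge> R \<Longrightarrow> u \<in> generalized_gradient h y \<Longrightarrow>
           y \<bullet> u \<ge> C\<^sub>1 * norm y * norm u \<and> norm u \<le> C\<^sub>2 * norm y"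
    and "positive_semidefinite Q"
    and "eigenvalue Q 0"
    and "theta_growth \<alpha> (\<lambda>k. real k powr (- \<tau>\<^sub>\<alpha>))"
    and "theta_growth \<gamma> (\<lambda>k. real k powr \<tau>\<^sub>\<gamma>)"
    and "1 / 2 < \<tau>\<^sub>\<gamma>" "\<tau>\<^sub>\<gamma> < \<tau>\<^sub>\<alpha>" "\<tau>\<^sub>\<alpha> \<le> 1"
    and "\<And>k. k \<ge> 1 \<Longrightarrow> \<alpha> k \<noteq> 0 \<and> \<gamma> k \<noteq> 0"
    and "\<And>k. k \<ge> 1 \<Longrightarrow>
           AE w in P. vec_cond_exp P (F (k - 1)) (\<lambda>w. orthogonal_projection C (\<xi> k w)) w = 0"
    and "B > 0"
    and "\<And>k. k \<ge> 1 \<Longrightarrow>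
           AE w in P. nn_cond_exp P (F (k - 1)) (\<lambda>w. ennreal ((norm (\<xi> k w))\<^sup>2)) w < ennreal B"
    and "c\<^sub>1 > 0"
    and "\<And>k \<theta>. k \<ge> 1 \<Longrightarrow> \<theta> \<in> C \<Longrightarrow> norm \<theta> = 1 \<Longrightarrow>
           AE w in P. real_cond_exp P (F (k - 1)) (\<lambda>w. max 0 (\<xi> k w \<bullet> \<theta>)) w \<ge> c\<^sub>1"
    and "\<forall>\<^sub>F y in nhds x_star. orthogonal_matrix (U y) \<and>
           (\<exists>H. has_hessian_on h (\<lambda>d. H *v d) y UNIV \<and>
                diagonal_matrix (transpose (U y) ** H ** U y))"
    and "U differentiable (at x_star)"
    and "\<exists>S. open S \<and> x_star \<in> S \<and> higher_differentiable_on S h 3"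
  shows "measure P {w \<in> space P. (\<lambda>k. x k w) \<longlonglongrightarrow> x_star} = 0"
proof (rule ccontr)
  note P = assms(3) and xm = assms(4) and \<xi>m = assms(5) and dyn = assms(7) and vin = assms(8) and mds = assms(9)
    and sp = assms(10) and psd = assms(16) and ta = assms(18) and tg = assms(19) and tau = assms(20,21,22)
    and B = assms(25) and second = assms(26) and c1 = assms(27) and exc = assms(28) and Ud = assms(29) and C3 = assms(31)
  interpret prob_space P by (rule P)
  define E where "E = {w \<in> space P. (\<lambda>k. x k w) \<longlonglongrightarrow> x_star}"
  assume "measure P {w \<in> space P. (\<lambda>k. x k w) \<longlonglongrightarrow> x_star} \<noteq> 0"
  then have Epos: "0 < measure P E" by (simp add: E_def zero_less_measure_iff)
  have sub: "subalgebra P (F k)" for k unfolding F_def by (rule history_facts(1)[OF xm \<xi>m])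
  have mono: "sets (F m) \<subseteq> sets (F k)" if "m \<le> k" for m k
    unfolding F_def by (rule history_facts(2)[OF xm \<xi>m that])
  have xF: "x j \<in> borel_measurable (F k)" if "1 \<le> j" "j \<le> k" for j k
    unfolding F_def by (rule history_facts(3)[OF xm \<xi>m that])
  have spF: "space (F k) = space P" for k using sub[of k] by (simp add: subalgebra_def)

  \<comment> \<open>The recursion near the saddle point\<close>
  obtain S where S: "open S" "x_star \<in> S" "higher_differentiable_on S h 3" using C3 by blast
  obtain H PC Pm T lam0 e h0 q q1 where H: "linear H" "\<And>x. norm (H x) \<le> h0 * norm x" "0 < h0"
    and strict: "\<And>d. 0 < d \<Longrightarrow> \<exists>r>0. \<forall>y\<in>ball x_star r. \<forall>y'\<in>ball x_star r. norm (grad h y - grad h y' - H (y - y')) \<le> d * norm (y - y')"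
    and PC: "linear PC" "\<And>x y. PC x \<bullet> y = x \<bullet> PC y" "\<And>x. PC (PC x) = PC x" "\<And>x. Q *v (PC x) = 0" "\<And>x. PC (Q *v x) = 0"
    and Pm: "linear Pm" "\<And>x y. Pm x \<bullet> y = x \<bullet> Pm y" "\<And>x. Pm (Pm x) = Pm x" "\<And>x. PC (Pm x) = Pm x"
    and q: "0 < q" "\<And>x. q * (norm (x - PC x))\<^sup>2 \<le> x \<bullet> (Q *v x)" and q1: "\<And>x. norm (Q *v x) \<le> q1 * norm (x - PC x)" "0 < q1"
    and T: "\<And>x. T x = PC (H (PC x)) + (x - PC x)" "\<And>x. T (Pm x) = Pm (T x)" and lam0: "0 < lam0"
      "\<And>x. Pm x \<bullet> T (Pm x) \<le> - lam0 * (norm (Pm x))\<^sup>2"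
      "\<And>x. lam0 * (norm (x - Pm x))\<^sup>2 \<le> (x - Pm x) \<bullet> T (x - Pm x)"
    and e: "norm e = 1" "Pm e = e" "e \<in> C"
    apply (rule saddle_geometry[OF sp[unfolded C_def] psd Ud S, folded C_def])
    subgoal premises prems by (rule prems(1)[OF prems(2-)])
    done

  have noise: "cond_noise P (F k) (\<xi> (Suc k)) e B c\<^sub>1" for k
  proof (rule cond_noise_from_conditional_moments[OF P sub])
    show "\<xi> (Suc k) \<in> borel_measurable P" using \<xi>m by simp
    show "integrable P (\<xi> (Suc k))" "AE w in P. vec_cond_exp P (F k) (\<xi> (Suc k)) w = 0"
      using mds[unfolded martingale_difference_sequence_def, rule_format, of "Suc k"] by auto
    show "AE w in P. nn_cond_exp P (F k) (\<lambda>w. ennreal ((norm (\<xi> (Suc k) w))\<^sup>2)) w < ennreal B"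
      using second[of "Suc k"] by simp
    show "AE w in P. c\<^sub>1 \<le> real_cond_exp P (F k) (\<lambda>w. max 0 (\<xi> (Suc k) w \<bullet> e)) w"
      using exc[of "Suc k" e] e by simp
  qed (rule B)

  define lam where "lam = lam0 / 2"
  define L where "L = 3 * (h0 + 1)"
  have pos: "0 < lam" "0 < L" "0 < 4 * B" using lam0 H B by (auto simp: lam_def L_def)
  \<comment> \<open>The second moment enters as \<open>4 * B\<close> because the rates refer to the
    noise of the difference of two copies.\<close>
  from rates_exist[OF pos c1] obtain M r0 kap nu eta c2 eps1 g del Gam where rates: "rates lam L (4 * B) c\<^sub>1 M r0 kap nu eta c2 eps1 g del Gam"
    by (elim exE)
  interpret rates lam L "4 * B" "c\<^sub>1" M r0 kap nu eta c2 eps1 g del Gam by (rule rates)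
  have c2p: "0 < c2" and gp: "0 < g" and Mp: "0 < M" using lam kap c1 B M unfolding c2 g by auto
  define del' where "del' = min (del / 4) (min (lam0 / 12) 1)"
  have del': "0 < del'" "del' \<le> del / 4" "12 * del' \<le> lam0" "del' \<le> 1" using del lam0 by (auto simp: del'_def)
  obtain r1 where r1: "0 < r1" "\<And>y y'. y \<in> ball x_star r1 \<Longrightarrow> y' \<in> ball x_star r1 \<Longrightarrow> norm (grad h y - grad h y' - H (y - y')) \<le> del' * norm (y - y')"
    using strict[OF del'(1)] by blast
  obtain r2 where r2: "0 < r2" "ball x_star r2 \<subseteq> S" using S openE by blast
  define \<rho> where "\<rho> = min r1 r2"
  define D where "D = ball x_star \<rho>"
  have D: "open D" "x_star \<in> D" "D \<subseteq> S" "D \<subseteq> ball x_star r1" using r1 r2 by (auto simp: D_def \<rho>_def)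
  note C1 = C3_imp_C1[OF S(3,1)]
  have cont: "continuous_on D (grad h)" using C1(2) D(3) by (rule continuous_on_subset)
  have gg: "generalized_gradient h y = {grad h y}" if "y \<in> D" for y
    using generalized_gradient_C1[OF D(1) that C1(1) cont] D(3) by blast
  \<comment> \<open>Cutting the gradient off outside \<open>D\<close> gives a Borel function on the
    whole space; the recursion is used only at iterates in \<open>D\<close>, where nothing
    changes.\<close>
  define gr where "gr y = indicator D y *\<^sub>R grad h y" for y
  have grm: "gr \<in> borel_measurable borel" unfolding gr_def
    using cont D(1) by (intro borel_measurable_continuous_on_indicator) auto
  define f where "f k y = gr y + \<gamma> k *\<^sub>R (Q *v y)" for k y
  have fm: "f k \<in> borel_measurable borel" for k
  proof -
    have "(*v) Q \<in> borel_measurable borel"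
      by (intro borel_measurable_continuous_onI linear_continuous_on) (simp add: linear_conv_bounded_linear[symmetric])
    then show ?thesis using grm unfolding f_def by measurable
  qed
  have fdyn: "x (Suc k) w = x k w - \<alpha> k *\<^sub>R (f k (x k w) + \<xi> (Suc k) w)" if "1 \<le> k" "w \<in> space P" "x k w \<in> D" for k w
  proof -
    have "v k w = grad h (x k w)" using vin[OF that(1,2)] gg[OF that(3)] by simp
    then show ?thesis using dyn[OF that(1,2)] that(3) by (simp add: f_def gr_def)
  qed

  \<comment> \<open>Step-size conditions at late times\<close>
  note tgr = theta_growth_rates[OF ta tg tau]
  obtain Ca where Ca: "0 < Ca" "\<forall>\<^sub>F n in sequentially. \<forall>k\<ge>n. \<alpha> k \<le> Ca * (\<Sum>j. (\<alpha> (j + n))\<^sup>2)"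
    using tgr(7) by blast
  have small: "\<forall>\<^sub>F k in sequentially. \<alpha> k * c \<le> z" if "0 < z" for c z
  proof -
    have "(\<lambda>k. \<alpha> k * c) \<longlonglongrightarrow> 0" using tendsto_mult_left_zero[OF tgr(2)] .
    then have "\<forall>\<^sub>F k in sequentially. \<alpha> k * c < z" using that by (rule order_tendstoD)
    then show ?thesis by eventually_elim simp
  qed
  have small2: "\<forall>\<^sub>F k in sequentially. 2 * (\<alpha> k * \<gamma> k) * q1\<^sup>2 \<le> q"
  proof -
    have "(\<lambda>k. 2 * (\<alpha> k * \<gamma> k) * q1\<^sup>2) \<longlonglongrightarrow> 2 * 0 * q1\<^sup>2" by (intro tendsto_intros tgr(4))
    then have "\<forall>\<^sub>F k in sequentially. 2 * (\<alpha> k * \<gamma> k) * q1\<^sup>2 < q" using q(1) by (intro order_tendstoD) auto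
    then show ?thesis by eventually_elim simp
  qed
  have big: "\<forall>\<^sub>F k in sequentially. Gam + 2 + 4 * h0\<^sup>2 / del + 16 * h0\<^sup>2 / lam0 \<le> \<gamma> k * q"
  proof -
    have "\<forall>\<^sub>F k in sequentially. (Gam + 2 + 4 * h0\<^sup>2 / del + 16 * h0\<^sup>2 / lam0) / q \<le> \<gamma> k"
      using tgr(5) unfolding filterlim_at_top by blast
    then show ?thesis by eventually_elim (use q(1) in \<open>simp add: pos_divide_le_eq\<close>)
  qed
  have dl: "0 < del / 4" "0 < lam0 / 4" using del lam0 by auto
  have "\<forall>\<^sub>F k in sequentially. 0 < \<alpha> k \<and> 0 < \<gamma> k \<and> \<alpha> k * lam \<le> 1 \<and> \<alpha> k * c2 \<le> 1 \<and> \<alpha> k * (h0 + 1) \<le> 1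
    \<and> \<alpha> k * (4 * (h0 + 1)\<^sup>2) \<le> del / 4 \<and> \<alpha> k * (4 * (h0 + 1)\<^sup>2) \<le> lam0 / 4 \<and> 2 * (\<alpha> k * \<gamma> k) * q1\<^sup>2 \<le> q
    \<and> Gam + 2 + 4 * h0\<^sup>2 / del + 16 * h0\<^sup>2 / lam0 \<le> \<gamma> k * q \<and> \<alpha> k * (eps1 * M\<^sup>2) \<le> 1 \<and> \<alpha> k * eps1 \<le> 1"
    by (intro eventually_conj tgr(1,3) small small2 big dl zero_less_one)
  then obtain n1 where n1: "\<And>k. n1 \<le> k \<Longrightarrow> 0 < \<alpha> k \<and> 0 < \<gamma> k \<and> \<alpha> k * lam \<le> 1 \<and> \<alpha> k * c2 \<le> 1 \<and> \<alpha> k * (h0 + 1) \<le> 1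
    \<and> \<alpha> k * (4 * (h0 + 1)\<^sup>2) \<le> del / 4 \<and> \<alpha> k * (4 * (h0 + 1)\<^sup>2) \<le> lam0 / 4 \<and> 2 * (\<alpha> k * \<gamma> k) * q1\<^sup>2 \<le> q
    \<and> Gam + 2 + 4 * h0\<^sup>2 / del + 16 * h0\<^sup>2 / lam0 \<le> \<gamma> k * q \<and> \<alpha> k * (eps1 * M\<^sup>2) \<le> 1 \<and> \<alpha> k * eps1 \<le> 1"
    unfolding eventually_sequentially by blast
  obtain n2 where n2: "\<And>n k. n2 \<le> n \<Longrightarrow> n \<le> k \<Longrightarrow> \<alpha> k \<le> Ca * (\<Sum>j. (\<alpha> (j + n))\<^sup>2)"
    using Ca(2) unfolding eventually_sequentially by blast

  \<comment> \<open>With \<open>\<sigma>\<^sup>2 = K0 * sm\<close> the bound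
    \<open>\<alpha> k \<le> Ca * sm\<close> becomes
    \<open>\<alpha> k \<le> eps1 * \<sigma>\<^sup>2\<close>, and the squared noise amplitudes sum to
    \<open>1 / K0\<close>. So the fraction \<open>p\<close> lost by the Lyapunov function does not
    depend on the starting time.\<close>
  define K0 where "K0 = Ca / eps1"
  have K0: "0 < K0" using Ca eps1 by (simp add: K0_def)
  define p where "p = 1 - exp (- g * (1 / K0))"
  have p: "0 < p" "p < 1" using gp K0 by (auto simp: p_def)

  \<comment> \<open>Convergence allows finitely many excursions from \<open>D\<close>;
    \<open>En n\<close> excludes those from time \<open>n\<close> on. The maximum with 1 skips the
    unconstrained \<open>x 0\<close>.\<close>
  define En where "En n = {w \<in> E. \<forall>k\<ge>max 1 n. x k w \<in> D}" for n
  have EM: "E \<in> sets P" unfolding E_def by (rule convergence_set_measurable[OF xm])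
  \<comment> \<open>Approximation by events of the past requires the limit event to lie in the
    \<sigma>-algebra generated by the filtration, not merely in that of \<open>P\<close>.\<close>
  have EF: "E \<in> sigma_sets (space P) (\<Union>n. sets (F n))"
  proof -
    define G where "G = sigma (space P) (\<Union>n. sets (F n))"
    have "(\<Union>n. sets (F n)) \<subseteq> Pow (space P)" using sets.sets_into_space spF by blast
    then have G: "sets G = sigma_sets (space P) (\<Union>n. sets (F n))" "space G = space P"
      by (simp_all add: G_def sets_measure_of space_measure_of)
    have "x k \<in> borel_measurable G" if "1 \<le> k" for k
    proof (rule measurableI)
      fix A :: "(real^'m) set" assume "A \<in> sets borel"
      then have "x k -` A \<inter> space P \<in> sets (F k)" using measurable_sets[OF xF[OF that order_refl]] spF by simp
      then show "x k -` A \<inter> space G \<in> sets G" unfolding G by (intro sigma_sets.Basic) blast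
    qed simp
    from convergence_set_measurable[of x G, OF this, of x_star] show ?thesis by (simp add: G E_def)
  qed
  have EnM: "En n \<in> sets P" for n
  proof -
    have "En n = E \<inter> (\<Inter>k\<in>{max 1 n..}. x k -` D \<inter> space P)" by (auto simp: En_def E_def)
    moreover have "(\<Inter>k\<in>{max 1 n..}. x k -` D \<inter> space P) \<in> sets P"
    proof (rule sets.countable_INT')
      have "x k -` D \<inter> space P \<in> sets P" if "k \<in> {max 1 n..}" for k
        using that D(1) by (intro measurable_sets[OF xm]) auto
      then show "(\<lambda>k. x k -` D \<inter> space P) ` {max 1 n..} \<subseteq> sets P" by blast
    qed auto
    ultimately show ?thesis using EM by auto
  qed
  have Eninc: "incseq En" by (auto simp: incseq_def En_def)
  have EnU: "(\<Union>n. En n) = E"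
  proof -
    have "w \<in> (\<Union>n. En n)" if w: "w \<in> E" for w
    proof -
      have "\<forall>\<^sub>F k in sequentially. x k w \<in> D"
        using w D(1,2) by (auto simp: E_def intro: topological_tendstoD)
      then obtain n where "\<forall>k\<ge>n. x k w \<in> D" unfolding eventually_sequentially by blast
      then show ?thesis using w by (auto simp: En_def)
    qed
    then show ?thesis by (auto simp: En_def)
  qed
  obtain n A where n: "max 1 (max n1 n2) \<le> n" and A: "A \<in> sets (F n)" "0 < measure P A" "measure P (A - En n) \<le> p / 4 * measure P A"
    using approx_large[OF sub mono EF EnM Eninc EnU Epos, of "p / 4" "max 1 (max n1 n2)"] p by auto
  have n': "1 \<le> n" "n1 \<le> n" "n2 \<le> n" using n by auto

  \<comment> \<open>The scale and the starting event\<close>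
  define sm where "sm = (\<Sum>j. (\<alpha> (j + n))\<^sup>2)"
  have summ: "summable (\<lambda>j. (\<alpha> (j + n))\<^sup>2)" by (rule summable_ignore_initial_segment[OF tgr(6)])
  have smp: "0 < sm"
  proof -
    have "0 < \<alpha> n" using n1[OF n'(2)] by blast
    also have "\<dots> \<le> Ca * sm" using n2[OF n'(3) order_refl] by (simp add: sm_def)
    finally show ?thesis using Ca(1) by (simp add: zero_less_mult_iff)
  qed
  define \<sigma> where "\<sigma> = sqrt (K0 * sm)"
  have sg: "0 < \<sigma>" "\<sigma>\<^sup>2 = K0 * sm" using K0 smp by (auto simp: \<sigma>_def)
  \<comment> \<open>Chosen so that the Lyapunov function starts at no more than
    \<open>1 + p / 2\<close>.\<close>
  define r where "r = \<sigma> * sqrt (p / (2 * kap))"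
  have r: "0 < r" "kap * (r / \<sigma>)\<^sup>2 \<le> p / 2" using sg p kap by (auto simp: r_def)
  obtain A' where A': "A' \<in> sets (F n)" "A' \<subseteq> A" "0 < measure P A'" "measure P (A' - En n) \<le> p / 4 * measure P A'"
    "\<And>w w'. w \<in> A' \<Longrightarrow> w' \<in> A' \<Longrightarrow> norm (x n w - x n w') \<le> r"
    using localize_cell[OF xF[OF n'(1) order_refl] sub A(1) EnM A(2,3) r(1)] by blast
  \<comment> \<open>Staying in \<open>D\<close> up to time \<open>k\<close> is an event of
    \<open>F k\<close> and may serve as a weight, unlike \<open>En n\<close>, which looks at the
    whole future.\<close>
  define al where "al k = {w \<in> A'. \<forall>j\<in>{n..k}. x j w \<in> D}" for k
  have A'P: "A' \<in> sets P" using A'(1) sub[of n] by (auto simp: subalgebra_def)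
  have A'sp: "A' \<subseteq> space P" using sets.sets_into_space[OF A'P] .
  have alF: "al k \<in> sets (F k)" if "n \<le> k" for k
  proof -
    have eq: "al k = A' \<inter> (\<Inter>j\<in>{n..k}. x j -` D \<inter> space (F k))" using A'sp that by (auto simp: al_def spF)
    have "x j -` D \<inter> space (F k) \<in> sets (F k)" if "j \<in> {n..k}" for j
      using that D(1) n' by (intro measurable_sets[OF xF]) auto
    then have "(\<Inter>j\<in>{n..k}. x j -` D \<inter> space (F k)) \<in> sets (F k)"
      using that by (intro sets.finite_INT) auto
    moreover have "A' \<in> sets (F k)" using A'(1) mono[OF that] by blast
    ultimately show ?thesis unfolding eq by (rule sets.Int[rotated])
  qed
  have alP: "al k \<in> sets P" if "n \<le> k" for k using alF[OF that] sub[of k] by (auto simp: subalgebra_def)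

  \<comment> \<open>Rescaling commutes with the linear part and preserves the relative size of the
    error, so the drift keeps the step \<open>\<alpha> k\<close> while the noise enters with
    amplitude \<open>\<alpha> k / \<sigma>\<close>.\<close>
  have drift: "drift_step (\<alpha> k) (Pm d) (d - Pm d) (norm (d - PC d)) (Pm (d - (\<alpha> k / \<sigma>) *\<^sub>R (f k y - f k y')))
        ((d - (\<alpha> k / \<sigma>) *\<^sub>R (f k y - f k y')) - Pm (d - (\<alpha> k / \<sigma>) *\<^sub>R (f k y - f k y')))"
    if k: "n \<le> k" and y: "y \<in> D" "y' \<in> D" and d: "d = (y - y') /\<^sub>R \<sigma>" for k y y' d
  proof -
    define er where "er = (grad h y - grad h y' - H (y - y')) /\<^sub>R \<sigma>"
    define ff where "ff = H d + er + \<gamma> k *\<^sub>R (Q *v d)"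
    have Hd: "H d = H (y - y') /\<^sub>R \<sigma>" unfolding d by (rule linear_scale[OF H(1)])
    have Qd: "Q *v d = (Q *v y - Q *v y') /\<^sub>R \<sigma>"
      unfolding d by (simp only: matrix_vector_mult_scaleR matrix_vector_mult_diff_distrib)
    have "ff = (f k y - f k y') /\<^sub>R \<sigma>"
      using y by (simp add: ff_def er_def Hd Qd f_def gr_def scaleR_diff_right scaleR_add_right mult.commute)
    then have sc: "\<alpha> k *\<^sub>R ff = (\<alpha> k / \<sigma>) *\<^sub>R (f k y - f k y')" by (simp add: divide_inverse)
    have "norm er \<le> del' * norm d"
    proof -
      have "norm er = norm (grad h y - grad h y' - H (y - y')) / \<sigma>" using sg by (simp add: er_def divide_inverse mult.commute)
      also have "\<dots> \<le> (del' * norm (y - y')) / \<sigma>"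
        by (rule divide_right_mono[OF r1(2)[OF subsetD[OF D(4) y(1)] subsetD[OF D(4) y(2)]] less_imp_le[OF sg(1)]])
      also have "\<dots> = del' * norm d" using sg by (simp add: d divide_inverse mult_ac)
      finally show ?thesis .
    qed
    moreover have kk: "0 < \<alpha> k \<and> 0 < \<gamma> k \<and> \<alpha> k * lam \<le> 1 \<and> \<alpha> k * c2 \<le> 1 \<and> \<alpha> k * (h0 + 1) \<le> 1
      \<and> \<alpha> k * (4 * (h0 + 1)\<^sup>2) \<le> del / 4 \<and> \<alpha> k * (4 * (h0 + 1)\<^sup>2) \<le> lam0 / 4 \<and> 2 * (\<alpha> k * \<gamma> k) * q1\<^sup>2 \<le> q
      \<and> Gam + 2 + 4 * h0\<^sup>2 / del + 16 * h0\<^sup>2 / lam0 \<le> \<gamma> k * q" using n1[of k] n' k by linarith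
    ultimately have "drift_step (\<alpha> k) (Pm d) (d - Pm d) (norm (d - PC d)) (Pm (d - \<alpha> k *\<^sub>R ff)) ((d - \<alpha> k *\<^sub>R ff) - Pm (d - \<alpha> k *\<^sub>R ff))"
      by (intro drift_verification[where Q = "\<lambda>y. Q *v y" and q = q and ?q1.0 = q1 and T = T and ?lam0.0 = lam0 and H = H
            and ?h0.0 = h0 and er = er and del' = del' and gam = "\<gamma> k" and f = ff])
        (use Pm PC H q q1 T lam0 del' in \<open>auto simp: lam_def L_def ff_def\<close>)
    then show ?thesis unfolding sc .
  qed

  have bk: "(\<alpha> k / \<sigma>)\<^sup>2 \<le> eps1 * \<alpha> k" "\<alpha> k / \<sigma> * M \<le> 1" "(\<alpha> k / \<sigma>)\<^sup>2 \<le> 1" "0 < \<alpha> k" if k: "n \<le> k" for k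
  proof -
    have nk: "0 < \<alpha> k" "\<alpha> k * (eps1 * M\<^sup>2) \<le> 1" "\<alpha> k * eps1 \<le> 1" using n1[of k] n' k by auto
    have "\<alpha> k \<le> Ca * sm" using n2[OF n'(3) k] by (simp add: sm_def)
    also have "\<dots> = eps1 * \<sigma>\<^sup>2" using eps1 by (simp add: sg K0_def)
    finally have "\<alpha> k * \<alpha> k \<le> \<alpha> k * (eps1 * \<sigma>\<^sup>2)" using nk by (intro mult_left_mono) auto
    then have "(\<alpha> k)\<^sup>2 / \<sigma>\<^sup>2 \<le> eps1 * \<alpha> k" using sg(1) by (simp add: pos_divide_le_eq power2_eq_square mult_ac)
    then show 1: "(\<alpha> k / \<sigma>)\<^sup>2 \<le> eps1 * \<alpha> k" by (simp add: power_divide)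
    then show "(\<alpha> k / \<sigma>)\<^sup>2 \<le> 1" using nk by (simp add: mult.commute)
    have "(\<alpha> k / \<sigma> * M)\<^sup>2 \<le> eps1 * \<alpha> k * M\<^sup>2" unfolding power_mult_distrib[of "\<alpha> k / \<sigma>" M] using 1 by (intro mult_right_mono) auto
    also have "\<dots> \<le> 1\<^sup>2" using nk by (simp add: mult_ac)
    finally show "\<alpha> k / \<sigma> * M \<le> 1" by (rule power2_le_imp_le) simp
    show "0 < \<alpha> k" by (rule nk)
  qed

  have noise': "cond_noise P (F k) (\<xi> (Suc k)) e (4 * B / 4) c\<^sub>1" for k using noise by simp
  have prem: "al (Suc k) \<subseteq> al k" "\<And>w. w \<in> al k \<Longrightarrow> x (Suc k) w = x k w - \<alpha> k *\<^sub>R (f k (x k w) + \<xi> (Suc k) w)"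
     "\<And>w w'. w \<in> al k \<Longrightarrow> w' \<in> al k \<Longrightarrow> norm (x k w - x k w') \<le> 2 * \<rho>" if k: "n \<le> k" for k
  proof -
    show "al (Suc k) \<subseteq> al k" by (auto simp: al_def)
    have inD: "x k w \<in> D" if "w \<in> al k" for w using that k by (auto simp: al_def)
    show "x (Suc k) w = x k w - \<alpha> k *\<^sub>R (f k (x k w) + \<xi> (Suc k) w)" if "w \<in> al k" for w
      using fdyn[of k w] inD[OF that] that A'sp k n' by (auto simp: al_def)
    show "norm (x k w - x k w') \<le> 2 * \<rho>" if "w \<in> al k" "w' \<in> al k" for w w'
      using inD[OF that(1)] inD[OF that(2)] dist_triangle3[of "x k w" "x k w'" x_star] by (simp add: D_def dist_norm)
  qed
  define E0 where "E0 = En n \<inter> A'"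
  have E0P: "E0 \<in> sets P" using EnM A'P by (auto simp: E0_def)
  have E0al: "E0 \<subseteq> al k" if "n \<le> k" for k using n'(1) by (auto simp: E0_def al_def En_def)
  have sums: "(\<lambda>j. (\<alpha> (j + n) / \<sigma>)\<^sup>2) sums (1 / K0)"
  proof -
    have "(\<lambda>j. (\<alpha> (j + n))\<^sup>2 / \<sigma>\<^sup>2) sums (sm / \<sigma>\<^sup>2)"
      using summ unfolding sm_def by (intro sums_divide summable_sums)
    then show ?thesis using smp by (simp add: power_divide sg(2))
  qed
  have Pmn: "norm (v - Pm v) \<le> norm v" for v
  proof -
    have "v \<bullet> Pm v = (norm (Pm v))\<^sup>2" by (simp add: power2_norm_eq_inner Pm(2,3))
    then have "(norm (v - Pm v))\<^sup>2 = (norm v)\<^sup>2 - (norm (Pm v))\<^sup>2"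
      by (simp add: power2_norm_eq_inner inner_diff inner_commute)
    then have "(norm (v - Pm v))\<^sup>2 \<le> (norm v)\<^sup>2" by simp
    then show ?thesis by (rule power2_le_imp_le) simp
  qed
  have bound: "(measure P E0)\<^sup>2 \<le> exp (- g * (1 / K0)) * ((1 + p / 2) * (measure P (al n))\<^sup>2)"
  proof (rule probability_bound[where x = x and al = al and n = n and \<alpha> = \<alpha> and xs = x_star and \<sigma> = \<sigma> and r = r and Pm = Pm, OF P alP[OF order_refl] E0P E0al _ _ Pm(1) Pmn sg(1) _ r(2) _ _ sums])
    show "x k \<in> borel_measurable P" if "n \<le> k" for k using xm n' that by simp
    show "(\<lambda>k. x k w) \<longlonglongrightarrow> x_star" if "w \<in> E0" for w using that by (auto simp: E0_def En_def E_def)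
    show "norm (x n w - x n w') \<le> r" if "w \<in> al n" "w' \<in> al n" for w w' using A'(5)[of w w'] that by (auto simp: al_def)
    fix k assume k: "n \<le> k"
    have dr: "\<exists>z. drift_step (\<alpha> k)
        (Pm ((x k w - x k w') /\<^sub>R \<sigma>)) ((x k w - x k w') /\<^sub>R \<sigma> - Pm ((x k w - x k w') /\<^sub>R \<sigma>)) z
        (Pm ((x k w - x k w') /\<^sub>R \<sigma> - (\<alpha> k / \<sigma>) *\<^sub>R (f k (x k w) - f k (x k w'))))
        (((x k w - x k w') /\<^sub>R \<sigma> - (\<alpha> k / \<sigma>) *\<^sub>R (f k (x k w) - f k (x k w')))
          - Pm ((x k w - x k w') /\<^sub>R \<sigma> - (\<alpha> k / \<sigma>) *\<^sub>R (f k (x k w) - f k (x k w'))))"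
      if "w \<in> al k" "w' \<in> al k" for w w'
      using drift[OF k, of "x k w" "x k w'", OF _ _ refl] that k by (auto simp: al_def)
    have k': "1 \<le> k" "n \<le> Suc k" "1 \<le> Suc k" using k n' by auto
    note dk = product_decay[where x = x and N = \<xi> and f = f and e = e and al = al and \<sigma> = \<sigma> and \<rho> = "2 * \<rho>" and k = k and F = F and \<alpha> = \<alpha>,
      OF P sub xF[OF k'(1) order_refl] alF[OF k] alP[OF k'(2)] prem(1)[OF k] prem(2)[OF k] fm xm[OF k'(3)] noise' Pm(1,2,3) e(2,1) sg(1) bk(4)[OF k] dr prem(3)[OF k] bk(1,2,3)[OF k]]
    show "integrable (P \<Otimes>\<^sub>M P) (\<lambda>z. indicator (al (Suc k) \<times> al (Suc k)) z *
        lyapunov (Pm ((x (Suc k) (fst z) - x (Suc k) (snd z)) /\<^sub>R \<sigma>)) ((x (Suc k) (fst z) - x (Suc k) (snd z)) /\<^sub>R \<sigma> - Pm ((x (Suc k) (fst z) - x (Suc k) (snd z)) /\<^sub>R \<sigma>)))"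
      using dk(1) by simp
    show "(\<integral>z. indicator (al (Suc k) \<times> al (Suc k)) z *
        lyapunov (Pm ((x (Suc k) (fst z) - x (Suc k) (snd z)) /\<^sub>R \<sigma>)) ((x (Suc k) (fst z) - x (Suc k) (snd z)) /\<^sub>R \<sigma> - Pm ((x (Suc k) (fst z) - x (Suc k) (snd z)) /\<^sub>R \<sigma>)) \<partial>(P \<Otimes>\<^sub>M P))
      \<le> (1 - g * (\<alpha> k / \<sigma>)\<^sup>2) * (\<integral>z. indicator (al k \<times> al k) z *
        lyapunov (Pm ((x k (fst z) - x k (snd z)) /\<^sub>R \<sigma>)) ((x k (fst z) - x k (snd z)) /\<^sub>R \<sigma> - Pm ((x k (fst z) - x k (snd z)) /\<^sub>R \<sigma>)) \<partial>(P \<Otimes>\<^sub>M P))"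
      using dk(2) by simp
  qed
  define a where "a = measure P A'"
  have a: "0 < a" using A'(3) by (simp add: a_def)
  have le: "(1 - p / 4) * a \<le> measure P E0"
  proof -
    have "E0 = A' - (A' - En n)" by (auto simp: E0_def)
    then have "measure P E0 = a - measure P (A' - En n)"
      unfolding a_def using A'P EnM by (metis Diff_subset finite_measure_Diff sets.Diff)
    then show ?thesis using A'(4) by (simp add: a_def algebra_simps)
  qed
  have "measure P (al n) \<le> a" unfolding a_def using A'P by (intro finite_measure_mono) (auto simp: al_def)
  then have "(measure P (al n))\<^sup>2 \<le> a\<^sup>2" by (intro power_mono) auto
  then have "exp (- g * (1 / K0)) * ((1 + p / 2) * (measure P (al n))\<^sup>2) \<le> (1 - p) * ((1 + p / 2) * a\<^sup>2)"
    using p by (intro mult_mono) (auto simp: p_def)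
  then have up: "(measure P E0)\<^sup>2 \<le> (1 - p) * ((1 + p / 2) * a\<^sup>2)" using bound by linarith
  have "((1 - p / 4) * a)\<^sup>2 \<le> (measure P E0)\<^sup>2" using le p a by (intro power_mono) auto
  then have "(1 - p / 4)\<^sup>2 * a\<^sup>2 \<le> ((1 - p) * (1 + p / 2)) * a\<^sup>2" using up by (simp add: power_mult_distrib mult.assoc)
  \<comment> \<open>The left side is 1 - p/2 + p^2/16 and the right side 1 - p/2 - p^2/2. The
    tolerances \<open>p / 4\<close> for the event and \<open>p / 2\<close> for the initial value are
    calibrated so that the first-order terms cancel and the quadratic terms contradict each
    other.\<close>
  then have "(1 - p / 4)\<^sup>2 \<le> (1 - p) * (1 + p / 2)" using a by (simp add: mult_le_cancel_right)
  then have "p\<^sup>2 \<le> 0" by (simp add: power2_eq_square field_simps)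
  then show False using p by simp
qed

end
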